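(* There exist an uncountable family $(G_j)_{j\in J}$ of pairwise non-isomorphic, residually finite $18$-generator groups, a residually finite $6$-generator group $A$, and embeddings (injective group homomorphisms) $\iota_j\colon A\to G_j$ ($j\in J$) such that the following properties hold: (1) for every $j\in J$ the induced homomorphism $\widehat{\iota_j}\colon\widehat{A}\to\widehat{G_j}$ of profinite completions is an isomorphism; (2) $A$ is amenable; (3) each $G_j$ contains a non-abelian free subgroup. In particular, amenability is not a profinite invariant of finitely generated residually finite groups, i.e. there are finitely generated residually finite groups with isomorphic profinite completions one of which is amenable and the other is not.
   Context: A $k$-generator group is a group that can be generated by $k$ elements. The profinite completion of a group $G$ is $\widehat{G}=\varprojlim_{N} G/N$, where $N$ ranges over the normal subgroups of finite index in $G$; a homomorphism $\iota\colon H\to G$ induces a continuous homomorphism $\widehat{\iota}\colon\widehat{H}\to\widehat{G}$. *)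

theory Defs
  imports
    "HOL-Algebra.Product_Groups"
    "HOL-Algebra.Generated_Groups"
    "HOL-Analysis.Function_Topology"
begin

definition generated_by_at_most :: "nat \<Rightarrow> ('a, 'b) monoid_scheme \<Rightarrow> bool" where
  "generated_by_at_most k G \<longleftrightarrow>
     (\<exists>S \<subseteq> carrier G. finite S \<and> card S \<le> k \<and> generate G S = carrier G)"

definition finitely_generated :: "('a, 'b) monoid_scheme \<Rightarrow> bool" where
  "finitely_generated G \<longleftrightarrow> (\<exists>S \<subseteq> carrier G. finite S \<and> generate G S = carrier G)"

definition finite_index_normals :: "('a, 'b) monoid_scheme \<Rightarrow> 'a set set" where
  "finite_index_normals G = {N. N \<lhd> G \<and> finite (rcosets\<^bsub>G\<^esub> N)}"

definition residually_finite :: "('a, 'b) monoid_scheme \<Rightarrow> bool" where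
  "residually_finite G \<longleftrightarrow>
     (\<forall>g \<in> carrier G. g \<noteq> \<one>\<^bsub>G\<^esub> \<longrightarrow> (\<exists>N \<in> finite_index_normals G. g \<notin> N))"

text \<open>
  The inverse limit is realised as the subgroup of compatible families in the product of all
  finite quotients. For \<open>N \<subseteq> M\<close> the projection \<open>G Mod N \<rightarrow> G Mod M\<close> sends a coset \<open>C\<close> of \<open>N\<close>
  to the product set \<open>M <#> C\<close>, the coset of \<open>M\<close> containing it.
\<close>
definition profinite_completion :: "('a, 'b) monoid_scheme \<Rightarrow> ('a set \<Rightarrow> 'a set) monoid" where
  "profinite_completion G =
     (product_group (finite_index_normals G) (\<lambda>N. G Mod N))
       \<lparr>carrier := {x \<in> carrier (product_group (finite_index_normals G) (\<lambda>N. G Mod N)).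
          \<forall>N \<in> finite_index_normals G. \<forall>M \<in> finite_index_normals G.
            N \<subseteq> M \<longrightarrow> M <#>\<^bsub>G\<^esub> x N = x M}\<rparr>"

definition profinite_completion_topology ::
    "('a, 'b) monoid_scheme \<Rightarrow> ('a set \<Rightarrow> 'a set) topology" where
  "profinite_completion_topology G =
     subtopology
       (product_topology (\<lambda>N. discrete_topology (carrier (G Mod N))) (finite_index_normals G))
       (carrier (profinite_completion G))"

text \<open>
  The \<open>N\<close>-component of the image of \<open>x\<close> is obtained from the component of \<open>x\<close> at the preimage
  of \<open>N\<close> via the homomorphism of quotients \<open>H Mod f\<^sup>-\<^sup>1(N) \<rightarrow> G Mod N\<close> induced by \<open>f\<close>,
  under which a coset \<open>C\<close> goes to the coset \<open>N <#> f ` C\<close>.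
\<close>
definition profinite_map ::
    "('a, 'b) monoid_scheme \<Rightarrow> ('c, 'd) monoid_scheme \<Rightarrow> ('a \<Rightarrow> 'c) \<Rightarrow>
      ('a set \<Rightarrow> 'a set) \<Rightarrow> 'c set \<Rightarrow> 'c set" where
  "profinite_map H G f x =
     (\<lambda>N \<in> finite_index_normals G. N <#>\<^bsub>G\<^esub> (f ` x {h \<in> carrier H. f h \<in> N}))"

text \<open>Isomorphism of profinite completions means isomorphism of topological groups.\<close>
definition profinite_iso ::
    "('a, 'b) monoid_scheme \<Rightarrow> ('c, 'd) monoid_scheme \<Rightarrow>
      (('a set \<Rightarrow> 'a set) \<Rightarrow> 'c set \<Rightarrow> 'c set) \<Rightarrow> bool" where
  "profinite_iso H G F \<longleftrightarrow>
     F \<in> iso (profinite_completion H) (profinite_completion G) \<and>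
     homeomorphic_map (profinite_completion_topology H) (profinite_completion_topology G) F"

text \<open>
  Amenability of a discrete group, by a left-invariant finitely additive probability measure
  defined on all subsets of the group.
\<close>
definition amenable :: "('a, 'b) monoid_scheme \<Rightarrow> bool" where
  "amenable G \<longleftrightarrow>
     (\<exists>\<mu> :: 'a set \<Rightarrow> real.
        (\<forall>B \<subseteq> carrier G. 0 \<le> \<mu> B) \<and>
        \<mu> (carrier G) = 1 \<and>
        (\<forall>B \<subseteq> carrier G. \<forall>C \<subseteq> carrier G. B \<inter> C = {} \<longrightarrow> \<mu> (B \<union> C) = \<mu> B + \<mu> C) \<and>
        (\<forall>g \<in> carrier G. \<forall>B \<subseteq> carrier G. \<mu> (g <#\<^bsub>G\<^esub> B) = \<mu> B))"

text \<open>
  In words, \<open>(x, True)\<close> stands for the letter \<open>x\<close> and \<open>(x, False)\<close> for its formal inverse.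
\<close>
definition reduced_words :: "'a set \<Rightarrow> ('a \<times> bool) list set" where
  "reduced_words X =
     {w. set w \<subseteq> X \<times> UNIV \<and>
         successively (\<lambda>(x, b) (y, c). \<not> (x = y \<and> b \<noteq> c)) w}"

definition word_value :: "('a, 'b) monoid_scheme \<Rightarrow> ('a \<times> bool) list \<Rightarrow> 'a" where
  "word_value G w =
     foldr (\<lambda>(x, b) g. (if b then x else inv\<^bsub>G\<^esub> x) \<otimes>\<^bsub>G\<^esub> g) w \<one>\<^bsub>G\<^esub>"

text \<open>
  A group is free on \<open>X\<close> if each of its elements is the value of exactly one reduced word
  in \<open>X\<close> and its formal inverses.
\<close>
definition free_on :: "('a, 'b) monoid_scheme \<Rightarrow> 'a set \<Rightarrow> bool" where
  "free_on G X \<longleftrightarrow>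
     group G \<and> X \<subseteq> carrier G \<and> bij_betw (word_value G) (reduced_words X) (carrier G)"

definition contains_nonabelian_free_subgroup :: "('a, 'b) monoid_scheme \<Rightarrow> bool" where
  "contains_nonabelian_free_subgroup G \<longleftrightarrow>
     (\<exists>F. subgroup F G \<and> (\<exists>X. free_on (G\<lparr>carrier := F\<rparr>) X) \<and>
          \<not> comm_group (G\<lparr>carrier := F\<rparr>))"

end

theory Submission
  imports Defs "HOL-Combinatorics.Permutations"
begin

text \<open>
  All groups are groups of permutations of one countable set, arranged so that every finite quotient
  is visible in finitely many coordinates; this follows B. H. Neumann's use of subgroups of products
  of finite groups. For \<open>n > 0\<close> the points \<open>(n, i, y)\<close> form a finite block whose rows \<open>i\<close>, of which there
  are \<open>5 * 8 ^ n\<close>, are copies of the sheet \<open>(\<int>/n)\<^sup>2\<close>; the points with \<open>n = 0\<close> form copies of the line \<open>\<int>\<close>.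
  The shift rotates the rows of every block and translates the line. A twisted three-cycle permutes
  three consecutive rows \<open>s, s + 1, s + 2\<close> of every block and applies the \<open>z\<close>-th power of a fixed
  matrix modulo \<open>n\<close> to the sheet when it moves a row by \<open>z\<close>. The amenable group \<open>A\<close> is generated by the
  shift and by three such cycles, with twists the identity, the upper and the lower elementary matrix
  with entry 3, starting at the rows \<open>8 ^ n\<close>, \<open>2 * 8 ^ n\<close> and \<open>3 * 8 ^ n\<close>. For an infinite set \<open>X\<close> of
  natural numbers, \<open>G X\<close> is generated by \<open>A\<close> and two more cycles at the rows \<open>8 ^ n\<close>, with the two
  nontrivial twists, the second one acting only in the blocks \<open>n \<in> Suc ` X\<close>. The formal names of these
  groups are \<open>grpA\<close> and \<open>grpG X\<close>.

  Amenability of \<open>A\<close> (\<open>amenable_grpA\<close>): the three kinds of cycles sit in windows whose distances grow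
  with \<open>n\<close>. A constant twist can be removed by rescaling the rows, so in all but finitely many blocks
  finitely many shifted cycles generate three commuting finite groups, each independent of \<open>n\<close>.
  Hence the shifted cycles generate a locally finite group, and adjoining the shift keeps it amenable
  (\<open>amenable_locally_finite_by_int\<close>).

  Free subgroups (\<open>inj_on_word_value_free_gen\<close>): in \<open>G X\<close> an untwisted and a twisted cycle share a
  window, and the quotient of the two maps a row to itself through the matrix that twists. The two
  elementary matrices with entry 3 generate a free group, by ping-pong on \<open>\<int>\<^sup>2\<close>, and a nontrivial word
  stays nontrivial modulo every large \<open>n\<close>.

  Profinite completions: three-cycles \<open>x\<close>, \<open>x1\<close>, \<open>x2\<close> starting at rows \<open>s\<close>, \<open>s + 1\<close>, \<open>s + 2\<close>, with
  the same twist, satisfy \<open>x1\<inverse> [x, x2] x1 = x\<inverse>\<close> (\<open>cyc_relation\<close>). This identity is used twice. Since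
  commutators of \<open>x\<close> with a far shift of \<open>x\<close> vanish in almost all blocks, \<open>A\<close> contains the restriction
  of its cycles to each single block (\<open>tcycle_singleton_mem\<close>). And since a normal subgroup of finite
  index contains a power of the shift, it contains the restriction of every cycle to all but finitely
  many blocks (\<open>tcycle_cofinite_mem_normal\<close>). Therefore \<open>G X\<close> is the product of \<open>A\<close> and any normal
  subgroup of finite index, because the difference between a new cycle and an element of \<open>N\<close> lives in
  finitely many blocks and there it belongs to \<open>A\<close>; and a normal subgroup of finite index in \<open>A\<close>
  contains all elements of \<open>A\<close> that act trivially on finitely many blocks and translate the line by a
  multiple of some \<open>e\<close>. These two properties, collected in \<open>grothendieck_pair\<close>, say that the inclusion
  induces an isomorphism of profinite completions (\<open>grothendieck_pair_imp_profinite_iso\<close>).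

  Uncountably many isomorphism classes (\<open>countable_iso_class\<close>): the set \<open>X\<close> can be read off from the
  elements of \<open>A\<close> with which the last generator of \<open>G X\<close> commutes. An isomorphism from \<open>G X\<close> to a
  fixed countable group is determined on \<open>A\<close> and on that generator by finitely many elements, so only
  countably many \<open>X\<close> give isomorphic groups.
\<close>

section \<open>Finite-index normal subgroups and transport along isomorphisms\<close>

text \<open>
  Finite index is most easily seen through an invariant \<open>q\<close> with finitely many values such that two
  elements with the same value lie in the same coset.
\<close>
lemma finite_index_normalsI:
  fixes G (structure)
  assumes "group G" "N \<lhd> G" "finite (q ` carrier G)"
    and q: "\<And>g h. g \<in> carrier G \<Longrightarrow> h \<in> carrier G \<Longrightarrow> q g = q h \<Longrightarrow> g \<otimes>\<^bsub>G\<^esub> inv\<^bsub>G\<^esub> h \<in> N"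
  shows "N \<in> finite_index_normals G"
proof -
  interpret group G by fact
  interpret N: normal N G by fact
  let ?h = "\<lambda>v. N #> (SOME g. g \<in> carrier G \<and> q g = v)"
  have "N #> g = ?h (q g)" if g: "g \<in> carrier G" for g
  proof -
    define g' where "g' = (SOME g'. g' \<in> carrier G \<and> q g' = q g)"
    have "g' \<in> carrier G \<and> q g' = q g"
      unfolding g'_def by (rule someI[of _ g]) (use g in auto)
    then have "g \<otimes> inv g' \<in> N" "g' \<in> carrier G" using q g by auto
    then have "g = (g \<otimes> inv g') \<otimes> g'" using g by (simp add: m_assoc)
    then have "g \<in> N #> g'" using \<open>g \<otimes> inv g' \<in> N\<close> unfolding r_coset_def by blast
    then have "N #> g = N #> g'" using repr_independence[OF _ \<open>g' \<in> carrier G\<close> N.is_subgroup] by simp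
    then show ?thesis by (simp add: g'_def)
  qed
  then have "rcosets N \<subseteq> ?h ` (q ` carrier G)"
    unfolding RCOSETS_def by auto
  then show ?thesis
    using assms(2) finite_surj[OF assms(3)] unfolding finite_index_normals_def by simp
qed

text \<open>
  The cosets of a preimage inject into the cosets of the subgroup.
\<close>
lemma vimage_finite_index_normals:
  assumes "group G" "group H" "f \<in> hom G H" "N \<in> finite_index_normals H"
  shows "{h \<in> carrier G. f h \<in> N} \<in> finite_index_normals G"
proof -
  interpret group_hom G H f using assms by (simp add: group_hom_def group_hom_axioms_def)
  have N: "N \<lhd> H" and fin: "finite (rcosets\<^bsub>H\<^esub> N)"
    using assms(4) by (auto simp: finite_index_normals_def)
  interpret N: normal N H by fact
  show ?thesis
  proof (rule finite_index_normalsI[where q = "\<lambda>h. N #>\<^bsub>H\<^esub> f h"])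
    show "group G" by fact
    show "{h \<in> carrier G. f h \<in> N} \<lhd> G"
      unfolding G.normal_inv_iff
    proof (intro conjI ballI)
      show "subgroup {h \<in> carrier G. f h \<in> N} G"
        by (rule G.subgroupI) (auto intro!: exI[of _ "\<one>\<^bsub>G\<^esub>"])
      fix x h assume "x \<in> carrier G" "h \<in> {h \<in> carrier G. f h \<in> N}"
      then show "x \<otimes>\<^bsub>G\<^esub> h \<otimes>\<^bsub>G\<^esub> inv\<^bsub>G\<^esub> x \<in> {h \<in> carrier G. f h \<in> N}"
        by (simp add: N.inv_op_closed2)
    qed
    show "finite ((\<lambda>h. N #>\<^bsub>H\<^esub> f h) ` carrier G)"
      by (rule finite_subset[OF _ fin]) (auto simp: RCOSETS_def intro!: bexI[of _ "f _"])
    fix g h assume gh: "g \<in> carrier G" "h \<in> carrier G" "N #>\<^bsub>H\<^esub> f g = N #>\<^bsub>H\<^esub> f h"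
    then have "f g \<in> N #>\<^bsub>H\<^esub> f h"
      using H.rcos_self[OF _ N.is_subgroup, of "f g"] by simp
    then obtain n where "n \<in> N" "f g = n \<otimes>\<^bsub>H\<^esub> f h" by (auto simp: r_coset_def)
    then show "g \<otimes>\<^bsub>G\<^esub> inv\<^bsub>G\<^esub> h \<in> {h \<in> carrier G. f h \<in> N}"
      using gh N.subset by (auto simp: H.inv_solve_right' H.m_assoc)
  qed
qed

lemma residually_finite_pullback:
  assumes "group G" "group H" "f \<in> mon G H" "residually_finite H"
  shows "residually_finite G"
  unfolding residually_finite_def
proof (intro ballI impI)
  fix h assume h: "h \<in> carrier G" "h \<noteq> \<one>\<^bsub>G\<^esub>"
  have f: "f \<in> hom G H" "inj_on f (carrier G)" using assms(3) by (auto simp: mon_def)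
  interpret group_hom G H f using assms f by (simp add: group_hom_def group_hom_axioms_def)
  have "f h \<noteq> f \<one>\<^bsub>G\<^esub>" using f(2) h unfolding inj_on_def by blast
  then have "f h \<noteq> \<one>\<^bsub>H\<^esub>" by simp
  then obtain N where N: "N \<in> finite_index_normals H" "f h \<notin> N"
    using assms(4) h hom_closed unfolding residually_finite_def by blast
  then show "\<exists>N\<in>finite_index_normals G. h \<notin> N"
    using vimage_finite_index_normals[OF assms(1,2) f(1) N(1)] N(2)
    by (intro bexI[of _ "{g \<in> carrier G. f g \<in> N}"]) auto
qed

lemma amenable_iso:
  assumes "group G" "group H" "f \<in> iso G H" "amenable G"
  shows "amenable H"
proof -
  interpret G: group G by fact
  interpret H: group H by fact
  have f: "f \<in> hom G H" "bij_betw f (carrier G) (carrier H)" using assms(3) by (auto simp: iso_def)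
  interpret group_hom G H f using f by (simp add: group_hom_def group_hom_axioms_def G.is_group H.is_group)
  from assms(4)[unfolded amenable_def] obtain \<mu> where
        "(\<forall>B \<subseteq> carrier G. 0 \<le> \<mu> B) \<and> \<mu> (carrier G) = (1::real) \<and>
        (\<forall>B \<subseteq> carrier G. \<forall>C \<subseteq> carrier G. B \<inter> C = {} \<longrightarrow> \<mu> (B \<union> C) = \<mu> B + \<mu> C) \<and>
        (\<forall>g \<in> carrier G. \<forall>B \<subseteq> carrier G. \<mu> (g <#\<^bsub>G\<^esub> B) = \<mu> B)"
    by (rule exE)
  then have nonneg: "\<And>B. B \<subseteq> carrier G \<Longrightarrow> 0 \<le> \<mu> B" and one: "\<mu> (carrier G) = (1::real)"
    and add: "\<And>B C. B \<subseteq> carrier G \<Longrightarrow> C \<subseteq> carrier G \<Longrightarrow> B \<inter> C = {} \<Longrightarrow> \<mu> (B \<union> C) = \<mu> B + \<mu> C"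
    and inv: "\<And>g B. g \<in> carrier G \<Longrightarrow> B \<subseteq> carrier G \<Longrightarrow> \<mu> (g <#\<^bsub>G\<^esub> B) = \<mu> B"
    by simp_all
  define p where "p B = {g \<in> carrier G. f g \<in> B}" for B
  have pH: "p (carrier H) = carrier G" by (auto simp: p_def)
  have pl: "p (h <#\<^bsub>H\<^esub> B) = g <#\<^bsub>G\<^esub> p B" if "g \<in> carrier G" "h = f g" "B \<subseteq> carrier H" for g h B
  proof (intro equalityI subsetI)
    fix x assume "x \<in> p (h <#\<^bsub>H\<^esub> B)"
    then obtain b where x: "x \<in> carrier G" "b \<in> B" "f x = h \<otimes>\<^bsub>H\<^esub> b" by (auto simp: p_def l_coset_def)
    then have "f (inv\<^bsub>G\<^esub> g \<otimes>\<^bsub>G\<^esub> x) = b" using that by (auto simp: H.inv_solve_left')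
    then have "inv\<^bsub>G\<^esub> g \<otimes>\<^bsub>G\<^esub> x \<in> p B" using x that by (auto simp: p_def)
    moreover have "x = g \<otimes>\<^bsub>G\<^esub> (inv\<^bsub>G\<^esub> g \<otimes>\<^bsub>G\<^esub> x)" using x that by (simp add: G.m_assoc[symmetric])
    ultimately show "x \<in> g <#\<^bsub>G\<^esub> p B" unfolding l_coset_def by blast
  next
    fix x assume "x \<in> g <#\<^bsub>G\<^esub> p B"
    then show "x \<in> p (h <#\<^bsub>H\<^esub> B)" using that by (auto simp: p_def l_coset_def)
  qed
  have pU: "p (B \<union> C) = p B \<union> p C" for B C by (auto simp: p_def)
  have pI: "B \<inter> C = {} \<Longrightarrow> p B \<inter> p C = {}" for B C by (auto simp: p_def)
  have ps: "p B \<subseteq> carrier G" for B by (auto simp: p_def)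
  have "\<mu> (p (h <#\<^bsub>H\<^esub> B)) = \<mu> (p B)" if "h \<in> carrier H" "B \<subseteq> carrier H" for h B
  proof -
    have "h \<in> f ` carrier G" using that(1) bij_betw_imp_surj_on[OF f(2)] by simp
    then obtain g where "g \<in> carrier G" "h = f g" by (rule imageE) auto
    then show ?thesis using pl[OF _ _ that(2)] inv[OF _ ps] by simp
  qed
  moreover have "\<mu> (p (B \<union> C)) = \<mu> (p B) + \<mu> (p C)" if "B \<inter> C = {}" for B C
    unfolding pU by (rule add[OF ps ps pI[OF that]])
  ultimately show ?thesis
    unfolding amenable_def using nonneg[OF ps] one pH
    by (intro exI[of _ "\<lambda>B. \<mu> (p B)"] conjI allI ballI impI) simp_all
qed

lemma generated_by_at_most_iso:
  assumes "group G" "group H" "f \<in> iso G H" "generated_by_at_most k G"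
  shows "generated_by_at_most k H"
proof -
  have f: "f \<in> hom G H" "f ` carrier G = carrier H" using assms(3) by (auto simp: iso_def bij_betw_def)
  interpret group_hom G H f using f assms by (simp add: group_hom_def group_hom_axioms_def)
  obtain S where S: "S \<subseteq> carrier G" "finite S" "card S \<le> k" "generate G S = carrier G"
    using assms(4) unfolding generated_by_at_most_def by blast
  have "generate H (f ` S) = carrier H" using generate_img[OF S(1)] S(4) f by simp
  then show ?thesis using S f(2) card_image_le[OF S(2), of f]
    unfolding generated_by_at_most_def by (intro exI[of _ "f ` S"]) auto
qed

text \<open>
  The groups constructed below are countable groups of permutations; an injection of the carrier into
  the natural numbers carries them over to the type demanded by the main result.
\<close>
definition transport :: "('a \<Rightarrow> 'c) \<Rightarrow> ('a, 'b) monoid_scheme \<Rightarrow> 'c monoid" where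
  "transport e G = \<lparr>carrier = e ` carrier G,
     monoid.mult = (\<lambda>x y. e (inv_into (carrier G) e x \<otimes>\<^bsub>G\<^esub> inv_into (carrier G) e y)),
     one = e \<one>\<^bsub>G\<^esub>\<rparr>"

lemma transport_iso:
  assumes "group G" "inj_on e (carrier G)"
  shows "group (transport e G)" "e \<in> iso G (transport e G)"
proof -
  interpret group G by fact
  show "e \<in> iso G (transport e G)"
    using assms(2) by (auto simp: iso_def hom_def transport_def bij_betw_def)
  show "group (transport e G)"
  proof (rule groupI)
    fix x assume "x \<in> carrier (transport e G)"
    then obtain a where "a \<in> carrier G" "x = e a" by (auto simp: transport_def)
    then show "\<exists>y\<in>carrier (transport e G). y \<otimes>\<^bsub>transport e G\<^esub> x = \<one>\<^bsub>transport e G\<^esub>"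
      using assms(2) by (intro bexI[of _ "e (inv\<^bsub>G\<^esub> a)"]) (auto simp: transport_def)
  qed (use assms(2) in \<open>auto simp: transport_def m_assoc\<close>)
qed

text \<open>
  The second condition says that \<open>A\<close> is dense in \<open>G\<close> for the profinite topology, the third that the
  profinite topology of \<open>G\<close> induces on \<open>A\<close> the full profinite topology of \<open>A\<close>. Density makes the map
  of profinite completions surjective, and the condition on topologies makes it injective.
\<close>
definition grothendieck_pair ::
    "('a, 'b) monoid_scheme \<Rightarrow> ('c, 'd) monoid_scheme \<Rightarrow> ('a \<Rightarrow> 'c) \<Rightarrow> bool" where
  "grothendieck_pair A G \<iota> \<longleftrightarrow> \<iota> \<in> mon A G \<and>
     (\<forall>N \<in> finite_index_normals G. \<forall>g \<in> carrier G. \<exists>a \<in> carrier A. g \<in> N #>\<^bsub>G\<^esub> \<iota> a) \<and>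
     (\<forall>M \<in> finite_index_normals A. \<exists>N \<in> finite_index_normals G. {a \<in> carrier A. \<iota> a \<in> N} \<subseteq> M)"

lemma grothendieck_pair_iso:
  assumes "group A" "group G" "group A'" "group G'" "grothendieck_pair A G \<iota>"
    and f: "f \<in> iso A' A" and h: "h \<in> iso G G'"
  shows "grothendieck_pair A' G' (h \<circ> \<iota> \<circ> f)"
  unfolding grothendieck_pair_def
proof (intro conjI ballI)
  interpret A: group A by fact
  interpret G: group G by fact
  interpret A': group A' by fact
  interpret G': group G' by fact
  have i: "\<iota> \<in> hom A G" "inj_on \<iota> (carrier A)" using assms(5) by (auto simp: grothendieck_pair_def mon_def)
  have f': "f \<in> hom A' A" "f ` carrier A' = carrier A" "inj_on f (carrier A')" using f
    by (auto simp: iso_def bij_betw_def)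
  have h': "h \<in> hom G G'" "h ` carrier G = carrier G'" "inj_on h (carrier G)" using h
    by (auto simp: iso_def bij_betw_def)
  have ic: "\<iota> a \<in> carrier G" if "a \<in> carrier A" for a using i that by (auto simp: hom_def)
  interpret h: group_hom G G' h using h'
    by (simp add: group_hom_def group_hom_axioms_def G.is_group G'.is_group)
  show "h \<circ> \<iota> \<circ> f \<in> mon A' G'"
    unfolding mon_def
  proof (intro CollectI conjI)
    show "h \<circ> \<iota> \<circ> f \<in> hom A' G'"
      using Group.hom_compose[OF f'(1) Group.hom_compose[OF i(1) h'(1)]] .
    show "inj_on (h \<circ> \<iota> \<circ> f) (carrier A')"
    proof (rule inj_onI)
      fix x y assume "x \<in> carrier A'" "y \<in> carrier A'" and e: "(h \<circ> \<iota> \<circ> f) x = (h \<circ> \<iota> \<circ> f) y"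
      then have xy: "x \<in> carrier A'" "y \<in> carrier A'" "f x \<in> carrier A" "f y \<in> carrier A"
        using f'(2) by auto
      then have "\<iota> (f x) = \<iota> (f y)" using e inj_onD[OF h'(3)] ic by simp
      then show "x = y" using inj_onD[OF i(2)] inj_onD[OF f'(3)] xy by simp
    qed
  qed
  fix N assume N: "N \<in> finite_index_normals G'"
  then have N': "N \<lhd> G'" by (auto simp: finite_index_normals_def)
  let ?N = "{g \<in> carrier G. h g \<in> N}"
  have "?N \<in> finite_index_normals G" by (intro vimage_finite_index_normals[OF assms(2,4) h'(1) N])
  fix g assume "g \<in> carrier G'"
  then obtain g0 where g0: "g0 \<in> carrier G" "g = h g0" using h'(2) by auto
  then obtain a where a: "a \<in> carrier A" "g0 \<in> ?N #>\<^bsub>G\<^esub> \<iota> a"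
    using assms(5) \<open>?N \<in> finite_index_normals G\<close> unfolding grothendieck_pair_def by blast
  then obtain a' n where "a' \<in> carrier A'" "a = f a'" and n: "n \<in> carrier G" "h n \<in> N" "g0 = n \<otimes>\<^bsub>G\<^esub> \<iota> a"
    using f'(2) unfolding r_coset_def by blast
  moreover have "g = h n \<otimes>\<^bsub>G'\<^esub> h (\<iota> a)" using n g0 ic a by auto
  ultimately show "\<exists>a\<in>carrier A'. g \<in> N #>\<^bsub>G'\<^esub> (h \<circ> \<iota> \<circ> f) a"
    by (auto simp: r_coset_def)
next
  interpret A: group A by fact
  interpret G: group G by fact
  have f': "f \<in> hom A' A" "f ` carrier A' = carrier A" "inj_on f (carrier A')" using f
    by (auto simp: iso_def bij_betw_def)
  have h': "h \<in> hom G G'" "h ` carrier G = carrier G'" "inj_on h (carrier G)" using h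
    by (auto simp: iso_def bij_betw_def)
  have i: "\<iota> \<in> hom A G" "inj_on \<iota> (carrier A)" using assms(5) by (auto simp: grothendieck_pair_def mon_def)
  have ic: "\<iota> a \<in> carrier G" if "a \<in> carrier A" for a using i that by (auto simp: hom_def)
  define fi where "fi = inv_into (carrier A') f"
  have fi: "fi \<in> iso A A'" unfolding fi_def using assms(3) f group.iso_set_sym by blast
  define hi where "hi = inv_into (carrier G) h"
  have hi: "hi \<in> iso G' G" unfolding hi_def using assms(2) h group.iso_set_sym by blast
  have fi': "fi (f a) = a" if "a \<in> carrier A'" for a using that f' by (simp add: fi_def)
  have hi': "hi (h a) = a" if "a \<in> carrier G" for a using that h' by (simp add: hi_def)
  fix M assume M: "M \<in> finite_index_normals A'"
  let ?M = "{a \<in> carrier A. fi a \<in> M}"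
  have "?M \<in> finite_index_normals A"
    using vimage_finite_index_normals[OF assms(1,3) _ M] fi by (auto simp: iso_def)
  then obtain N where N: "N \<in> finite_index_normals G" "{a \<in> carrier A. \<iota> a \<in> N} \<subseteq> ?M"
    using assms(5) unfolding grothendieck_pair_def by blast
  have "{g \<in> carrier G'. hi g \<in> N} \<in> finite_index_normals G'"
    using vimage_finite_index_normals[OF assms(4,2) _ N(1)] hi by (auto simp: iso_def)
  moreover have "{a \<in> carrier A'. (h \<circ> \<iota> \<circ> f) a \<in> {g \<in> carrier G'. hi g \<in> N}} \<subseteq> M"
  proof clarify
    fix a assume a: "a \<in> carrier A'" "hi ((h \<circ> \<iota> \<circ> f) a) \<in> N"
    then have "f a \<in> carrier A" using f'(2) by auto
    then show "a \<in> M" using a N(2) ic fi' hi' by auto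
  qed
  ultimately show "\<exists>N\<in>finite_index_normals G'. {a \<in> carrier A'. (h \<circ> \<iota> \<circ> f) a \<in> N} \<subseteq> M" by blast
qed

section \<open>A criterion for isomorphic profinite completions\<close>

text \<open>
  This makes the finite quotients of \<open>G\<close> a directed system, so that two coordinates of a point of the
  completion can be compared in a common refinement.
\<close>
lemma finite_index_normals_Int:
  assumes "group G" "N \<in> finite_index_normals G" "N' \<in> finite_index_normals G"
  shows "N \<inter> N' \<in> finite_index_normals G"
proof -
  interpret group G by fact
  have N: "N \<lhd> G" "N' \<lhd> G" and fin: "finite (rcosets\<^bsub>G\<^esub> N)" "finite (rcosets\<^bsub>G\<^esub> N')"
    using assms by (auto simp: finite_index_normals_def)
  interpret N: normal N G by fact
  interpret N': normal N' G by fact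
  show ?thesis
  proof (rule finite_index_normalsI[where q = "\<lambda>g. (N #>\<^bsub>G\<^esub> g, N' #>\<^bsub>G\<^esub> g)"])
    show "N \<inter> N' \<lhd> G" by (rule normal_subgroup_intersect[OF N])
    show "finite ((\<lambda>g. (N #>\<^bsub>G\<^esub> g, N' #>\<^bsub>G\<^esub> g)) ` carrier G)"
      by (rule finite_subset[OF _ finite_cartesian_product[OF fin]]) (auto simp: RCOSETS_def)
    fix g h assume gh: "g \<in> carrier G" "h \<in> carrier G"
      and "(N #>\<^bsub>G\<^esub> g, N' #>\<^bsub>G\<^esub> g) = (N #>\<^bsub>G\<^esub> h, N' #>\<^bsub>G\<^esub> h)"
    then have "g \<in> N #>\<^bsub>G\<^esub> h" "g \<in> N' #>\<^bsub>G\<^esub> h"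
      using rcos_self[OF gh(1) N.is_subgroup] rcos_self[OF gh(1) N'.is_subgroup] by simp_all
    then show "g \<otimes>\<^bsub>G\<^esub> inv\<^bsub>G\<^esub> h \<in> N \<inter> N'"
      using gh N.rcos_module N'.rcos_module is_group by simp
  qed fact
qed

lemma (in group) rcos_eq_iff:
  assumes "subgroup N G" "g \<in> carrier G" "h \<in> carrier G"
  shows "N #> g = N #> h \<longleftrightarrow> g \<otimes> inv h \<in> N"
proof -
  have "N #> g = N #> h \<longleftrightarrow> g \<in> N #> h"
    using rcos_self[OF assms(2,1)] repr_independence[OF _ assms(3,1), of g] by auto
  also have "\<dots> \<longleftrightarrow> g \<otimes> inv h \<in> N"
    using subgroup.rcos_module[OF assms(1) is_group assms(3,2)] by simp
  finally show ?thesis .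
qed

text \<open>
  The transition maps of the inverse system, evaluated on a coset with a known representative.
\<close>
lemma (in group) set_mult_rcos_of_le:
  assumes "subgroup N G" "subgroup M G" "N \<subseteq> M" "g \<in> carrier G"
  shows "M <#> (N #> g) = M #> g"
proof (intro equalityI subsetI)
  fix x assume "x \<in> M <#> (N #> g)"
  then obtain m n where "m \<in> M" "n \<in> N" "x = m \<otimes> (n \<otimes> g)"
    unfolding set_mult_def r_coset_def by auto
  then show "x \<in> M #> g"
    using assms subgroup.m_closed[OF assms(2), of m n] subgroup.mem_carrier[OF assms(2)]
    by (auto simp: r_coset_def m_assoc[symmetric] intro!: bexI[of _ "m \<otimes> n"])
next
  fix x assume "x \<in> M #> g"
  then obtain m where m: "m \<in> M" "x = m \<otimes> g" unfolding r_coset_def by auto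
  have "g \<in> N #> g" using rcos_self[OF assms(4,1)] .
  then show "x \<in> M <#> (N #> g)" using m unfolding set_mult_def by auto
qed

text \<open>
  The value of \<open>profinite_map\<close> in one coordinate, for a coset with a known representative.
\<close>
lemma set_mult_image_rcos:
  assumes "group A" "group G" "f \<in> hom A G" "subgroup N G" "a \<in> carrier A"
  shows "N <#>\<^bsub>G\<^esub> (f ` ({h \<in> carrier A. f h \<in> N} #>\<^bsub>A\<^esub> a)) = N #>\<^bsub>G\<^esub> f a"
proof -
  interpret G: group G by fact
  interpret A: group A by fact
  have hm: "f (x \<otimes>\<^bsub>A\<^esub> y) = f x \<otimes>\<^bsub>G\<^esub> f y" "f x \<in> carrier G" if "x \<in> carrier A" "y \<in> carrier A" for x y
    using assms(3) that by (auto simp: hom_def)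
  have fone: "f \<one>\<^bsub>A\<^esub> = \<one>\<^bsub>G\<^esub>" using hom_one[OF assms(3,1,2)] .
  note Nc = subgroup.mem_carrier[OF assms(4)] subgroup.m_closed[OF assms(4)]
  show ?thesis
  proof (intro equalityI subsetI)
    fix x assume "x \<in> N <#>\<^bsub>G\<^esub> (f ` ({h \<in> carrier A. f h \<in> N} #>\<^bsub>A\<^esub> a))"
    then obtain n h where "n \<in> N" "h \<in> carrier A" "f h \<in> N" "x = n \<otimes>\<^bsub>G\<^esub> f (h \<otimes>\<^bsub>A\<^esub> a)"
      unfolding set_mult_def r_coset_def by auto
    then show "x \<in> N #>\<^bsub>G\<^esub> f a"
      using assms(5) Nc by (auto simp: r_coset_def hm G.m_assoc[symmetric] intro!: bexI[of _ "n \<otimes>\<^bsub>G\<^esub> f h"])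
  next
    fix x assume "x \<in> N #>\<^bsub>G\<^esub> f a"
    then obtain n where n: "n \<in> N" "x = n \<otimes>\<^bsub>G\<^esub> f a" unfolding r_coset_def by auto
    have "f a \<in> f ` ({h \<in> carrier A. f h \<in> N} #>\<^bsub>A\<^esub> a)"
      using assms(5) fone subgroup.one_closed[OF assms(4)]
      by (auto simp: r_coset_def intro!: image_eqI[of _ _ a] exI[of _ "\<one>\<^bsub>A\<^esub>"])
    then show "x \<in> N <#>\<^bsub>G\<^esub> (f ` ({h \<in> carrier A. f h \<in> N} #>\<^bsub>A\<^esub> a))"
      unfolding set_mult_def UN_iff using n by (intro bexI[of _ n] bexI[of _ "f a"]) simp_all
  qed
qed

lemma mem_profinite_completion:
  "x \<in> carrier (profinite_completion G) \<longleftrightarrow>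
     x \<in> (\<Pi>\<^sub>E N\<in>finite_index_normals G. rcosets\<^bsub>G\<^esub> N) \<and>
     (\<forall>N \<in> finite_index_normals G. \<forall>M \<in> finite_index_normals G. N \<subseteq> M \<longrightarrow> M <#>\<^bsub>G\<^esub> x N = x M)"
  by (simp add: profinite_completion_def product_group_def FactGroup_def)

lemma profinite_completion_coordinate:
  assumes "x \<in> carrier (profinite_completion G)" "N \<in> finite_index_normals G"
  shows "x N \<in> rcosets\<^bsub>G\<^esub> N"
  using assms by (simp add: mem_profinite_completion PiE_iff)

lemma mult_profinite_completion:
  "x \<otimes>\<^bsub>profinite_completion G\<^esub> y = (\<lambda>N\<in>finite_index_normals G. x N <#>\<^bsub>G\<^esub> y N)"
  by (simp add: profinite_completion_def product_group_def FactGroup_def)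

lemma topspace_profinite_completion:
  "topspace (profinite_completion_topology G) = carrier (profinite_completion G)"
  by (auto simp: profinite_completion_topology_def topspace_subtopology mem_profinite_completion
      FactGroup_def PiE_iff extensional_def)

text \<open>
  Any function of a single coordinate is continuous because the factors are discrete. Both the map of
  completions and its inverse are of this form in each coordinate.
\<close>
lemma continuous_map_profinite_completion_coordinate:
  assumes "M \<in> finite_index_normals G" "\<And>C. C \<in> rcosets\<^bsub>G\<^esub> M \<Longrightarrow> h C \<in> S"
  shows "continuous_map (profinite_completion_topology G) (discrete_topology S) (\<lambda>x. h (x M))"
proof -
  have "continuous_map (profinite_completion_topology G) (discrete_topology (rcosets\<^bsub>G\<^esub> M)) (\<lambda>x. x M)"
    unfolding profinite_completion_topology_def
    using continuous_map_product_projection[OF assms(1), of "\<lambda>N. discrete_topology (carrier (G Mod N))"]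
    by (intro continuous_map_from_subtopology) (simp add: FactGroup_def)
  moreover have "continuous_map (discrete_topology (rcosets\<^bsub>G\<^esub> M)) (discrete_topology S) h"
    using assms(2) by auto
  ultimately show ?thesis using continuous_map_compose[of _ _ "\<lambda>x. x M" _ h] by (simp add: o_def)
qed

text \<open>
  By density every coordinate of a point of the completion of \<open>G\<close> is the coset of an element of \<open>A\<close>.
  The inverse map takes such a point \<open>y\<close> to the family whose coordinate at \<open>M\<close> is the coset of an
  element of \<open>A\<close> representing \<open>y\<close> at a chosen subgroup \<open>n M\<close> with preimage inside \<open>M\<close>; the fact \<open>key\<close>
  shows that the choices do not matter. Each coordinate of the inverse depends on one coordinate of
  \<open>y\<close> only, which gives continuity without an appeal to compactness.
\<close>
lemma grothendieck_pair_imp_profinite_iso: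
  assumes A: "group A" and G: "group G" and pair: "grothendieck_pair A G \<iota>"
  shows "profinite_iso A G (profinite_map A G \<iota>)"
proof -
  interpret A: group A by fact
  interpret G: group G by fact
  let ?F = "profinite_map A G \<iota>"
  let ?FA = "finite_index_normals A" and ?FG = "finite_index_normals G"
  have \<iota>: "\<iota> \<in> hom A G" and dense: "\<And>N g. N \<in> ?FG \<Longrightarrow> g \<in> carrier G \<Longrightarrow> \<exists>a \<in> carrier A. g \<in> N #>\<^bsub>G\<^esub> \<iota> a"
    and top: "\<And>M. M \<in> ?FA \<Longrightarrow> \<exists>N \<in> ?FG. {a \<in> carrier A. \<iota> a \<in> N} \<subseteq> M"
    using pair by (auto simp: grothendieck_pair_def mon_def)
  interpret \<iota>: group_hom A G \<iota> using A G \<iota> by (simp add: group_hom_def group_hom_axioms_def)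
  have FG: "subgroup N G" "N \<lhd> G" if "N \<in> ?FG" for N
    using that by (auto simp: finite_index_normals_def normal_imp_subgroup)
  have FA: "subgroup N A" "N \<lhd> A" if "N \<in> ?FA" for N
    using that by (auto simp: finite_index_normals_def normal_imp_subgroup)
  define P where "P N = {a \<in> carrier A. \<iota> a \<in> N}" for N
  have PF: "P N \<in> ?FA" if "N \<in> ?FG" for N
    unfolding P_def by (rule vimage_finite_index_normals[OF A G \<iota> that])
  \<comment> \<open>By density, also the coordinates in the completion of \<open>G\<close> are cosets of elements of \<open>A\<close>.\<close>
  have repA: "\<exists>a\<in>carrier A. x M = M #>\<^bsub>A\<^esub> a" if "x \<in> carrier (profinite_completion A)" "M \<in> ?FA" for x M
    using profinite_completion_coordinate[OF that] by (auto simp: RCOSETS_def)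
  have repG: "\<exists>a\<in>carrier A. y N = N #>\<^bsub>G\<^esub> \<iota> a" if y: "y \<in> carrier (profinite_completion G)" and N: "N \<in> ?FG"
      for y N
  proof -
    obtain g where g: "g \<in> carrier G" "y N = N #>\<^bsub>G\<^esub> g"
      using profinite_completion_coordinate[OF y N] by (auto simp: RCOSETS_def)
    obtain a where a: "a \<in> carrier A" "g \<in> N #>\<^bsub>G\<^esub> \<iota> a" using dense[OF N g(1)] by auto
    then show ?thesis using G.repr_independence[OF a(2) _ FG(1)[OF N]] g(2) by auto
  qed
  have compA: "M' <#>\<^bsub>A\<^esub> x M = x M'" if "x \<in> carrier (profinite_completion A)" "M \<in> ?FA" "M' \<in> ?FA" "M \<subseteq> M'"
      for x M M'
    using that by (simp add: mem_profinite_completion)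
  have compG: "M' <#>\<^bsub>G\<^esub> x M = x M'" if "x \<in> carrier (profinite_completion G)" "M \<in> ?FG" "M' \<in> ?FG" "M \<subseteq> M'"
      for x M M'
    using that by (simp add: mem_profinite_completion)
  have F: "?F x N = N #>\<^bsub>G\<^esub> \<iota> a" if "N \<in> ?FG" "a \<in> carrier A" "x (P N) = P N #>\<^bsub>A\<^esub> a" for x N a
    using that set_mult_image_rcos[OF A G \<iota> FG(1)[OF that(1)] that(2)]
    by (simp add: profinite_map_def P_def)
  have Fext: "?F x N = undefined" if "N \<notin> ?FG" for x N using that by (simp add: profinite_map_def)
  have Fc: "?F x \<in> carrier (profinite_completion G)" if x: "x \<in> carrier (profinite_completion A)" for x
    unfolding mem_profinite_completion
  proof (intro conjI ballI impI PiE_I)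
    fix N assume N: "N \<in> ?FG"
    obtain a where a: "a \<in> carrier A" "x (P N) = P N #>\<^bsub>A\<^esub> a" using repA[OF x PF[OF N]] by auto
    then show "?F x N \<in> rcosets\<^bsub>G\<^esub> N" using F[where x = x, OF N a] by (auto simp: RCOSETS_def)
    fix M assume M: "M \<in> ?FG" and le: "N \<subseteq> M"
    have "P M #>\<^bsub>A\<^esub> a = P M <#>\<^bsub>A\<^esub> x (P N)"
      using A.set_mult_rcos_of_le[OF FA(1)[OF PF[OF N]] FA(1)[OF PF[OF M]] _ a(1)] le a(2)
        by (auto simp: P_def)
    also have "\<dots> = x (P M)" using compA[OF x PF[OF N] PF[OF M]] le by (auto simp: P_def)
    finally have "?F x M = M #>\<^bsub>G\<^esub> \<iota> a" using F[OF M a(1)] by simp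
    then show "M <#>\<^bsub>G\<^esub> ?F x N = ?F x M"
      using F[where x = x, OF N a] G.set_mult_rcos_of_le[OF FG(1)[OF N] FG(1)[OF M] le] a(1) by simp
  qed (simp add: Fext)
  \<comment> \<open>A coordinate of \<open>y\<close> at a small enough subgroup determines the coset of \<open>M\<close>.\<close>
  have key: "M #>\<^bsub>A\<^esub> a = M #>\<^bsub>A\<^esub> b"
    if y: "y \<in> carrier (profinite_completion G)" and M: "M \<in> ?FA" and N: "N \<in> ?FG" "P N \<subseteq> M"
        and N': "N' \<in> ?FG" "P N' \<subseteq> M"
      and a: "a \<in> carrier A" "y N = N #>\<^bsub>G\<^esub> \<iota> a" and b: "b \<in> carrier A" "y N' = N' #>\<^bsub>G\<^esub> \<iota> b"
          for y M N N' a b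
  proof -
    have I: "N \<inter> N' \<in> ?FG" by (rule finite_index_normals_Int[OF G N(1) N'(1)])
    obtain c where c: "c \<in> carrier A" "y (N \<inter> N') = (N \<inter> N') #>\<^bsub>G\<^esub> \<iota> c" using repG[OF y I] by auto
    have *: "M #>\<^bsub>A\<^esub> e = M #>\<^bsub>A\<^esub> c" if L: "L \<in> ?FG" "P L \<subseteq> M" "N \<inter> N' \<subseteq> L"
        and e: "e \<in> carrier A" "y L = L #>\<^bsub>G\<^esub> \<iota> e" for L e
    proof -
      have "L #>\<^bsub>G\<^esub> \<iota> e = L #>\<^bsub>G\<^esub> \<iota> c"
        using compG[OF y I L(1,3)] e c G.set_mult_rcos_of_le[OF FG(1)[OF I] FG(1)[OF L(1)] L(3)] by simp
      then have "\<iota> (e \<otimes>\<^bsub>A\<^esub> inv\<^bsub>A\<^esub> c) \<in> L"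
        using G.rcos_eq_iff[OF FG(1)[OF L(1)], of "\<iota> e" "\<iota> c"] e c by simp
      then have "e \<otimes>\<^bsub>A\<^esub> inv\<^bsub>A\<^esub> c \<in> M" using L(2) e c by (auto simp: P_def)
      then show ?thesis using A.rcos_eq_iff[OF FA(1)[OF M]] e c by simp
    qed
    show ?thesis using *[OF N _ a] *[OF N' _ b] by simp
  qed
  \<comment> \<open>A subgroup of \<open>G\<close> that is deep enough to determine the coordinate at \<open>M\<close>.\<close>
  define n where "n M = (SOME N. N \<in> ?FG \<and> P N \<subseteq> M)" for M
  have n: "n M \<in> ?FG" "P (n M) \<subseteq> M" if "M \<in> ?FA" for M
    using someI_ex[of "\<lambda>N. N \<in> ?FG \<and> P N \<subseteq> M"] top[OF that] unfolding n_def P_def by blast+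
  define r where "r M C = M #>\<^bsub>A\<^esub> (SOME a. a \<in> carrier A \<and> C = n M #>\<^bsub>G\<^esub> \<iota> a)" for M C
  have r: "\<exists>a\<in>carrier A. C = n M #>\<^bsub>G\<^esub> \<iota> a \<and> r M C = M #>\<^bsub>A\<^esub> a"
    if M: "M \<in> ?FA" and C: "C \<in> rcosets\<^bsub>G\<^esub> (n M)" for M C
  proof -
    obtain g where g: "g \<in> carrier G" "C = n M #>\<^bsub>G\<^esub> g" using C by (auto simp: RCOSETS_def)
    obtain a where a: "a \<in> carrier A" "g \<in> n M #>\<^bsub>G\<^esub> \<iota> a" using dense[OF n(1)[OF M] g(1)] by auto
    then have "a \<in> carrier A \<and> C = n M #>\<^bsub>G\<^esub> \<iota> a"
      using G.repr_independence[OF a(2) _ FG(1)[OF n(1)[OF M]]] g(2) by auto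
    from someI[of "\<lambda>a. a \<in> carrier A \<and> C = n M #>\<^bsub>G\<^esub> \<iota> a", OF this]
    show ?thesis unfolding r_def by auto
  qed
  define K where "K y = (\<lambda>M\<in>?FA. r M (y (n M)))" for y
  have Kr: "\<exists>a\<in>carrier A. y (n M) = n M #>\<^bsub>G\<^esub> \<iota> a \<and> K y M = M #>\<^bsub>A\<^esub> a"
    if "y \<in> carrier (profinite_completion G)" "M \<in> ?FA" for y M
    using r[OF that(2) profinite_completion_coordinate[OF that(1) n(1)[OF that(2)]]] that(2)
      by (simp add: K_def)
  have Kc: "K y \<in> carrier (profinite_completion A)" if y: "y \<in> carrier (profinite_completion G)" for y
    unfolding mem_profinite_completion
  proof (intro conjI ballI impI PiE_I)
    fix M assume M: "M \<in> ?FA"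
    obtain a where a: "a \<in> carrier A" "y (n M) = n M #>\<^bsub>G\<^esub> \<iota> a" "K y M = M #>\<^bsub>A\<^esub> a" using Kr[OF y M] by auto
    then show "K y M \<in> rcosets\<^bsub>A\<^esub> M" by (auto simp: RCOSETS_def)
    fix M' assume M': "M' \<in> ?FA" and le: "M \<subseteq> M'"
    obtain b where b: "b \<in> carrier A" "y (n M') = n M' #>\<^bsub>G\<^esub> \<iota> b" "K y M' = M' #>\<^bsub>A\<^esub> b" using Kr[OF y M']
      by auto
    have "M' #>\<^bsub>A\<^esub> a = M' #>\<^bsub>A\<^esub> b"
      by (rule key[OF y M' n(1)[OF M] _ n[OF M'] a(1,2) b(1,2)]) (use n(2)[OF M] le in auto)
    then show "M' <#>\<^bsub>A\<^esub> K y M = K y M'"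
      using a b A.set_mult_rcos_of_le[OF FA(1)[OF M] FA(1)[OF M'] le] by simp
  qed (simp add: K_def)
  have FK: "?F (K y) = y" if y: "y \<in> carrier (profinite_completion G)" for y
  proof
    fix N
    show "?F (K y) N = y N"
    proof (cases "N \<in> ?FG")
      case False
      then show ?thesis using y Fext by (auto simp: mem_profinite_completion PiE_iff extensional_def)
    next
      case N: True
      note M = PF[OF N]
      obtain a where a: "a \<in> carrier A" "y (n (P N)) = n (P N) #>\<^bsub>G\<^esub> \<iota> a" "K y (P N) = P N #>\<^bsub>A\<^esub> a"
        using Kr[OF y M] by auto
      obtain b where b: "b \<in> carrier A" "y N = N #>\<^bsub>G\<^esub> \<iota> b" using repG[OF y N] by auto
      have "P N #>\<^bsub>A\<^esub> a = P N #>\<^bsub>A\<^esub> b"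
        by (rule key[OF y M n[OF M] N _ a(1,2) b(1,2)]) auto
      then show ?thesis using F[OF N b(1)] a b by simp
    qed
  qed
  have inj: "x = x'" if x: "x \<in> carrier (profinite_completion A)" "x' \<in> carrier (profinite_completion A)"
      and e: "?F x = ?F x'" for x x'
  proof
    fix M
    show "x M = x' M"
    proof (cases "M \<in> ?FA")
      case False
      then show ?thesis using x by (auto simp: mem_profinite_completion PiE_iff extensional_def)
    next
      case M: True
      note N = n[OF M]
      obtain a where a: "a \<in> carrier A" "x (P (n M)) = P (n M) #>\<^bsub>A\<^esub> a" using repA[OF x(1) PF[OF N(1)]]
        by auto
      obtain b where b: "b \<in> carrier A" "x' (P (n M)) = P (n M) #>\<^bsub>A\<^esub> b" using repA[OF x(2) PF[OF N(1)]]
        by auto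
      have "n M #>\<^bsub>G\<^esub> \<iota> a = n M #>\<^bsub>G\<^esub> \<iota> b" using F[where x = x, OF N(1) a] F[where x = x', OF N(1) b] e
        by simp
      then have "\<iota> (a \<otimes>\<^bsub>A\<^esub> inv\<^bsub>A\<^esub> b) \<in> n M"
        using G.rcos_eq_iff[OF FG(1)[OF N(1)], of "\<iota> a" "\<iota> b"] a b by simp
      then have "P (n M) #>\<^bsub>A\<^esub> a = P (n M) #>\<^bsub>A\<^esub> b"
        using A.rcos_eq_iff[OF FA(1)[OF PF[OF N(1)]]] a b by (simp add: P_def)
      then show ?thesis
        using compA[OF x(1) PF[OF N(1)] M N(2)] compA[OF x(2) PF[OF N(1)] M N(2)] a b by simp
    qed
  qed
  have KF: "K (?F x) = x" if "x \<in> carrier (profinite_completion A)" for x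
    using inj[OF Kc[OF Fc[OF that]] that FK[OF Fc[OF that]]] .
  have hom: "?F \<in> hom (profinite_completion A) (profinite_completion G)"
    unfolding hom_def
  proof (intro CollectI conjI ballI)
    show "?F \<in> carrier (profinite_completion A) \<rightarrow> carrier (profinite_completion G)" using Fc by auto
    fix x x' assume x: "x \<in> carrier (profinite_completion A)" "x' \<in> carrier (profinite_completion A)"
    show "?F (x \<otimes>\<^bsub>profinite_completion A\<^esub> x') = ?F x \<otimes>\<^bsub>profinite_completion G\<^esub> ?F x'"
    proof
      fix N
      show "?F (x \<otimes>\<^bsub>profinite_completion A\<^esub> x') N = (?F x \<otimes>\<^bsub>profinite_completion G\<^esub> ?F x') N"
      proof (cases "N \<in> ?FG")
        case False
        then show ?thesis using Fext by (simp add: mult_profinite_completion)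
      next
        case N: True
        obtain a where a: "a \<in> carrier A" "x (P N) = P N #>\<^bsub>A\<^esub> a" using repA[OF x(1) PF[OF N]] by auto
        obtain b where b: "b \<in> carrier A" "x' (P N) = P N #>\<^bsub>A\<^esub> b" using repA[OF x(2) PF[OF N]] by auto
        have "(x \<otimes>\<^bsub>profinite_completion A\<^esub> x') (P N) = P N #>\<^bsub>A\<^esub> (a \<otimes>\<^bsub>A\<^esub> b)"
          using a b PF[OF N] normal.rcos_sum[OF FA(2)[OF PF[OF N]]] by (simp add: mult_profinite_completion)
        then show ?thesis
          using F[OF N, of "a \<otimes>\<^bsub>A\<^esub> b"] F[where x = x, OF N a] F[where x = x', OF N b] a b N
              normal.rcos_sum[OF FG(2)[OF N]]
          by (simp add: mult_profinite_completion)
      qed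
    qed
  qed
  have bij: "bij_betw ?F (carrier (profinite_completion A)) (carrier (profinite_completion G))"
    by (rule bij_betw_byWitness[where f' = K]) (use Fc Kc FK KF in auto)
  have contF: "continuous_map (profinite_completion_topology A) (profinite_completion_topology G) ?F"
    unfolding profinite_completion_topology_def[of G] continuous_map_in_subtopology
      continuous_map_componentwise topspace_profinite_completion
  proof (intro conjI ballI)
    show "?F ` carrier (profinite_completion A) \<subseteq> extensional ?FG" using Fext
      by (auto simp: extensional_def)
    show "?F \<in> carrier (profinite_completion A) \<rightarrow> carrier (profinite_completion G)" using Fc by auto
    fix N assume N: "N \<in> ?FG"
    have "(\<lambda>x. ?F x N) = (\<lambda>x. N <#>\<^bsub>G\<^esub> (\<iota> ` x (P N)))" using N by (simp add: profinite_map_def P_def)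
    moreover have "N <#>\<^bsub>G\<^esub> (\<iota> ` C) \<in> carrier (G Mod N)" if "C \<in> rcosets\<^bsub>A\<^esub> (P N)" for C
      using that set_mult_image_rcos[OF A G \<iota> FG(1)[OF N]] by (auto simp: RCOSETS_def FactGroup_def P_def)
    ultimately show "continuous_map (profinite_completion_topology A) (discrete_topology (carrier (G Mod
        N))) (\<lambda>x. ?F x N)"
      using continuous_map_profinite_completion_coordinate[OF PF[OF N], of "\<lambda>C. N <#>\<^bsub>G\<^esub> (\<iota> ` C)"] by simp
  qed
  have contK: "continuous_map (profinite_completion_topology G) (profinite_completion_topology A) K"
    unfolding profinite_completion_topology_def[of A] continuous_map_in_subtopology
      continuous_map_componentwise topspace_profinite_completion
  proof (intro conjI ballI)
    show "K ` carrier (profinite_completion G) \<subseteq> extensional ?FA" by (auto simp: K_def)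
    show "K \<in> carrier (profinite_completion G) \<rightarrow> carrier (profinite_completion A)" using Kc by auto
    fix M assume M: "M \<in> ?FA"
    have "(\<lambda>x. K x M) = (\<lambda>x. r M (x (n M)))" using M by (simp add: K_def)
    moreover have "r M C \<in> carrier (A Mod M)" if "C \<in> rcosets\<^bsub>G\<^esub> (n M)" for C
      using r[OF M that] by (auto simp: RCOSETS_def FactGroup_def)
    ultimately show "continuous_map (profinite_completion_topology G) (discrete_topology (carrier (A Mod
        M))) (\<lambda>x. K x M)"
      using continuous_map_profinite_completion_coordinate[OF n(1)[OF M], of "r M"] by simp
  qed
  have "homeomorphic_maps (profinite_completion_topology A) (profinite_completion_topology G) ?F K"
    unfolding homeomorphic_maps_def topspace_profinite_completion using contF contK FK KF by auto
  then show ?thesis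
    unfolding profinite_iso_def using hom bij by (auto simp: iso_def homeomorphic_map_maps)
qed

section \<open>Amenability of locally finite by infinite cyclic groups\<close>

lemma compact_PiE_unit_interval: "compact (\<Pi>\<^sub>E i\<in>UNIV. {0..1::real})"
proof -
  have "compactin (product_topology (\<lambda>i::'a. euclidean :: real topology) UNIV) (\<Pi>\<^sub>E i\<in>UNIV. {0..1::real})"
    by (simp add: compactin_PiE)
  then show ?thesis by (simp add: euclidean_product_topology)
qed

text \<open>
  The finitely additive probability measures form a closed subset of a product of unit intervals,
  compact by Tychonoff's theorem, and the measures invariant up to \<open>\<epsilon>\<close> under \<open>g\<close> form a closed subset
  of it. By the finite intersection property it suffices to meet finitely many of these conditions.
\<close>
lemma amenable_if_almost_invariant_means:
  fixes G (structure)
  assumes "group G"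
    and approx: "\<And>E \<epsilon>. finite E \<Longrightarrow> E \<subseteq> carrier G \<Longrightarrow> \<epsilon> > 0 \<Longrightarrow> \<exists>\<mu> :: 'a set \<Rightarrow> real.
        (\<forall>B. 0 \<le> \<mu> B \<and> \<mu> B \<le> 1) \<and> \<mu> (carrier G) = 1 \<and>
        (\<forall>B C. B \<inter> C = {} \<longrightarrow> \<mu> (B \<union> C) = \<mu> B + \<mu> C) \<and>
        (\<forall>g\<in>E. \<forall>B \<subseteq> carrier G. \<bar>\<mu> (g <# B) - \<mu> B\<bar> \<le> \<epsilon>)"
  shows "amenable G"
proof -
  define V where "V = {\<mu> :: 'a set \<Rightarrow> real. \<mu> (carrier G) = 1 \<and> (\<forall>B C. B \<inter> C = {} \<longrightarrow> \<mu> (B \<union> C) = \<mu> B + \<mu> C)}"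
  define W where "W g \<epsilon> = {\<mu> :: 'a set \<Rightarrow> real. \<forall>B \<subseteq> carrier G. \<bar>\<mu> (g <# B) - \<mu> B\<bar> \<le> \<epsilon>}" for g and \<epsilon> :: real
  have cc: "continuous_on UNIV (\<lambda>\<mu> :: 'a set \<Rightarrow> real. \<mu> B)" for B by simp
  have "closed V" unfolding V_def
    by (intro closed_Collect_conj closed_Collect_all closed_Collect_imp closed_Collect_eq
        continuous_intros cc open_Collect_const)
  moreover have "closed (W g \<epsilon>)" for g \<epsilon>
    unfolding W_def
    by (intro closed_Collect_all closed_Collect_imp closed_Collect_le continuous_intros cc
        open_Collect_const)
  ultimately have closed: "closed (V \<inter> W g \<epsilon>)" for g \<epsilon> by auto
  let ?I = "carrier G \<times> {0<..} :: ('a \<times> real) set"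
  have "(\<Pi>\<^sub>E i\<in>UNIV. {0..1::real}) \<inter> (\<Inter>i\<in>?I. V \<inter> W (fst i) (snd i)) \<noteq> {}"
  proof (rule compact_imp_fip_image[OF compact_PiE_unit_interval])
    fix I' assume I': "finite I'" "I' \<subseteq> ?I"
    define \<epsilon> where "\<epsilon> = Min (insert 1 (snd ` I'))"
    have \<epsilon>: "\<epsilon> > 0" "\<And>i. i \<in> I' \<Longrightarrow> \<epsilon> \<le> snd i" using I' by (auto simp: \<epsilon>_def)
    have fstI: "fst ` I' \<subseteq> carrier G" using I'(2) by auto
    obtain \<mu> :: "'a set \<Rightarrow> real" where \<mu>: "\<forall>B. 0 \<le> \<mu> B \<and> \<mu> B \<le> 1" "\<mu> (carrier G) = 1"
        "\<forall>B C. B \<inter> C = {} \<longrightarrow> \<mu> (B \<union> C) = \<mu> B + \<mu> C"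
        "\<forall>g\<in>fst ` I'. \<forall>B \<subseteq> carrier G. \<bar>\<mu> (g <# B) - \<mu> B\<bar> \<le> \<epsilon>"
      using approx[OF finite_imageI[OF I'(1)] fstI \<epsilon>(1)] by (elim exE conjE) (rule that)
    have "\<mu> \<in> W (fst i) (snd i)" if "i \<in> I'" for i
      unfolding W_def
    proof (intro CollectI allI impI)
      fix B assume "B \<subseteq> carrier G"
      then have "\<bar>\<mu> (fst i <# B) - \<mu> B\<bar> \<le> \<epsilon>" using \<mu>(4) that by simp
      then show "\<bar>\<mu> (fst i <# B) - \<mu> B\<bar> \<le> snd i" using \<epsilon>(2)[OF that] by simp
    qed
    then have "\<mu> \<in> (\<Pi>\<^sub>E i\<in>UNIV. {0..1::real}) \<inter> (\<Inter>i\<in>I'. V \<inter> W (fst i) (snd i))"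
      using \<mu>(1-3) by (auto simp: V_def)
    then show "(\<Pi>\<^sub>E i\<in>UNIV. {0..1::real}) \<inter> (\<Inter>i\<in>I'. V \<inter> W (fst i) (snd i)) \<noteq> {}" by blast
  qed (use closed in auto)
  then obtain \<mu> :: "'a set \<Rightarrow> real" where \<mu>0: "\<mu> \<in> (\<Pi>\<^sub>E i\<in>UNIV. {0..1::real})"
     "\<mu> \<in> (\<Inter>i\<in>?I. V \<inter> W (fst i) (snd i))"
    by (metis (no_types, lifting) IntE ex_in_conv)
  have \<mu>: "\<mu> \<in> (\<Pi>\<^sub>E i\<in>UNIV. {0..1::real})" "\<mu> \<in> V \<inter> W g \<epsilon>" if "g \<in> carrier G" "\<epsilon> > 0" for g \<epsilon>
    using INT_D[OF \<mu>0(2), of "(g, \<epsilon>)"] \<mu>0(1) that by simp_all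
  have one: "\<one> \<in> carrier G" using assms(1) by (simp add: group.is_monoid)
  have "\<mu> (g <# B) = \<mu> B" if "g \<in> carrier G" "B \<subseteq> carrier G" for g B
  proof -
    have "\<bar>\<mu> (g <# B) - \<mu> B\<bar> \<le> 0 + \<epsilon>" if "\<epsilon> > 0" for \<epsilon>
      using \<mu>(2)[OF \<open>g \<in> carrier G\<close> that] \<open>B \<subseteq> carrier G\<close> by (simp add: W_def)
    then have "\<bar>\<mu> (g <# B) - \<mu> B\<bar> \<le> 0" by (rule field_le_epsilon)
    then show ?thesis by simp
  qed
  moreover have "\<mu> \<in> V" using \<mu>(2)[OF one, of 1] by simp
  moreover have "0 \<le> \<mu> B" for B using \<mu>0(1) by (auto simp: PiE_iff)
  ultimately show ?thesis unfolding amenable_def V_def by (intro exI[of _ \<mu>]) simp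
qed

lemma abs_sum_shift_le:
  fixes c :: "int \<Rightarrow> real"
  assumes c: "\<And>i. 0 \<le> c i" "\<And>i. c i \<le> C"
  shows "\<bar>(\<Sum>j<L. c (int j + z)) - (\<Sum>j<L. c (int j))\<bar> \<le> \<bar>real_of_int z\<bar> * C"
proof -
  have tel: "(\<Sum>j<L. c (int j + w + 1)) - (\<Sum>j<L. c (int j + w)) = c (int L + w) - c w" for w
    by (induction L) (auto simp: algebra_simps)
  have step: "\<bar>(\<Sum>j<L. c (int j + w + int k)) - (\<Sum>j<L. c (int j + w))\<bar> \<le> real k * C" for k w
  proof (induction k)
    case (Suc k)
    have "\<bar>c (int L + (w + int k)) - c (w + int k)\<bar> \<le> C"
      using c[of "int L + (w + int k)"] c[of "w + int k"] by linarith
    then show ?case using Suc tel[of "w + int k"] by (simp add: algebra_simps)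
  qed simp
  show ?thesis
  proof (cases "z \<ge> 0")
    case True
    then show ?thesis using step[of 0 "nat z"] by simp
  next
    case False
    then show ?thesis using step[of z "nat (- z)"] by (simp add: abs_minus_commute)
  qed
qed

text \<open>
  An almost invariant mean is the average over the elements \<open>\<tau> j \<otimes> f\<close> with \<open>0 \<le> j < L\<close> and \<open>f\<close> in a
  finite subgroup \<open>F\<close>, counted with multiplicity. An element \<open>p \<otimes> \<tau> z\<close> moves \<open>\<tau> j \<otimes> f\<close> to
  \<open>\<tau> (j + z) \<otimes> (q \<otimes> f)\<close>, where \<open>q\<close> is a conjugate of \<open>p\<close>. If \<open>F\<close> contains the finitely many conjugates
  that occur, then only the shift of the summation range by \<open>z\<close> contributes to the error, and its
  relative size is at most \<open>\<bar>z\<bar> / L\<close>.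
\<close>
lemma amenable_locally_finite_by_int:
  fixes G (structure)
  assumes "group G"
    and \<tau>: "\<And>i. \<tau> i \<in> carrier G" "\<And>i j. \<tau> (i + j :: int) = \<tau> i \<otimes> \<tau> j"
    and P: "P \<subseteq> carrier G"
    and conj: "\<And>p i. p \<in> P \<Longrightarrow> \<tau> (- i) \<otimes> p \<otimes> \<tau> i \<in> P"
    and dec: "\<And>g. g \<in> carrier G \<Longrightarrow> \<exists>p\<in>P. \<exists>i. g = p \<otimes> \<tau> i"
    and lf: "\<And>E. finite E \<Longrightarrow> E \<subseteq> P \<Longrightarrow> \<exists>F. subgroup F G \<and> finite F \<and> E \<subseteq> F"
  shows "amenable G"
proof (rule amenable_if_almost_invariant_means[OF assms(1)])
  interpret group G by fact
  fix E and \<epsilon> :: real assume E: "finite E" "E \<subseteq> carrier G" and \<epsilon>: "\<epsilon> > 0"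
  have \<tau>0: "\<tau> 0 = \<one>" using \<tau>(2)[of 0 0] \<tau>(1)[of 0] by (metis add.right_neutral l_cancel_one)
  have \<tau>inv: "\<tau> i \<otimes> \<tau> (- i) = \<one>" "\<tau> (- i) \<otimes> \<tau> i = \<one>" for i
    using \<tau>(2)[of i "- i"] \<tau>(2)[of "- i" i] \<tau>0 by simp_all
  have "\<forall>g\<in>E. \<exists>p i. p \<in> P \<and> inv g = p \<otimes> \<tau> i" using dec E(2) by (meson inv_closed subsetD)
  then obtain p z where pz: "\<And>g. g \<in> E \<Longrightarrow> p g \<in> P" "\<And>g. g \<in> E \<Longrightarrow> inv g = p g \<otimes> \<tau> (z g)"
    by metis
  define m where "m = Max (insert 0 ((\<lambda>g. \<bar>z g\<bar>) ` E))"
  have m: "\<bar>z g\<bar> \<le> m" if "g \<in> E" for g using that E(1) by (auto simp: m_def)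
  obtain L where "real L > of_int m / \<epsilon>" using reals_Archimedean2 by blast
  moreover define L' where "L' = Suc L"
  ultimately have L: "real L' > 0" "of_int m / real L' \<le> \<epsilon>" using \<epsilon> by (auto simp: field_simps add_pos_pos)
  \<comment> \<open>All conjugates that occur when an element of \<open>E\<close> acts on the averaging set.\<close>
  define D where "D = (\<lambda>(g, j). \<tau> (- (z g + int j)) \<otimes> p g \<otimes> \<tau> (z g + int j)) ` (E \<times> {..<L'})"
  have "finite D" "D \<subseteq> P" using E(1) conj pz(1) by (auto simp: D_def simp del: minus_add_distrib)
  then obtain F where F: "subgroup F G" "finite F" "D \<subseteq> F" using lf by blast
  interpret F: subgroup F G by fact
  define n where "n = real (card F)"
  have "F \<noteq> {}" using F.one_closed by blast
  then have n: "n > 0" using F(2) by (simp add: n_def card_gt_0_iff)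
  define c where "c B i = real (card {f \<in> F. \<tau> i \<otimes> f \<in> B})" for B and i :: int
  have c: "0 \<le> c B i" "c B i \<le> n" for B i
    using F(2) by (auto simp: c_def n_def intro!: card_mono)
  define \<mu> where "\<mu> B = (\<Sum>j<L'. c B (int j)) / (real L' * n)" for B
  have "\<mu> B \<le> 1" for B
    using sum_bounded_above[of "{..<L'}" "\<lambda>j. c B (int j)" n] c L(1) n by (simp add: \<mu>_def)
  moreover have "0 \<le> \<mu> B" for B using c L(1) n by (auto simp: \<mu>_def intro!: divide_nonneg_nonneg sum_nonneg)
  moreover have "\<mu> (carrier G) = 1"
  proof -
    have "{f \<in> F. \<tau> i \<otimes> f \<in> carrier G} = F" for i using \<tau>(1) by auto
    then show ?thesis using L(1) n by (simp add: \<mu>_def c_def n_def[symmetric])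
  qed
  moreover have "\<mu> (B \<union> C) = \<mu> B + \<mu> C" if "B \<inter> C = {}" for B C
  proof -
    have "{f \<in> F. \<tau> i \<otimes> f \<in> B \<union> C} = {f \<in> F. \<tau> i \<otimes> f \<in> B} \<union> {f \<in> F. \<tau> i \<otimes> f \<in> C}"
      and "{f \<in> F. \<tau> i \<otimes> f \<in> B} \<inter> {f \<in> F. \<tau> i \<otimes> f \<in> C} = {}" for i
      using that by auto
    then have "c (B \<union> C) i = c B i + c C i" for i
      using F(2) by (simp add: c_def card_Un_disjoint)
    then show ?thesis by (simp add: \<mu>_def sum.distrib add_divide_distrib)
  qed
  moreover have "\<bar>\<mu> (g <# B) - \<mu> B\<bar> \<le> \<epsilon>" if g: "g \<in> E" and B: "B \<subseteq> carrier G" for g B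
  proof -
    have gc: "g \<in> carrier G" and pc: "p g \<in> carrier G" using g E P pz by auto
    have "c (g <# B) (int j) = c B (int j + z g)" if j: "j < L'" for j
    proof -
      define i where "i = z g + int j"
      define q where "q = \<tau> (- i) \<otimes> p g \<otimes> \<tau> i"
      have "q \<in> D" using g j by (auto simp: D_def q_def i_def image_iff simp del: minus_add_distrib)
      then have q: "q \<in> F" "q \<in> carrier G" using F(3) by auto
      have "inv g \<otimes> \<tau> (int j) = p g \<otimes> \<tau> i"
        using pz(2)[OF g] \<tau> pc by (simp add: i_def m_assoc)
      also have "\<dots> = \<tau> i \<otimes> q"
        using \<tau>inv(1)[of i] \<tau>(1) pc by (simp add: q_def m_assoc[symmetric])
      finally have gq: "inv g \<otimes> \<tau> (int j) = \<tau> i \<otimes> q" .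
      have mem: "\<tau> (int j) \<otimes> f \<in> g <# B \<longleftrightarrow> \<tau> i \<otimes> (q \<otimes> f) \<in> B" if f: "f \<in> F" for f
      proof -
        have fc: "f \<in> carrier G" using f by auto
        have e: "inv g \<otimes> (\<tau> (int j) \<otimes> f) = \<tau> i \<otimes> (q \<otimes> f)"
          using gq \<tau>(1) gc fc q by (simp add: m_assoc[symmetric])
        show ?thesis
        proof
          assume "\<tau> (int j) \<otimes> f \<in> g <# B"
          then obtain b where "b \<in> B" "\<tau> (int j) \<otimes> f = g \<otimes> b" by (auto simp: l_coset_def)
          then show "\<tau> i \<otimes> (q \<otimes> f) \<in> B" using e gc B by (auto simp: m_assoc[symmetric])
        next
          assume a: "\<tau> i \<otimes> (q \<otimes> f) \<in> B"
          have "\<tau> (int j) \<otimes> f = g \<otimes> (\<tau> i \<otimes> (q \<otimes> f))"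
            unfolding e[symmetric] using gc fc \<tau>(1) by (simp add: m_assoc[symmetric])
          then show "\<tau> (int j) \<otimes> f \<in> g <# B" using a by (auto simp: l_coset_def)
        qed
      qed
      have "bij_betw (\<lambda>f. q \<otimes> f) {f \<in> F. \<tau> (int j) \<otimes> f \<in> g <# B} {f \<in> F. \<tau> i \<otimes> f \<in> B}"
      proof (rule bij_betw_byWitness[where f' = "\<lambda>f. inv q \<otimes> f"])
        show "\<forall>f\<in>{f \<in> F. \<tau> (int j) \<otimes> f \<in> g <# B}. inv q \<otimes> (q \<otimes> f) = f"
          using q by (auto simp: m_assoc[symmetric])
        show "\<forall>f\<in>{f \<in> F. \<tau> i \<otimes> f \<in> B}. q \<otimes> (inv q \<otimes> f) = f"
          using q by (auto simp: m_assoc[symmetric])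
        show "(\<lambda>f. q \<otimes> f) ` {f \<in> F. \<tau> (int j) \<otimes> f \<in> g <# B} \<subseteq> {f \<in> F. \<tau> i \<otimes> f \<in> B}"
          using q mem by auto
        show "(\<lambda>f. inv q \<otimes> f) ` {f \<in> F. \<tau> i \<otimes> f \<in> B} \<subseteq> {f \<in> F. \<tau> (int j) \<otimes> f \<in> g <# B}"
        proof
          fix x assume "x \<in> (\<lambda>f. inv q \<otimes> f) ` {f \<in> F. \<tau> i \<otimes> f \<in> B}"
          then obtain f where f: "f \<in> F" "\<tau> i \<otimes> f \<in> B" "x = inv q \<otimes> f" by auto
          then have "x \<in> F" "q \<otimes> x = f" using q by (auto simp: m_assoc[symmetric])
          then show "x \<in> {f \<in> F. \<tau> (int j) \<otimes> f \<in> g <# B}" using mem f by auto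
        qed
      qed
      then show ?thesis using bij_betw_same_card by (fastforce simp: c_def i_def add.commute)
    qed
    then have "\<mu> (g <# B) = (\<Sum>j<L'. c B (int j + z g)) / (real L' * n)" by (simp add: \<mu>_def)
    then have "\<bar>\<mu> (g <# B) - \<mu> B\<bar> = \<bar>(\<Sum>j<L'. c B (int j + z g)) - (\<Sum>j<L'. c B (int j))\<bar> / (real L' * n)"
      using L(1) n by (simp add: \<mu>_def diff_divide_distrib[symmetric])
    also have "\<dots> \<le> (\<bar>real_of_int (z g)\<bar> * n) / (real L' * n)"
      using abs_sum_shift_le[where c = "c B" and C = n and L = L' and z = "z g"] c L(1) n
        by (intro divide_right_mono) auto
    also have "\<dots> \<le> of_int m / real L'" using m[OF g] n L(1) by (simp add: divide_right_mono)
    finally show ?thesis using L(2) by simp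
  qed
  ultimately show "\<exists>\<mu> :: 'a set \<Rightarrow> real.
        (\<forall>B. 0 \<le> \<mu> B \<and> \<mu> B \<le> 1) \<and> \<mu> (carrier G) = 1 \<and>
        (\<forall>B C. B \<inter> C = {} \<longrightarrow> \<mu> (B \<union> C) = \<mu> B + \<mu> C) \<and>
        (\<forall>g\<in>E. \<forall>B \<subseteq> carrier G. \<bar>\<mu> (g <# B) - \<mu> B\<bar> \<le> \<epsilon>)"
    by (intro exI[of _ \<mu>]) simp
qed

section \<open>Free subgroups and non-amenability\<close>

definition letter_value :: "('a, 'b) monoid_scheme \<Rightarrow> 'a \<times> bool \<Rightarrow> 'a" where
  "letter_value G l = (if snd l then fst l else inv\<^bsub>G\<^esub> (fst l))"

lemma word_value_simps [simp]:
  "word_value G [] = \<one>\<^bsub>G\<^esub>"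
  "word_value G (l # w) = letter_value G l \<otimes>\<^bsub>G\<^esub> word_value G w"
  by (simp_all add: word_value_def letter_value_def case_prod_beta)

definition letter_inv :: "'a \<times> bool \<Rightarrow> 'a \<times> bool" where
  "letter_inv l = (fst l, \<not> snd l)"

lemma letter_inv_letter_inv [simp]: "letter_inv (letter_inv l) = l"
  by (simp add: letter_inv_def)

lemma reduced_words_Nil [simp]: "[] \<in> reduced_words X"
  by (simp add: reduced_words_def)

lemma reduced_words_Cons:
  "l # w \<in> reduced_words X \<longleftrightarrow>
     fst l \<in> X \<and> w \<in> reduced_words X \<and> (w = [] \<or> hd w \<noteq> letter_inv l)"
  by (cases l; cases w) (auto simp: reduced_words_def letter_inv_def case_prod_beta prod_eq_iff
      mem_Times_iff)

context group
begin

lemma letter_value_closed [simp]: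
  "fst l \<in> carrier G \<Longrightarrow> letter_value G l \<in> carrier G"
  by (simp add: letter_value_def)

lemma letter_value_letter_inv:
  "fst l \<in> carrier G \<Longrightarrow> letter_value G (letter_inv l) = inv (letter_value G l)"
  by (simp add: letter_value_def letter_inv_def)

lemma word_value_closed:
  assumes "X \<subseteq> carrier G" "w \<in> reduced_words X"
  shows "word_value G w \<in> carrier G"
  using assms(2) by (induction w) (use assms(1) in \<open>auto simp: reduced_words_Cons\<close>)

lemma letter_mult_reduced_word:
  assumes "X \<subseteq> carrier G" "fst l \<in> X" "w \<in> reduced_words X"
  shows "\<exists>w' \<in> reduced_words X. word_value G w' = letter_value G l \<otimes> word_value G w"
proof (cases "w \<noteq> [] \<and> hd w = letter_inv l")
  case True
  then obtain w' where w: "w = letter_inv l # w'" by (cases w) auto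
  then have w': "w' \<in> reduced_words X" using assms(3) by (simp add: reduced_words_Cons)
  have lc: "fst l \<in> carrier G" using assms by auto
  have "letter_value G l \<otimes> word_value G w = word_value G w'"
    using word_value_closed[OF assms(1) w'] lc
    by (simp add: w letter_value_letter_inv m_assoc[symmetric])
  then show ?thesis using w' by force
next
  case False
  then have "l # w \<in> reduced_words X" using assms by (auto simp: reduced_words_Cons)
  then show ?thesis by force
qed

lemma subgroup_reduced_word_values:
  assumes X: "X \<subseteq> carrier G"
  shows "subgroup (word_value G ` reduced_words X) G"
proof -
  let ?F = "word_value G ` reduced_words X"
  have mult: "word_value G v \<otimes> y \<in> ?F" if "v \<in> reduced_words X" "y \<in> ?F" for v y
    using that(1)
  proof (induction v)
    case Nil
    then show ?case using that(2) word_value_closed[OF X] by auto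
  next
    case (Cons l v)
    then have v: "v \<in> reduced_words X" "fst l \<in> X" by (simp_all add: reduced_words_Cons)
    then obtain u where u: "u \<in> reduced_words X" "word_value G v \<otimes> y = word_value G u" using Cons.IH by auto
    have "word_value G (l # v) \<otimes> y = letter_value G l \<otimes> word_value G u"
      using u(2) word_value_closed[OF X v(1)] v(2) X that(2) word_value_closed[OF X]
      by (auto simp: m_assoc)
    moreover obtain w where "w \<in> reduced_words X" "word_value G w = letter_value G l \<otimes> word_value G u"
      using letter_mult_reduced_word[OF X v(2) u(1)] by auto
    ultimately show ?case by (metis imageI)
  qed
  have inv: "inv (word_value G v) \<in> ?F" if "v \<in> reduced_words X" for v
    using that
  proof (induction v)
    case (Cons l v)
    then have v: "v \<in> reduced_words X" "fst l \<in> X" by (simp_all add: reduced_words_Cons)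
    have lc: "fst l \<in> carrier G" using v(2) X by auto
    obtain u where u: "u \<in> reduced_words X" "inv (word_value G v) = word_value G u" using Cons.IH v(1)
      by auto
    have "word_value G [letter_inv l] = inv (letter_value G l)"
      using lc by (simp add: letter_value_letter_inv)
    moreover have "[letter_inv l] \<in> reduced_words X" using v(2)
      by (simp add: reduced_words_Cons letter_inv_def)
    ultimately have "inv (letter_value G l) \<in> ?F" by (metis imageI)
    then have "word_value G u \<otimes> inv (letter_value G l) \<in> ?F" using mult[OF u(1)] by simp
    moreover have "inv (word_value G (l # v)) = word_value G u \<otimes> inv (letter_value G l)"
      using lc word_value_closed[OF X v(1)] by (simp add: inv_mult_group u(2))
    ultimately show ?case by simp
  qed (auto intro!: image_eqI[of _ _ "[]"])
  show ?thesis
    by (rule subgroupI) (use mult inv word_value_closed[OF X] reduced_words_Nil in blast)+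
qed

text \<open>
  Values of reduced words already form a subgroup, so injectivity of \<open>word_value\<close> on them is all that
  freeness requires.
\<close>
lemma contains_nonabelian_free_subgroupI:
  assumes X: "X \<subseteq> carrier G" and xy: "x \<in> X" "y \<in> X" "x \<noteq> y"
    and inj: "inj_on (word_value G) (reduced_words X)"
  shows "contains_nonabelian_free_subgroup G"
proof -
  let ?F = "word_value G ` reduced_words X"
  let ?H = "G\<lparr>carrier := ?F\<rparr>"
  have F: "subgroup ?F G" by (rule subgroup_reduced_word_values[OF X])
  have XF: "X \<subseteq> ?F"
  proof
    fix x assume "x \<in> X"
    then have "[(x, True)] \<in> reduced_words X" "word_value G [(x, True)] = x"
      using X by (auto simp: reduced_words_Cons letter_value_def)
    then show "x \<in> ?F" by (metis imageI)
  qed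
  have eq: "word_value ?H w = word_value G w" if "w \<in> reduced_words X" for w
    using that
  proof (induction w)
    case (Cons l w)
    then have "letter_value ?H l = letter_value G l"
      using m_inv_consistent[OF F] XF by (auto simp: letter_value_def reduced_words_Cons)
    then show ?case using Cons by (simp add: reduced_words_Cons)
  qed simp
  have "bij_betw (word_value ?H) (reduced_words X) (carrier ?H)"
    using inj eq by (auto simp: bij_betw_def inj_on_def intro!: image_eqI)
  then have "free_on ?H X" using subgroup.subgroup_is_group[OF F is_group] XF by (simp add: free_on_def)
  moreover have "\<not> comm_group ?H"
  proof
    assume "comm_group ?H"
    then have "x \<otimes> y = y \<otimes> x" using comm_groupE(4)[of ?H x y] xy XF by auto
    then have "word_value G [(x, True), (y, True)] = word_value G [(y, True), (x, True)]"
      using X[THEN subsetD, OF xy(1)] X[THEN subsetD, OF xy(2)] by (simp add: letter_value_def)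
    moreover have "[(x, True), (y, True)] \<in> reduced_words X" "[(y, True), (x, True)] \<in> reduced_words X"
      using xy by (auto simp: reduced_words_Cons letter_inv_def)
    ultimately show False using inj_onD[OF inj] xy(3) by blast
  qed
  ultimately show ?thesis using F unfolding contains_nonabelian_free_subgroup_def by blast
qed

text \<open>
  The paradoxical decomposition of a free group, spread over the whole group along representatives of
  the right cosets of the subgroup \<open>F\<close> of word values: \<open>B l\<close> consists of the elements whose word begins
  with the letter \<open>l\<close>. For each letter, \<open>B l\<close> and a translate of \<open>B (letter_inv l)\<close> cover the group, so
  their measures add up to at least 1; but the four sets for the letters of \<open>x\<close> and \<open>y\<close> are disjoint.
\<close>
lemma not_amenable_if_free_pair:
  assumes X: "X \<subseteq> carrier G" and xy: "x \<in> X" "y \<in> X" "x \<noteq> y"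
    and inj: "inj_on (word_value G) (reduced_words X)"
  shows "\<not> amenable G"
proof
  assume "amenable G"
  from this[unfolded amenable_def] obtain \<mu> where
        "(\<forall>B \<subseteq> carrier G. 0 \<le> \<mu> B) \<and> \<mu> (carrier G) = (1::real) \<and>
        (\<forall>B \<subseteq> carrier G. \<forall>C \<subseteq> carrier G. B \<inter> C = {} \<longrightarrow> \<mu> (B \<union> C) = \<mu> B + \<mu> C) \<and>
        (\<forall>g \<in> carrier G. \<forall>B \<subseteq> carrier G. \<mu> (g <# B) = \<mu> B)"
    by (rule exE)
  then have nonneg: "\<And>B. B \<subseteq> carrier G \<Longrightarrow> 0 \<le> \<mu> B" and one: "\<mu> (carrier G) = (1::real)"
    and add: "\<And>B C. B \<subseteq> carrier G \<Longrightarrow> C \<subseteq> carrier G \<Longrightarrow> B \<inter> C = {} \<Longrightarrow> \<mu> (B \<union> C) = \<mu> B + \<mu> C"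
    and inv: "\<And>g B. g \<in> carrier G \<Longrightarrow> B \<subseteq> carrier G \<Longrightarrow> \<mu> (g <# B) = \<mu> B"
    by simp_all
  let ?F = "word_value G ` reduced_words X"
  have F: "subgroup ?F G" by (rule subgroup_reduced_word_values[OF X])
  interpret F: subgroup ?F G by (rule F)
  define rep where "rep C = (SOME g. g \<in> C)" for C :: "'a set"
  have dec: "\<exists>w \<in> reduced_words X. g = word_value G w \<otimes> rep (?F #> g)" and rc: "rep (?F #> g) \<in> carrier G"
    if g: "g \<in> carrier G" for g
  proof -
    define C where "C = ?F #> g"
    have rC: "rep C \<in> C" unfolding rep_def C_def using rcos_self[OF g F] by (rule someI)
    then have "rep C \<in> carrier G" using r_coset_subset_G[OF F.subset g] by (auto simp: C_def)
    moreover have "C = ?F #> rep C" using repr_independence[OF rC[unfolded C_def] g F] by (simp add: C_def)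
    then have "g \<in> ?F #> rep C" using rcos_self[OF g F] by (simp add: C_def)
    ultimately show "\<exists>w \<in> reduced_words X. g = word_value G w \<otimes> rep (?F #> g)" "rep (?F #> g) \<in> carrier G"
      unfolding C_def[symmetric] by (auto simp: r_coset_def)
  qed
  have cos: "?F #> (letter_value G l \<otimes> g) = ?F #> g" if "g \<in> carrier G" "fst l \<in> X" for g l
  proof -
    have "[l] \<in> reduced_words X" using that by (simp add: reduced_words_Cons)
    moreover have "word_value G [l] = letter_value G l" using that X by auto
    ultimately have "letter_value G l \<in> ?F" by (metis imageI)
    then have "letter_value G l \<otimes> g \<in> ?F #> g" by (auto simp: r_coset_def)
    then show ?thesis using repr_independence[OF _ that(1) F] by simp
  qed
  define B where "B l = {g \<in> carrier G. \<exists>w. l # w \<in> reduced_words X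
      \<and> g = word_value G (l # w) \<otimes> rep (?F #> g)}" for l
  have Bc: "B l \<subseteq> carrier G" for l by (auto simp: B_def)
  have disj: "B l \<inter> B m = {}" if lm: "l \<noteq> m" for l m
  proof (rule ccontr)
    assume "B l \<inter> B m \<noteq> {}"
    then obtain g v w where g: "g \<in> carrier G" and v: "l # v \<in> reduced_words X"
        and w: "m # w \<in> reduced_words X"
      and e: "word_value G (l # v) \<otimes> rep (?F #> g) = word_value G (m # w) \<otimes> rep (?F #> g)"
      unfolding B_def by (smt (verit, del_insts) Int_iff all_not_in_conv mem_Collect_eq)
    have "word_value G (l # v) = word_value G (m # w)"
      using e right_cancel[OF rc[OF g] word_value_closed[OF X v] word_value_closed[OF X w]] by simp
    then show False using inj_onD[OF inj _ v w] lm by blast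
  qed
  have cover: "carrier G \<subseteq> B l \<union> (letter_value G l <# B (letter_inv l))" if l: "fst l \<in> X" for l
  proof
    fix g assume g: "g \<in> carrier G"
    have lc: "letter_value G l \<in> carrier G" using l X by auto
    obtain w where w: "w \<in> reduced_words X" "g = word_value G w \<otimes> rep (?F #> g)" using dec[OF g] by auto
    show "g \<in> B l \<union> (letter_value G l <# B (letter_inv l))"
    proof (cases "w \<noteq> [] \<and> hd w = l")
      case True
      then have "w = l # tl w" by (cases w) auto
      then have "g \<in> B l" using w g unfolding B_def by (metis (mono_tags, lifting) mem_Collect_eq)
      then show ?thesis by simp
    next
      case False
      let ?h = "letter_value G (letter_inv l) \<otimes> g"
      have li: "fst (letter_inv l) \<in> X" using l by (simp add: letter_inv_def)
      have lv: "letter_value G (letter_inv l) = inv (letter_value G l)"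
        using letter_value_letter_inv[of l] l X by auto
      have h: "?h \<in> carrier G" using lv lc g by simp
      have r: "letter_inv l # w \<in> reduced_words X" using False w(1) li by (auto simp: reduced_words_Cons)
      have "?h = word_value G (letter_inv l # w) \<otimes> rep (?F #> ?h)"
        unfolding cos[OF g li]
        using lc rc[OF g] word_value_closed[OF X w(1)] lv by (subst w(2)) (simp add: m_assoc)
      then have "?h \<in> B (letter_inv l)" using h r unfolding B_def by blast
      moreover have "g = letter_value G l \<otimes> ?h" using lc g by (simp add: lv m_assoc[symmetric])
      ultimately show ?thesis unfolding l_coset_def by blast
    qed
  qed
  have half: "\<mu> (B l) + \<mu> (B (letter_inv l)) \<ge> 1" if l: "fst l \<in> X" for l
  proof -
    have lc: "letter_value G l \<in> carrier G" using l X by auto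
    let ?C = "letter_value G l <# B (letter_inv l)"
    have Cc: "?C \<subseteq> carrier G" using lc Bc[of "letter_inv l"] by (auto simp: l_coset_def)
    have "carrier G = B l \<union> (?C - B l)" using cover[OF l] Bc Cc by blast
    then have "1 = \<mu> (B l \<union> (?C - B l))" using one by metis
    also have "\<dots> = \<mu> (B l) + \<mu> (?C - B l)" by (rule add) (use Bc Cc in auto)
    also have "\<mu> ?C = \<mu> ((?C - B l) \<union> (?C \<inter> B l))" by (rule arg_cong[of _ _ \<mu>]) auto
    then have "\<mu> ?C = \<mu> (?C - B l) + \<mu> (?C \<inter> B l)" by (subst add[symmetric]) (use Cc in auto)
    then have "\<mu> (?C - B l) \<le> \<mu> ?C" using nonneg[of "?C \<inter> B l"] Cc by auto
    finally show ?thesis using inv[OF lc Bc] by simp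
  qed
  let ?a = "(x, True)" and ?b = "(x, False)" and ?c = "(y, True)" and ?d = "(y, False)"
  have "\<mu> (B ?a) + \<mu> (B ?b) \<ge> 1" "\<mu> (B ?c) + \<mu> (B ?d) \<ge> 1"
    using half[of ?a] half[of ?c] xy by (simp_all add: letter_inv_def)
  moreover have "\<mu> ((B ?a \<union> B ?b) \<union> (B ?c \<union> B ?d)) = (\<mu> (B ?a) + \<mu> (B ?b)) + (\<mu> (B ?c) + \<mu> (B ?d))"
  proof -
    have "\<mu> (B ?a \<union> B ?b) = \<mu> (B ?a) + \<mu> (B ?b)" by (rule add[OF Bc Bc disj]) simp
    moreover have "\<mu> (B ?c \<union> B ?d) = \<mu> (B ?c) + \<mu> (B ?d)" by (rule add[OF Bc Bc disj]) simp
    moreover have "(B ?a \<union> B ?b) \<inter> (B ?c \<union> B ?d) = {}"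
      using disj[of ?a ?c] disj[of ?a ?d] disj[of ?b ?c] disj[of ?b ?d] xy(3) by auto
    then have "\<mu> ((B ?a \<union> B ?b) \<union> (B ?c \<union> B ?d)) = \<mu> (B ?a \<union> B ?b) + \<mu> (B ?c \<union> B ?d)"
      by (rule add[rotated 2]) (use Bc in auto)
    ultimately show ?thesis by simp
  qed
  moreover have "\<mu> S \<le> 1" if "S \<subseteq> carrier G" for S
  proof -
    have "\<mu> (S \<union> (carrier G - S)) = \<mu> S + \<mu> (carrier G - S)" by (rule add) (use that in auto)
    moreover have "S \<union> (carrier G - S) = carrier G" using that by auto
    ultimately show ?thesis using one nonneg[of "carrier G - S"] by auto
  qed
  ultimately show False using Bc[of ?a] Bc[of ?b] Bc[of ?c] Bc[of ?d]
    by (smt (verit, best) Un_subset_iff)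
qed

end

lemma word_value_hom:
  assumes "group G" "group H" "f \<in> hom G H" "X \<subseteq> carrier G" "w \<in> reduced_words X"
  shows "word_value H (map (\<lambda>l. (f (fst l), snd l)) w) = f (word_value G w)"
proof -
  interpret group_hom G H f using assms by (simp add: group_hom_def group_hom_axioms_def)
  show ?thesis using assms(5)
  proof (induction w)
    case (Cons l w)
    then have l: "fst l \<in> carrier G" "w \<in> reduced_words X" using assms(4) by (auto simp: reduced_words_Cons)
    then have "letter_value H (f (fst l), snd l) = f (letter_value G l)" by (simp add: letter_value_def)
    then show ?case using Cons l G.word_value_closed[OF assms(4) l(2)] by simp
  qed simp
qed

lemma inj_on_word_value_iso:
  assumes "group G" "group H" "f \<in> iso G H" "X \<subseteq> carrier G" "inj_on (word_value G) (reduced_words X)"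
  shows "inj_on (word_value H) (reduced_words (f ` X))"
proof (rule inj_onI)
  interpret G: group G by fact
  have f: "f \<in> hom G H" "inj_on f (carrier G)" using assms(3) by (auto simp: iso_def bij_betw_def)
  define g where "g = inv_into (carrier G) f"
  have gf: "g (f x) = x" if "x \<in> X" for x using that assms(4) f(2) by (auto simp: g_def)
  have pull: "\<exists>v \<in> reduced_words X. w = map (\<lambda>l. (f (fst l), snd l)) v" if "w \<in> reduced_words (f ` X)" for w
    using that
  proof (induction w)
    case (Cons l w)
    then obtain v where v: "v \<in> reduced_words X" "w = map (\<lambda>l. (f (fst l), snd l)) v"
      by (auto simp: reduced_words_Cons)
    obtain x where x: "x \<in> X" "fst l = f x" using Cons.prems by (auto simp: reduced_words_Cons)
    have "v = [] \<or> hd v \<noteq> letter_inv (x, snd l)"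
    proof (rule ccontr)
      assume "\<not> (v = [] \<or> hd v \<noteq> letter_inv (x, snd l))"
      then have "hd w = letter_inv l \<and> w \<noteq> []" using v x by (cases v) (auto simp: letter_inv_def)
      then show False using Cons.prems by (auto simp: reduced_words_Cons)
    qed
    then have "(x, snd l) # v \<in> reduced_words X" using v x by (simp add: reduced_words_Cons)
    moreover have "l # w = map (\<lambda>l. (f (fst l), snd l)) ((x, snd l) # v)" using v x
      by (simp add: prod_eq_iff)
    ultimately show ?case by (intro bexI[of _ "(x, snd l) # v"])
  qed (auto intro!: bexI[of _ "[]"])
  fix w w' assume w: "w \<in> reduced_words (f ` X)" "w' \<in> reduced_words (f ` X)"
    and e: "word_value H w = word_value H w'"
  obtain v v' where v: "v \<in> reduced_words X" "w = map (\<lambda>l. (f (fst l), snd l)) v"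
    "v' \<in> reduced_words X" "w' = map (\<lambda>l. (f (fst l), snd l)) v'" using pull w by blast
  have "f (word_value G v) = f (word_value G v')"
    using e v word_value_hom[OF assms(1,2) f(1) assms(4)] by simp
  then have "word_value G v = word_value G v'"
    using inj_onD[OF f(2)] G.word_value_closed[OF assms(4)] v by simp
  then have "v = v'" using inj_onD[OF assms(5)] v by blast
  then show "w = w'" using v by simp
qed

section \<open>Shifts and twisted three-cycles\<close>

text \<open>
  The permutations are total functions, so that the group operation is plain composition.
\<close>
definition perms :: "('a \<Rightarrow> 'a) monoid" where
  "perms = \<lparr>carrier = {f. bij f}, monoid.mult = (\<circ>), one = id\<rparr>"

lemma perm_simps [simp]:
  "f \<in> carrier perms \<longleftrightarrow> bij f" "f \<otimes>\<^bsub>perms\<^esub> g = f \<circ> g" "\<one>\<^bsub>perms\<^esub> = id"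
  by (simp_all add: perms_def)

lemma group_perm: "group perms"
proof (rule groupI)
  fix f :: "'a \<Rightarrow> 'a" assume "f \<in> carrier perms"
  then have "bij f" by simp
  then show "\<exists>g\<in>carrier perms. g \<otimes>\<^bsub>perms\<^esub> f = \<one>\<^bsub>perms\<^esub>"
    using bij_imp_bij_inv[OF \<open>bij f\<close>] bij_is_inj[OF \<open>bij f\<close>]
    by (intro bexI[of _ "inv_into UNIV f"]) simp_all
qed (auto simp: bij_comp o_assoc)

lemma inv_perm: "f \<circ> g = id \<Longrightarrow> g \<circ> f = id \<Longrightarrow> inv\<^bsub>perms\<^esub> f = g"
  by (intro group.inv_equality[OF group_perm]) (auto intro: o_bij)

lemma inv_perm_comp:
  assumes "bij f" shows "f \<circ> inv\<^bsub>perms\<^esub> f = id" "inv\<^bsub>perms\<^esub> f \<circ> f = id"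
  using group.r_inv[OF group_perm, of f] group.l_inv[OF group_perm, of f] assms by simp_all

context
  fixes H :: "('a \<Rightarrow> 'a) set"
  assumes H: "subgroup H perms"
begin

lemma subgroup_perm_comp: "f \<in> H \<Longrightarrow> g \<in> H \<Longrightarrow> f \<circ> g \<in> H"
  using subgroup.m_closed[OF H, of f g] by simp

lemma subgroup_perm_id: "id \<in> H"
  using subgroup.one_closed[OF H] by simp

lemma subgroup_perm_bij: "f \<in> H \<Longrightarrow> bij f"
  using subgroup.mem_carrier[OF H, of f] by simp

lemma subgroup_perm_inv: "f \<in> H \<Longrightarrow> f \<circ> g = id \<Longrightarrow> g \<circ> f = id \<Longrightarrow> g \<in> H"
  using subgroup.m_inv_closed[OF H, of f] inv_perm[of f g] by simp

lemma group_restrict_perm: "group (perms\<lparr>carrier := H\<rparr>)"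
  by (rule subgroup.subgroup_is_group[OF H group_perm])

lemma inv_restrict_perm: "f \<in> H \<Longrightarrow> inv\<^bsub>perms\<lparr>carrier := H\<rparr>\<^esub> f = inv\<^bsub>perms\<^esub> f"
  by (rule group.m_inv_consistent[OF group_perm H])

lemma normal_restrict_perm_conj:
  assumes "N \<lhd> perms\<lparr>carrier := H\<rparr>" "f \<in> N" "g \<in> H" "g \<circ> g' = id" "g' \<circ> g = id"
  shows "g \<circ> f \<circ> g' \<in> N"
  using normal.inv_op_closed2[OF assms(1), of g f] assms inv_restrict_perm[of g] inv_perm[of g g'] by simp

lemma normal_restrict_perm_comp:
  assumes "N \<lhd> perms\<lparr>carrier := H\<rparr>" "f \<in> N" "g \<in> N"
  shows "f \<circ> g \<in> N"
  using subgroup.m_closed[OF normal_imp_subgroup[OF assms(1)] assms(2,3)] by simp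

lemma normal_restrict_perm_inv:
  assumes "N \<lhd> perms\<lparr>carrier := H\<rparr>" "f \<in> N" "f \<circ> g = id" "g \<circ> f = id"
  shows "g \<in> N"
proof -
  have "f \<in> H" using subgroup.mem_carrier[OF normal_imp_subgroup[OF assms(1)] assms(2)] by simp
  then show ?thesis
    using subgroup.m_inv_closed[OF normal_imp_subgroup[OF assms(1)] assms(2)] inv_restrict_perm inv_perm[OF
        assms(3,4)]
    by simp
qed

end

type_synonym point = "nat \<times> int \<times> int \<times> int"

text \<open>
  Distance between consecutive windows of block \<open>n\<close>. It grows fast enough for a full turn of block \<open>n\<close>
  to remain a small displacement in every later block.
\<close>
abbreviation stride :: "nat \<Rightarrow> int" where "stride n \<equiv> 8 ^ n"

abbreviation rows :: "nat \<Rightarrow> int" where "rows n \<equiv> 5 * 8 ^ n"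

text \<open>
  Residues modulo \<open>n\<close> as a fundamental domain. The sheet of index 0 is empty, which keeps every twisted
  cycle away from the line.
\<close>
definition sheet :: "nat \<Rightarrow> (int \<times> int) set" where
  "sheet n = {0..<int n} \<times> {0..<int n}"

definition block :: "nat \<Rightarrow> point set" where
  "block n = {n} \<times> {0..<rows n} \<times> sheet n"

lemma mem_block: "(n, i, y) \<in> block m \<longleftrightarrow> n = m \<and> 0 \<le> i \<and> i < rows n \<and> y \<in> sheet n"
  by (auto simp: block_def)

lemma finite_block: "finite (block n)"
  by (simp add: block_def sheet_def)

lemma sheet_0 [simp]: "sheet 0 = {}" by (simp add: sheet_def)

text \<open>
  The \<open>z\<close>-th power of the identity matrix (\<open>v = 0\<close>), of the upper (\<open>v = 1\<close>) and of the lower (\<open>v = 2\<close>)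
  elementary matrix with entry 3, acting modulo \<open>n\<close>.
\<close>
definition twist :: "nat \<Rightarrow> nat \<Rightarrow> int \<Rightarrow> int \<times> int \<Rightarrow> int \<times> int" where
  "twist v n z = (\<lambda>(x, y). if v = 1 then ((x + 3 * z * y) mod int n, y)
     else if v = 2 then (x, (y + 3 * z * x) mod int n) else (x, y))"

lemma twist_sheet: "y \<in> sheet n \<Longrightarrow> twist v n z y \<in> sheet n"
  by (cases y) (auto simp: twist_def sheet_def)

lemma twist_0: "y \<in> sheet n \<Longrightarrow> twist v n 0 y = y"
  by (cases y) (auto simp: twist_def sheet_def)

lemma twist_add: "twist v n (z + z') y = twist v n z (twist v n z' y)"
  by (cases y) (auto simp: twist_def mod_simps algebra_simps)

text \<open>
  A permutation of the row indices acts on a block by twisting every sheet according to the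
  displacement of its row. As displacements add up under composition and the twists form an action of
  the integers, lifting is a homomorphism (\<open>lift_comp\<close>), so that relations between permutations of
  rows hold for all twists alike.
\<close>
definition lift :: "nat \<Rightarrow> (nat \<Rightarrow> int \<Rightarrow> int) \<Rightarrow> point \<Rightarrow> point" where
  "lift v \<rho> = (\<lambda>(n, i, y). if y \<in> sheet n then (n, \<rho> n i, twist v n (\<rho> n i - i) y) else (n, i, y))"

lemma lift_apply: "lift v \<rho> (n, i, y) = (if y \<in> sheet n then (n, \<rho> n i, twist v n (\<rho> n i - i) y) else (n, i,
    y))"
  by (simp add: lift_def)

lemma lift_comp: "lift v \<rho> \<circ> lift v \<rho>' = lift v (\<lambda>n. \<rho> n \<circ> \<rho>' n)"
proof
  fix p :: point
  obtain n i y where p: "p = (n, i, y)" by (cases p)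
  show "(lift v \<rho> \<circ> lift v \<rho>') p = lift v (\<lambda>n. \<rho> n \<circ> \<rho>' n) p"
    using twist_add[of v n "\<rho> n (\<rho>' n i) - \<rho>' n i" "\<rho>' n i - i" y]
    by (simp add: p lift_apply twist_sheet)
qed

lemma lift_id: "lift v (\<lambda>n. id) = id"
  by (rule ext) (auto simp: lift_def twist_0)

lemma lift_eqI: "(\<And>n i. n > 0 \<Longrightarrow> \<rho> n i = \<rho>' n i) \<Longrightarrow> lift v \<rho> = lift v \<rho>'"
  by (rule ext) (auto simp: lift_def sheet_def)

definition cyc :: "int \<Rightarrow> int \<Rightarrow> int" where
  "cyc s i = (if i = s then s + 1 else if i = s + 1 then s + 2 else if i = s + 2 then s else i)"

definition cyc' :: "int \<Rightarrow> int \<Rightarrow> int" where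
  "cyc' s i = (if i = s then s + 2 else if i = s + 1 then s else if i = s + 2 then s + 1 else i)"

lemma cyc_inv [simp]: "cyc s (cyc' s i) = i" "cyc' s (cyc s i) = i"
  by (auto simp: cyc_def cyc'_def)

lemma cyc_commute: "\<bar>s - s'\<bar> > 2 \<Longrightarrow> cyc s (cyc s' i) = cyc s' (cyc s i)"
  by (auto simp: cyc_def)

lemma cyc_cyc'_commute: "\<bar>s - s'\<bar> > 2 \<Longrightarrow> cyc' s (cyc s' i) = cyc s' (cyc' s i)"
  by (metis cyc_inv cyc_commute)

text \<open>
  With \<open>x\<close>, \<open>x1\<close>, \<open>x2\<close> the cycles starting at \<open>s\<close>, \<open>s + 1\<close>, \<open>s + 2\<close>, the commutator of \<open>x\<close> and \<open>x2\<close>,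
  which overlap in one row, is again a three-cycle, and \<open>x1\<close> conjugates it to the inverse of \<open>x\<close>. Being
  an expression for \<open>x\<close> through a commutator, this identity plays the part of perfectness.
\<close>
lemma cyc_relation:
  "cyc' (s + 1) (cyc s (cyc (s + 2) (cyc' s (cyc' (s + 2) (cyc (s + 1) i))))) = cyc' s i"
proof -
  consider "i = s" | "i = s + 1" | "i = s + 2" | "i = s + 3" | "i = s + 4" | "i \<notin> {s, s+1, s+2, s+3, s+4}"
    by auto
  then show ?thesis by cases (simp_all add: cyc_def cyc'_def)
qed

definition tcycle :: "nat \<Rightarrow> (nat \<Rightarrow> int) \<Rightarrow> nat set \<Rightarrow> point \<Rightarrow> point" where
  "tcycle v s J = lift v (\<lambda>n. if n \<in> J then cyc (s n) else id)"

definition tcycle' :: "nat \<Rightarrow> (nat \<Rightarrow> int) \<Rightarrow> nat set \<Rightarrow> point \<Rightarrow> point" where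
  "tcycle' v s J = lift v (\<lambda>n. if n \<in> J then cyc' (s n) else id)"

lemma tcycle_inv: "tcycle v s J \<circ> tcycle' v s J = id" "tcycle' v s J \<circ> tcycle v s J = id"
  unfolding tcycle_def tcycle'_def lift_comp lift_id[of v, symmetric]
  by (intro lift_eqI; auto)+

lemma bij_tcycle: "bij (tcycle v s J)" "bij (tcycle' v s J)"
  using o_bij[OF tcycle_inv] o_bij[OF tcycle_inv(2,1)] by blast+

lemma tcycle_Un: "J \<inter> J' = {} \<Longrightarrow> tcycle v s (J \<union> J') = tcycle v s J \<circ> tcycle v s J'"
  unfolding tcycle_def lift_comp by (intro lift_eqI) auto

lemma tcycle_Diff: "J' \<subseteq> J \<Longrightarrow> tcycle v s (J - J') = tcycle' v s J' \<circ> tcycle v s J"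
  unfolding tcycle_def tcycle'_def lift_comp by (intro lift_eqI) auto

lemma tcycle_empty: "tcycle v s {} = id"
  by (simp add: tcycle_def lift_id)

text \<open>
  A block forgets the exponent of the shift up to a multiple of its number of rows. The line records it
  as an integer, which is a homomorphism on all of the groups considered.
\<close>
definition shift :: "int \<Rightarrow> point \<Rightarrow> point" where
  "shift z = (\<lambda>(n, i, y). if n = 0 then (n, i + z, y)
     else if (n, i, y) \<in> block n then (n, (i + z) mod rows n, y) else (n, i, y))"

lemma shift_apply: "shift z (n, i, y) = (if n = 0 then (n, i + z, y)
     else if (n, i, y) \<in> block n then (n, (i + z) mod rows n, y) else (n, i, y))"
  by (simp add: shift_def)

lemma shift_add: "shift (z + z') = shift z \<circ> shift z'"
proof
  fix p :: point
  obtain n i y where p: "p = (n, i, y)" by (cases p)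
  have "(i + (z + z')) mod rows n = ((i + z') mod rows n + z) mod rows n"
    by (simp add: mod_simps algebra_simps)
  then show "shift (z + z') p = (shift z \<circ> shift z') p"
    by (auto simp: p shift_apply mem_block)
qed

lemma shift_0: "shift 0 = id"
  by (rule ext) (auto simp: shift_def mem_block)

lemma shift_inv: "shift z \<circ> shift (- z) = id" "shift (- z) \<circ> shift z = id"
  by (simp_all add: shift_add[symmetric] shift_0)

lemma bij_shift: "bij (shift z)"
  using o_bij[OF shift_inv(2,1)] .

text \<open>
  The only requirement is that neither triple of rows crosses the end of the block: the rotation
  would then still permute the rows correctly, but the displacements, and with them the twists, would
  change by a full turn.
\<close>
lemma shift_tcycle:
  assumes "\<And>n. n \<in> J \<Longrightarrow> n > 0 \<Longrightarrow> 0 \<le> s n \<and> s n + 2 < rows n \<and> 0 \<le> s' n \<and> s' n + 2 < rows n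
      \<and> (\<exists>m. s n + z = s' n + m * rows n)"
  shows "shift z \<circ> tcycle v s J = tcycle v s' J \<circ> shift z"
proof
  fix p :: point
  obtain n i y where p: "p = (n, i, y)" by (cases p)
  show "(shift z \<circ> tcycle v s J) p = (tcycle v s' J \<circ> shift z) p"
  proof (cases "n \<in> J \<and> y \<in> sheet n")
    case False
    then show ?thesis
      by (auto simp: p shift_apply tcycle_def lift_apply mem_block twist_0)
  next
    case True
    then have n: "n > 0" by (cases n) auto
    then obtain m where s: "0 \<le> s n" "s n + 2 < rows n" "0 \<le> s' n" "s' n + 2 < rows n" "s n + z
        = s' n + m * rows n"
      using assms True by blast
    have md: "(s n + e + z) mod rows n = s' n + e" if "0 \<le> e" "e \<le> 2" for e
    proof -
      have "(s n + e + z) mod rows n = (s' n + e + m * rows n) mod rows n" using s(5)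
        by (simp add: algebra_simps)
      also have "\<dots> = (s' n + e) mod rows n" by simp
      also have "\<dots> = s' n + e" using s that by (intro mod_pos_pos_trivial) auto
      finally show ?thesis .
    qed
    have iff: "(i + z) mod rows n = s' n + e \<longleftrightarrow> i = s n + e" if "0 \<le> i" "i < rows n" "0 \<le> e" "e \<le> 2" for e
    proof
      assume a: "(i + z) mod rows n = s' n + e"
      then have "(i + z) mod rows n = (s n + e + z) mod rows n" using md that by simp
      then have "((i + z) - z) mod rows n = ((s n + e + z) - z) mod rows n" by (rule mod_diff_cong) simp
      then show "i = s n + e" using that s by simp
    qed (use md that in simp)
    show ?thesis
    proof (cases "0 \<le> i \<and> i < rows n")
      case False
      then have "i \<noteq> s n" "i \<noteq> s n + 1" "i \<noteq> s n + 2" "i \<noteq> s' n" "i \<noteq> s' n + 1" "i \<noteq> s' n + 2" using s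
        by auto
      then show ?thesis using True n False
        by (auto simp: p shift_apply tcycle_def lift_apply mem_block cyc_def twist_0)
    next
      case i: True
      note iff' = iff[of 0] iff[of 1] iff[of 2]
      consider "i = s n" | "i = s n + 1" | "i = s n + 2" | "i \<noteq> s n \<and> i \<noteq> s n + 1 \<and> i \<noteq> s n + 2" by blast
      then show ?thesis
        using True n i s md[of 0] md[of 1] md[of 2] iff'
        by cases (auto simp: p shift_apply tcycle_def lift_apply mem_block cyc_def twist_0 twist_sheet)
    qed
  qed
qed

lemma shift_tcycle_conj:
  assumes "\<And>n. n \<in> J \<Longrightarrow> n > 0 \<Longrightarrow> 0 \<le> s n \<and> s n + 2 < rows n \<and> 0 \<le> s' n \<and> s' n + 2 < rows n
      \<and> (\<exists>m. s n + z = s' n + m * rows n)"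
  shows "shift z \<circ> tcycle v s J \<circ> shift (- z) = tcycle v s' J"
  using shift_tcycle[OF assms, where v = v] shift_inv(1)[of z] by (simp add: o_assoc[symmetric])

section \<open>Restricting three-cycles to few or to almost all blocks\<close>

lemma tcycle_finite_mem:
  assumes H: "subgroup H perms" and "finite I" "\<And>n. n \<in> I \<Longrightarrow> tcycle v s {n} \<in> H"
  shows "tcycle v s I \<in> H"
  using assms(2,3)
proof (induction I)
  case empty
  show ?case unfolding tcycle_empty by (rule subgroup_perm_id[OF H])
next
  case (insert n I)
  have "tcycle v s (insert n I) = tcycle v s {n} \<circ> tcycle v s I"
    using tcycle_Un[of "{n}" I v s] insert.hyps by simp
  moreover have "tcycle v s {n} \<circ> tcycle v s I \<in> H" by (rule subgroup_perm_comp[OF H]) (use insert in auto)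
  ultimately show ?case by (simp only:)
qed

lemma tcycle'_mem: "subgroup H perms \<Longrightarrow> tcycle v s J \<in> H \<Longrightarrow> tcycle' v s J \<in> H"
  using subgroup_perm_inv[OF _ _ tcycle_inv] .

lemma tcycle_mem: "subgroup H perms \<Longrightarrow> tcycle' v s J \<in> H \<Longrightarrow> tcycle v s J \<in> H"
  using subgroup_perm_inv[OF _ _ tcycle_inv(2,1)] .

lemma shift_mem:
  assumes H: "subgroup H perms" and "shift 1 \<in> H"
  shows "shift z \<in> H"
proof -
  have nat: "shift (int j) \<in> H" for j
  proof (induction j)
    case (Suc j)
    have e: "shift (int (Suc j)) = shift 1 \<circ> shift (int j)" by (simp add: shift_add[symmetric])
    show ?case unfolding e by (rule subgroup_perm_comp[OF H assms(2) Suc])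
  next
    case 0
    show ?case unfolding of_nat_0 shift_0 by (rule subgroup_perm_id[OF H])
  qed
  show ?thesis
  proof (cases "z \<ge> 0")
    case True
    then show ?thesis using nat[of "nat z"] by simp
  next
    case False
    then have "shift (- z) \<in> H" using nat[of "nat (- z)"] by simp
    then show ?thesis using subgroup_perm_inv[OF H _ shift_inv(2,1)] by blast
  qed
qed

lemma stride_mono_step: "n < m \<Longrightarrow> 8 * stride n \<le> stride m"
  using power_increasing[of "Suc n" m "8 :: int"] by simp

lemma stride_pos: "n > 0 \<Longrightarrow> stride n \<ge> 8"
  using stride_mono_step[of 0 n] by simp

text \<open>
  By induction the parts of the cycle in earlier blocks can be split off, leaving the cycle \<open>x\<close> in the
  blocks from \<open>n\<close> on. A displacement by \<open>rows n + 2\<close> amounts to a displacement by 2 in block \<open>n\<close>, while in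
  later blocks it moves the three rows off themselves without going around. So the commutator of \<open>x\<close>
  with this shift of \<open>x\<close> lives in block \<open>n\<close> only, and \<open>cyc_relation\<close> turns it into the inverse of the
  cycle in that block.
\<close>
lemma tcycle_singleton_mem:
  assumes H: "subgroup H perms" and sh: "shift 1 \<in> H" and t: "tcycle v s UNIV \<in> H"
    and s: "\<And>n. stride n \<le> s n \<and> s n \<le> 3 * stride n"
  shows "tcycle v s {n} \<in> H"
proof (induction n rule: less_induct)
  case (less n)
  have "tcycle v s {..<n} \<in> H" by (rule tcycle_finite_mem[OF H]) (use less in auto)
  then have "tcycle' v s {..<n} \<circ> tcycle v s UNIV \<in> H" using tcycle'_mem[OF H] t subgroup_perm_comp[OF H]
    by blast
  moreover have "tcycle v s {n..} = tcycle' v s {..<n} \<circ> tcycle v s UNIV"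
    using tcycle_Diff[of "{..<n}" UNIV v s] by (simp add: Compl_eq_Diff_UNIV[symmetric])
  ultimately have x: "tcycle v s {n..} \<in> H" by simp
  \<comment> \<open>The starting rows after a shift by \<open>rows n + 2\<close>, which in block \<open>n\<close> goes around once.\<close>
  define s' where "s' m = (if m = n then s n + 2 else s m + (rows n + 2))" for m
  have "shift (rows n + 2) \<circ> tcycle v s {n..} \<circ> shift (- (rows n + 2)) = tcycle v s' {n..}"
  proof (rule shift_tcycle_conj)
    fix m assume m: "m \<in> {n..}" "m > 0"
    show "0 \<le> s m \<and> s m + 2 < rows m \<and> 0 \<le> s' m \<and> s' m + 2 < rows m
        \<and> (\<exists>j. s m + (rows n + 2) = s' m + j * rows m)"
    proof (cases "m = n")
      case True
      then show ?thesis using s[of n] stride_pos[OF m(2)] by (auto simp: s'_def intro!: exI[of _ 1])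
    next
      case False
      then have "8 * stride n \<le> stride m" using m by (intro stride_mono_step) auto
      then show ?thesis using False s[of m] stride_pos[OF m(2)] by (auto simp: s'_def intro!: exI[of _ 0])
    qed
  qed
  moreover have "shift z \<circ> tcycle v s {n..} \<circ> shift (- z) \<in> H" for z
    using x shift_mem[OF H sh] subgroup_perm_comp[OF H] by blast
  ultimately have y: "tcycle v s' {n..} \<in> H" by metis
  have "shift 1 \<circ> tcycle v s {n..} \<circ> shift (- 1) = tcycle v (\<lambda>m. s m + 1) {n..}"
  proof (rule shift_tcycle_conj)
    fix m assume m: "m \<in> {n..}" "m > 0"
    show "0 \<le> s m \<and> s m + 2 < rows m \<and> 0 \<le> s m + 1 \<and> s m + 1 + 2 < rows m
        \<and> (\<exists>j. s m + 1 = s m + 1 + j * rows m)"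
      using s[of m] stride_pos[OF m(2)] by (auto intro!: exI[of _ 0])
  qed
  then have x1: "tcycle v (\<lambda>m. s m + 1) {n..} \<in> H"
    using x shift_mem[OF H sh] subgroup_perm_comp[OF H] by metis
  let ?x = "tcycle v s {n..}" and ?x' = "tcycle' v s {n..}" and ?y = "tcycle v s' {n..}"
      and ?y' = "tcycle' v s' {n..}"
  have "tcycle' v (\<lambda>m. s m + 1) {n..} \<circ> ?x \<circ> ?y \<circ> ?x' \<circ> ?y' \<circ> tcycle v (\<lambda>m. s m + 1) {n..} \<in> H"
    by (intro subgroup_perm_comp[OF H] tcycle'_mem[OF H] x y x1)
  also have "tcycle' v (\<lambda>m. s m + 1) {n..} \<circ> ?x \<circ> ?y \<circ> ?x' \<circ> ?y' \<circ> tcycle v (\<lambda>m. s m + 1) {n..}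
      = tcycle' v s {n}"
    unfolding tcycle_def tcycle'_def lift_comp
  proof (rule lift_eqI)
    fix m :: nat and i assume "m > 0"
    have "\<bar>s m - s' m\<bar> > 2" if "m > n"
    proof -
      have "(0::int) < 8 ^ n" by simp
      moreover have "s m - s' m = - (rows n + 2)" using that by (simp add: s'_def)
      ultimately show ?thesis by arith
    qed
    then have "cyc (s m) (cyc (s' m) i') = cyc (s' m) (cyc (s m) i')" if "m > n" for i'
      using that by (intro cyc_commute) auto
    moreover have "s' n = s n + 2" by (simp add: s'_def)
    ultimately show "((if m \<in> {n..} then cyc' (s m + 1) else id) \<circ> (if m \<in> {n..} then cyc (s m) else id)
        \<circ> (if m \<in> {n..} then cyc (s' m) else id) \<circ>
        (if m \<in> {n..} then cyc' (s m) else id) \<circ> (if m \<in> {n..} then cyc' (s' m) else id) \<circ> (if m \<in> {n..}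
            then cyc (s m + 1) else id)) i
        = (if m \<in> {n} then cyc' (s m) else id) i"
      using cyc_relation[of "s n" i] by (cases m n rule: linorder_cases) simp_all
  qed
  finally show ?case by (rule tcycle_mem[OF H])
qed

text \<open>
  With \<open>t\<close> the shift by \<open>5 * e\<close>, an element of \<open>N\<close>, the quotient of \<open>x\<close> and its conjugate under \<open>t\<close> is in
  \<open>N\<close>. Owing to the factor 5 the conjugate starts at least three rows after \<open>x2\<close>, hence commutes with it,
  so the commutator of the quotient with \<open>x2\<close> equals the commutator of \<open>x\<close> with \<open>x2\<close>,
      and \<open>cyc_relation\<close> puts the inverse of \<open>x\<close>
  into \<open>N\<close>. The blocks in \<open>I\<close>, which are too short for these shifts, have to be left out beforehand;
  this is possible because the cycle in a single block belongs to the group.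
\<close>
lemma tcycle_cofinite_mem_normal:
  assumes H: "subgroup H perms" and sh: "shift 1 \<in> H" and t: "tcycle v s J \<in> H"
    and tn: "\<And>n. n \<in> J \<Longrightarrow> tcycle v s {n} \<in> H"
    and s: "\<And>n. stride n \<le> s n \<and> s n \<le> 3 * stride n"
    and N: "N \<lhd> perms\<lparr>carrier := H\<rparr>" and e: "shift e \<in> N" "e > 0"
    and I: "finite I" "\<And>n. n > 0 \<Longrightarrow> n \<notin> I \<Longrightarrow> 5 * e + 5 < 2 * stride n"
  shows "tcycle v s (J - I) \<in> N"
proof -
  have "tcycle v s (J \<inter> I) \<in> H" by (rule tcycle_finite_mem[OF H]) (use I tn in auto)
  moreover have "J - (J \<inter> I) = J - I" by auto
  then have "tcycle v s (J - I) = tcycle' v s (J \<inter> I) \<circ> tcycle v s J" using tcycle_Diff[of "J \<inter> I" J v s]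
    by simp
  ultimately have x: "tcycle v s (J - I) \<in> H" using t subgroup_perm_comp[OF H] tcycle'_mem[OF H] by simp
  define K where "K = J - I"
  note x = x[folded K_def]
  have conj: "shift z \<circ> tcycle v s K \<circ> shift (- z) = tcycle v (\<lambda>m. s m + z) K" if z: "0 \<le> z" "z \<le> 5 * e"
      for z
  proof (rule shift_tcycle_conj)
    fix m assume m: "m \<in> K" "m > 0"
    then have "5 * e + 5 < 2 * stride m" using I(2)[of m] by (simp add: K_def)
    then show "0 \<le> s m \<and> s m + 2 < rows m \<and> 0 \<le> s m + z \<and> s m + z + 2 < rows m
        \<and> (\<exists>j. s m + z = s m + z + j * rows m)"
      using s[of m] stride_pos[OF m(2)] z by (auto intro!: exI[of _ 0])
  qed
  have xz: "tcycle v (\<lambda>m. s m + z) K \<in> H" if "0 \<le> z" "z \<le> 5 * e" for z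
    using conj[OF that] x shift_mem[OF H sh] subgroup_perm_comp[OF H] by metis
  let ?E = "5 * e"
  let ?x = "tcycle v s K" and ?x' = "tcycle' v s K"
  let ?y = "tcycle v (\<lambda>m. s m + ?E) K" and ?y' = "tcycle' v (\<lambda>m. s m + ?E) K"
  let ?x1 = "tcycle v (\<lambda>m. s m + 1) K" and ?x1' = "tcycle' v (\<lambda>m. s m + 1) K"
  let ?x2 = "tcycle v (\<lambda>m. s m + 2) K" and ?x2' = "tcycle' v (\<lambda>m. s m + 2) K"
  have "shift ?E = shift e \<circ> shift e \<circ> shift e \<circ> shift e \<circ> shift e" by (simp add: shift_add[symmetric])
  then have E: "shift ?E \<in> N" using e(1) normal_restrict_perm_comp[OF H N] by simp
  have "shift (- ?E) \<in> N" using normal_restrict_perm_inv[OF H N E shift_inv] .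
  then have "(?x \<circ> shift ?E \<circ> ?x') \<circ> shift (- ?E) \<in> N"
    using normal_restrict_perm_conj[OF H N E x tcycle_inv] normal_restrict_perm_comp[OF H N] by blast
  moreover have "shift ?E \<circ> ?x' \<circ> shift (- ?E) = ?y'"
  proof -
    have c: "?y = shift ?E \<circ> ?x \<circ> shift (- ?E)" using conj[of ?E] e(2) by simp
    have "(shift ?E \<circ> ?x' \<circ> shift (- ?E)) \<circ> ?y = shift ?E \<circ> ?x' \<circ> (shift (- ?E) \<circ> shift ?E) \<circ> ?x
        \<circ> shift (- ?E)"
      unfolding c o_assoc by (rule refl)
    also have "\<dots> = shift ?E \<circ> (?x' \<circ> ?x) \<circ> shift (- ?E)" by (simp only: shift_inv comp_id o_assoc)
    also have "\<dots> = id" by (simp only: tcycle_inv comp_id shift_inv)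
    finally have "(shift ?E \<circ> ?x' \<circ> shift (- ?E)) \<circ> ?y \<circ> ?y' = ?y'" by simp
    then show ?thesis by (simp only: o_assoc[symmetric] tcycle_inv comp_id)
  qed
  moreover have "(?x \<circ> shift ?E \<circ> ?x') \<circ> shift (- ?E) = ?x \<circ> (shift ?E \<circ> ?x' \<circ> shift (- ?E))"
    by (simp only: o_assoc)
  ultimately have u: "?x \<circ> ?y' \<in> N" by (simp only:)
  have "(?x \<circ> ?y') \<circ> (?y \<circ> ?x') = ?x \<circ> (?y' \<circ> ?y) \<circ> ?x'"
       "(?y \<circ> ?x') \<circ> (?x \<circ> ?y') = ?y \<circ> (?x' \<circ> ?x) \<circ> ?y'"
    by (simp_all only: o_assoc)
  then have "?y \<circ> ?x' \<in> N"
    by (intro normal_restrict_perm_inv[OF H N u]) (simp_all only: tcycle_inv comp_id)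
  then have "?x2 \<circ> (?y \<circ> ?x') \<circ> ?x2' \<in> N"
    by (rule normal_restrict_perm_conj[OF H N _ _ tcycle_inv]) (use xz[of 2] e(2) in auto)
  then have "(?x \<circ> ?y') \<circ> (?x2 \<circ> (?y \<circ> ?x') \<circ> ?x2') \<in> N"
    by (rule normal_restrict_perm_comp[OF H N u])
  then have "?x1' \<circ> ((?x \<circ> ?y') \<circ> (?x2 \<circ> (?y \<circ> ?x') \<circ> ?x2')) \<circ> ?x1 \<in> N"
    by (rule normal_restrict_perm_conj[OF H N _ _ tcycle_inv(2,1)]) (use xz[of 1] e(2) tcycle'_mem[OF H] in
        auto)
  also have "?x1' \<circ> ((?x \<circ> ?y') \<circ> (?x2 \<circ> (?y \<circ> ?x') \<circ> ?x2')) \<circ> ?x1 = ?x'"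
    unfolding tcycle_def tcycle'_def lift_comp
  proof (rule lift_eqI)
    fix m :: nat and i assume "m > 0"
    have c: "cyc' (s m + ?E) (cyc (s m + 2) i') = cyc (s m + 2) (cyc' (s m + ?E) i')" for i'
      by (rule cyc_cyc'_commute) (use e(2) in auto)
    show "((if m \<in> K then cyc' (s m + 1) else id) \<circ> (((if m \<in> K then cyc (s m) else id) \<circ> (if m
        \<in> K then cyc' (s m + ?E) else id)) \<circ>
        ((if m \<in> K then cyc (s m + 2) else id) \<circ> ((if m \<in> K then cyc (s m + ?E) else id) \<circ> (if m \<in> K then
            cyc' (s m) else id)) \<circ> (if m \<in> K then cyc' (s m + 2) else id))) \<circ>
        (if m \<in> K then cyc (s m + 1) else id)) i = (if m \<in> K then cyc' (s m) else id) i"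
      using cyc_relation[of "s m" i] by (simp add: c)
  qed
  finally show ?thesis unfolding K_def[symmetric] using normal_restrict_perm_inv[OF H N _ tcycle_inv(2,1)]
    by blast
qed

text \<open>
  Among infinitely many powers of the shift two lie in the same coset.
\<close>
lemma shift_power_mem_finite_index:
  assumes H: "subgroup H perms" and sh: "shift 1 \<in> H"
    and N: "N \<in> finite_index_normals (perms\<lparr>carrier := H\<rparr>)"
  shows "\<exists>e>0. shift e \<in> N"
proof -
  let ?G = "perms\<lparr>carrier := H\<rparr>"
  interpret group ?G by (rule group_restrict_perm[OF H])
  have Nn: "subgroup N ?G" and fin: "finite (rcosets\<^bsub>?G\<^esub> N)"
    using N by (auto simp: finite_index_normals_def normal_imp_subgroup)
  let ?f = "\<lambda>j::nat. N #>\<^bsub>?G\<^esub> shift (int j)"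
  have "range ?f \<subseteq> rcosets\<^bsub>?G\<^esub> N" using shift_mem[OF H sh] by (auto simp: RCOSETS_def)
  then have "finite (range ?f)" using fin finite_subset by blast
  then have "\<not> inj ?f" using finite_imageD by blast
  then obtain i j where ij: "i < j" "?f j = ?f i" unfolding inj_on_def by (metis linorder_neq_iff)
  then have "shift (int j) \<otimes>\<^bsub>?G\<^esub> inv\<^bsub>?G\<^esub> (shift (int i)) \<in> N"
    using rcos_eq_iff[OF Nn, of "shift (int j)" "shift (int i)"] shift_mem[OF H sh] by simp
  moreover have "inv\<^bsub>?G\<^esub> (shift (int i)) = shift (- int i)"
    using inv_restrict_perm[OF H shift_mem[OF H sh]] inv_perm[OF shift_inv] by simp
  ultimately have "shift (int j - int i) \<in> N" using shift_add[of "int j" "- int i"] by simp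
  then show ?thesis using ij(1) by (intro exI[of _ "int j - int i"]) simp
qed

section \<open>Congruence kernels and residual finiteness\<close>

declare split_paired_All [simp del] split_paired_Ex [simp del]

text \<open>
  These conditions hold for the generators and are stable under products and inverses. They are what
  makes the groups residually finite: a tame permutation is known from its effect on the finite blocks
  and from the amount by which it translates the line.
\<close>
definition tame :: "(point \<Rightarrow> point) set" where
  "tame = {f. bij f \<and> (\<exists>z. \<forall>i y. f (0, i, y) = (0, i + z, y)) \<and>
     (\<forall>n>0. \<forall>p\<in>block n. f p \<in> block n) \<and> (\<forall>p. fst p > 0 \<longrightarrow> p \<notin> block (fst p) \<longrightarrow> f p = p)}"

definition translation :: "(point \<Rightarrow> point) \<Rightarrow> int" where
  "translation f = fst (snd (f (0, 0, 0, 0)))"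

lemma tame_0: "f \<in> tame \<Longrightarrow> f (0, i, y) = (0, i + translation f, y)"
  by (auto simp: tame_def translation_def)

lemma tame_block: "f \<in> tame \<Longrightarrow> n > 0 \<Longrightarrow> p \<in> block n \<Longrightarrow> f p \<in> block n"
  by (auto simp: tame_def)

lemma tame_outside: "f \<in> tame \<Longrightarrow> fst p > 0 \<Longrightarrow> p \<notin> block (fst p) \<Longrightarrow> f p = p"
  by (auto simp: tame_def)

lemma translation_comp: "f \<in> tame \<Longrightarrow> g \<in> tame \<Longrightarrow> translation (f \<circ> g) = translation f + translation g"
  using tame_0[of g 0 "(0, 0)"] tame_0[of f "translation g" "(0, 0)"] by (simp add: translation_def)

lemma subgroup_tame: "subgroup tame perms"
proof (rule group.subgroupI[OF group_perm])
  show "tame \<subseteq> carrier perms" by (auto simp: tame_def)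
  have "id \<in> tame" by (auto simp: tame_def intro!: exI[of _ 0])
  then show "tame \<noteq> {}" by blast
  fix f assume f: "f \<in> tame"
  then have bij: "bij f" by (simp add: tame_def)
  define g where "g = inv\<^bsub>perms\<^esub> f"
  have fg: "f \<circ> g = id" "g \<circ> f = id" using inv_perm_comp[OF bij] by (simp_all add: g_def)
  then have gf: "g (f p) = p" "f (g p) = p" for p by (simp_all add: pointfree_idE)
  have "g (0, i, y) = (0, i + (- translation f), y)" for i y
    using gf(1)[of "(0, i - translation f, y)"] tame_0[OF f, of "i - translation f" y] by simp
  moreover have "g p \<in> block n" if "n > 0" "p \<in> block n" for n p
  proof -
    have "f ` block n \<subseteq> block n" using tame_block[OF f that(1)] by auto
    moreover have "inj_on f (block n)" using bij by (auto simp: bij_def intro: inj_on_subset)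
    ultimately have "f ` block n = block n" by (rule endo_inj_surj[OF finite_block])
    then have "p \<in> f ` block n" using that(2) by simp
    then show ?thesis using gf(1) by auto
  qed
  moreover have "g p = p" if "fst p > 0" "p \<notin> block (fst p)" for p
    using tame_outside[OF f that] gf(1)[of p] by simp
  ultimately show "inv\<^bsub>perms\<^esub> f \<in> tame"
    unfolding tame_def g_def[symmetric] using o_bij[OF fg] by blast
next
  fix f g assume fg: "f \<in> tame" "g \<in> tame"
  have "(f \<circ> g) (0, i, y) = (0, i + (translation g + translation f), y)" for i y
    using fg by (simp add: tame_0)
  moreover have "bij (f \<circ> g)" using fg by (auto simp: tame_def intro: bij_comp)
  ultimately have "f \<circ> g \<in> tame"
    unfolding tame_def using tame_block[OF fg(1)] tame_block[OF fg(2)] tame_outside[OF fg(1)]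
        tame_outside[OF fg(2)]
    by (simp add: comp_def)
  then show "f \<otimes>\<^bsub>perms\<^esub> g \<in> tame" by simp
qed

lemma shift_tame: "shift z \<in> tame"
  unfolding tame_def using bij_shift by (auto simp: shift_apply mem_block)

lemma tcycle_tame:
  assumes "\<And>n. stride n \<le> s n \<and> s n \<le> 3 * stride n"
  shows "tcycle v s J \<in> tame"
proof -
  have c: "0 \<le> cyc (s n) i \<and> cyc (s n) i < rows n" if "n > 0" "0 \<le> i" "i < rows n" for n i
    using that assms[of n] stride_pos[of n] by (auto simp: cyc_def)
  have o: "cyc (s n) i = i" if "n > 0" "\<not> (0 \<le> i \<and> i < rows n)" for n i
    using that assms[of n] stride_pos[of n] by (auto simp: cyc_def)
  show ?thesis
    unfolding tame_def
  proof (intro CollectI conjI allI impI ballI)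
    show "bij (tcycle v s J)" by (rule bij_tcycle)
    show "\<exists>z. \<forall>i y. tcycle v s J (0, i, y) = (0, i + z, y)"
      by (rule exI[of _ 0]) (simp add: tcycle_def lift_apply)
    fix n p assume "0 < n" "p \<in> block n"
    then show "tcycle v s J p \<in> block n"
      using c by (cases p) (auto simp: tcycle_def lift_apply mem_block twist_sheet)
  next
    fix p :: point assume p: "fst p > 0" "p \<notin> block (fst p)"
    then show "tcycle v s J p = p"
      using o[of "fst p" "fst (snd p)"] by (cases p) (auto simp: tcycle_def lift_apply mem_block twist_0)
  qed
qed

text \<open>
  The kernel of the action on the blocks \<open>n \<in> I\<close> together with the translation of the line modulo \<open>e\<close>.
\<close>
definition congruence_kernel :: "(point \<Rightarrow> point) set \<Rightarrow> nat set \<Rightarrow> int \<Rightarrow> (point \<Rightarrow> point) set" where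
  "congruence_kernel H I e = {g \<in> H. (\<forall>n\<in>I. \<forall>p\<in>block n. g p = p) \<and> e dvd translation g}"

context
  fixes H :: "(point \<Rightarrow> point) set"
  assumes H: "subgroup H perms" and tame: "H \<subseteq> tame"
begin

lemma inv_mem: "g \<in> H \<Longrightarrow> inv\<^bsub>perms\<^esub> g \<in> H"
  by (rule subgroup.m_inv_closed[OF H])

lemma inv_cancel: "g \<in> H \<Longrightarrow> g ((inv\<^bsub>perms\<^esub> g) p) = p" "g \<in> H \<Longrightarrow> (inv\<^bsub>perms\<^esub> g) (g p) = p"
  using inv_perm_comp[OF subgroup_perm_bij[OF H, of g]] by (auto simp: pointfree_idE)

lemma translation_inv: "g \<in> H \<Longrightarrow> translation (inv\<^bsub>perms\<^esub> g) = - translation g"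
  using translation_comp[of g "inv\<^bsub>perms\<^esub> g"] inv_mem[of g] tame inv_perm_comp[OF subgroup_perm_bij[OF H, of
      g]]
  by (auto simp: translation_def subset_iff)

lemma congruence_kernel_finite_index:
  assumes I: "finite I" and e: "e > 0"
  shows "congruence_kernel H I e \<in> finite_index_normals (perms\<lparr>carrier := H\<rparr>)"
proof -
  let ?G = "perms\<lparr>carrier := H\<rparr>"
  define B where "B = (\<Union>n\<in>I - {0}. block n)"
  have finB: "finite B" using I finite_block by (auto simp: B_def)
  have G: "group ?G" by (rule group_restrict_perm[OF H])
  have K: "congruence_kernel H I e \<subseteq> H" by (auto simp: congruence_kernel_def)
  have ker: "g \<in> congruence_kernel H I e \<longleftrightarrow> (\<forall>p\<in>B. g p = p) \<and> e dvd translation g" if "g \<in> H" for g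
  proof -
    have "block 0 = {}" by (simp add: block_def)
    then have "(\<forall>n\<in>I. \<forall>p\<in>block n. g p = p) \<longleftrightarrow> (\<forall>p\<in>B. g p = p)" unfolding B_def by auto
    then show ?thesis using that by (simp add: congruence_kernel_def)
  qed
  have inB: "g p \<in> B" if "g \<in> H" "p \<in> B" for g p
    using that tame tame_block[of g _ p] unfolding B_def by auto
  show ?thesis
  proof (rule finite_index_normalsI[where q = "\<lambda>g. (\<lambda>p\<in>B. g p, translation g mod e)"])
  show "group ?G" by (rule G)
  show "congruence_kernel H I e \<lhd> ?G"
    unfolding group.normal_inv_iff[OF G]
  proof (intro conjI ballI)
    show "subgroup (congruence_kernel H I e) ?G"
    proof (rule group.subgroupI[OF G])
      have "id \<in> congruence_kernel H I e" using ker[OF subgroup_perm_id[OF H]]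
        by (simp add: translation_def)
      then show "congruence_kernel H I e \<noteq> {}" by blast
      fix f assume f: "f \<in> congruence_kernel H I e"
      then have fH: "f \<in> H" using K by auto
      have "(inv\<^bsub>perms\<^esub> f) p = p" if "p \<in> B" for p
      proof -
        have "f p = p" using f ker[OF fH] that by blast
        then show ?thesis using inv_cancel(2)[OF fH, of p] by simp
      qed
      then show "inv\<^bsub>?G\<^esub> f \<in> congruence_kernel H I e"
        unfolding inv_restrict_perm[OF H fH] ker[OF inv_mem[OF fH]]
          using f ker[OF fH] translation_inv[OF fH] by auto
      fix g assume g: "g \<in> congruence_kernel H I e"
      then have gH: "g \<in> H" using K by auto
      show "f \<otimes>\<^bsub>?G\<^esub> g \<in> congruence_kernel H I e"
        using f g ker[OF fH] ker[OF gH] ker[OF subgroup_perm_comp[OF H fH gH]] translation_comp[of f g] fH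
            gH tame
        by (auto simp: subset_iff)
    qed (use K in auto)
    fix g f assume "g \<in> carrier ?G" and f: "f \<in> congruence_kernel H I e"
    then have gH: "g \<in> H" and fH: "f \<in> H" using K by auto
    have "(g \<circ> f \<circ> inv\<^bsub>perms\<^esub> g) p = p" if "p \<in> B" for p
    proof -
      have "f ((inv\<^bsub>perms\<^esub> g) p) = (inv\<^bsub>perms\<^esub> g) p" using inB[OF inv_mem[OF gH] that] f ker[OF fH] by blast
      then show ?thesis using inv_cancel(1)[OF gH, of p] by simp
    qed
    moreover have "translation (g \<circ> f \<circ> inv\<^bsub>perms\<^esub> g) = translation f"
      using translation_comp[of "g \<circ> f" "inv\<^bsub>perms\<^esub> g"] translation_comp[of g f] translation_inv[OF gH]
        inv_mem[OF gH] subgroup_perm_comp[OF H gH fH] tame gH fH by (auto simp: subset_iff)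
    moreover have "g \<circ> f \<circ> inv\<^bsub>perms\<^esub> g \<in> H"
      by (intro subgroup_perm_comp[OF H] gH fH inv_mem)
    ultimately show "g \<otimes>\<^bsub>?G\<^esub> f \<otimes>\<^bsub>?G\<^esub> inv\<^bsub>?G\<^esub> g \<in> congruence_kernel H I e"
      using f ker[OF fH] ker[of "g \<circ> f \<circ> inv\<^bsub>perms\<^esub> g"] inv_restrict_perm[OF H gH] by simp
  qed
  have "(\<lambda>g. (\<lambda>p\<in>B. g p, translation g mod e)) ` carrier ?G \<subseteq> (B \<rightarrow>\<^sub>E B) \<times> {0..<e}"
    using inB e by auto
  then show "finite ((\<lambda>g. (\<lambda>p\<in>B. g p, translation g mod e)) ` carrier ?G)"
    by (rule finite_subset) (use finB in \<open>auto intro!: finite_PiE\<close>)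
  fix g h assume gh: "g \<in> carrier ?G" "h \<in> carrier ?G"
    and q: "(\<lambda>p\<in>B. g p, translation g mod e) = (\<lambda>p\<in>B. h p, translation h mod e)"
  then have gH: "g \<in> H" and hH: "h \<in> H" by auto
  have eq: "g p = h p" if "p \<in> B" for p using q that
    by (metis (no_types, lifting) prod.inject restrict_apply')
  have "(g \<circ> inv\<^bsub>perms\<^esub> h) p = p" if "p \<in> B" for p
    using eq[OF inB[OF inv_mem[OF hH] that]] inv_cancel(1)[OF hH, of p] by simp
  moreover have "translation (g \<circ> inv\<^bsub>perms\<^esub> h) = translation g - translation h"
    using translation_comp[of g "inv\<^bsub>perms\<^esub> h"] translation_inv[OF hH] inv_mem[OF hH] tame gH
      by (auto simp: subset_iff)
  moreover have "e dvd translation g - translation h" using q by (auto simp: mod_eq_dvd_iff)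
  ultimately show "g \<otimes>\<^bsub>?G\<^esub> inv\<^bsub>?G\<^esub> h \<in> congruence_kernel H I e"
    using ker[OF subgroup_perm_comp[OF H gH inv_mem[OF hH]]] inv_restrict_perm[OF H hH] by simp
  qed
qed

text \<open>
  A nontrivial tame permutation moves a point of some block or translates the line. The first is seen
  by the action on that block, the second modulo any larger number.
\<close>
lemma residually_finite_tame: "residually_finite (perms\<lparr>carrier := H\<rparr>)"
  unfolding residually_finite_def
proof (intro ballI impI)
  fix g assume g: "g \<in> carrier (perms\<lparr>carrier := H\<rparr>)" "g \<noteq> \<one>\<^bsub>perms\<lparr>carrier := H\<rparr>\<^esub>"
  then have gt: "g \<in> tame" using tame by auto
  obtain p where p: "g p \<noteq> p" using g(2) by (auto simp: fun_eq_iff)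
  show "\<exists>N\<in>finite_index_normals (perms\<lparr>carrier := H\<rparr>). g \<notin> N"
  proof (cases "fst p = 0")
    case True
    then have "translation g \<noteq> 0" using p tame_0[OF gt, of "fst (snd p)" "snd (snd p)"] by (cases p) auto
    then have "\<not> (\<bar>translation g\<bar> + 1) dvd translation g"
      using zdvd_not_zless[of "\<bar>translation g\<bar>" "\<bar>translation g\<bar> + 1"] by auto
    then have "g \<notin> congruence_kernel H {} (\<bar>translation g\<bar> + 1)" by (auto simp: congruence_kernel_def)
    then show ?thesis using congruence_kernel_finite_index[of "{}" "\<bar>translation g\<bar> + 1"] by auto
  next
    case False
    then have "p \<in> block (fst p)" using tame_outside[OF gt, of p] p by auto
    then have "g \<notin> congruence_kernel H {fst p} 1" using p by (auto simp: congruence_kernel_def)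
    then show ?thesis using congruence_kernel_finite_index[of "{fst p}" 1] by auto
  qed
qed

end

definition supported_on :: "nat set \<Rightarrow> (point \<Rightarrow> point) set" where
  "supported_on I = {f. bij f \<and> (\<forall>p. fst (f p) = fst p) \<and> (\<forall>p. fst p \<notin> I \<longrightarrow> f p = p)}"

lemma supported_on_comp: "f \<in> supported_on I \<Longrightarrow> g \<in> supported_on I \<Longrightarrow> f \<circ> g \<in> supported_on I"
  by (auto simp: supported_on_def intro: bij_comp)

lemma supported_on_inv:
  assumes "f \<in> supported_on I" "f \<circ> g = id" "g \<circ> f = id"
  shows "g \<in> supported_on I"
proof -
  have gf: "g (f p) = p" "f (g p) = p" for p using assms by (simp_all add: pointfree_idE)
  then have "fst (g p) = fst p" for p using assms(1)
    by (metis (mono_tags, lifting) mem_Collect_eq supported_on_def)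
  moreover have "g p = p" if "fst p \<notin> I" for p using gf(1)[of p] assms(1) that
    by (simp add: supported_on_def)
  ultimately show ?thesis using o_bij[OF assms(2,3)] o_bij[OF assms(3,2)] by (simp add: supported_on_def)
qed

lemma supported_on_commute:
  assumes "f \<in> supported_on I" "g \<in> supported_on K" "I \<inter> K = {}"
  shows "f \<circ> g = g \<circ> f"
proof
  fix p :: point
  have "fst p \<notin> I \<or> fst p \<notin> K" using assms(3) by auto
  then show "(f \<circ> g) p = (g \<circ> f) p" using assms(1,2) by (auto simp: supported_on_def)
qed

lemma supported_on_shift_conj:
  assumes "f \<in> supported_on I"
  shows "shift z \<circ> f \<circ> shift (- z) \<in> supported_on I"
proof -
  have "fst (shift w p) = fst p" for w p by (cases p) (simp add: shift_apply)
  moreover have "shift z (shift (- z) p) = p" for p using shift_inv(1)[of z] by (simp add: pointfree_idE)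
  ultimately show ?thesis using assms bij_shift by (auto simp: supported_on_def intro!: bij_comp)
qed

lemma tcycle_supported_on: "0 \<notin> I \<Longrightarrow> J - {0} \<subseteq> I \<Longrightarrow> tcycle v s J \<in> supported_on I"
  using bij_tcycle by (auto simp: supported_on_def tcycle_def lift_def twist_0 split: prod.splits)

section \<open>The amenable group and the groups containing it\<close>

definition window_start :: "nat \<Rightarrow> nat \<Rightarrow> int" where
  "window_start v n = (int v + 1) * stride n"

definition gensA :: "(point \<Rightarrow> point) set" where
  "gensA = insert (shift 1) ((\<lambda>v. tcycle v (window_start v) UNIV) ` {0, 1, 2})"

text \<open>
  The new cycles use window 0, which in \<open>A\<close> carries untwisted cycles only. The set \<open>Suc ` X\<close> avoids the
  coordinate 0, where cycles act trivially, so that \<open>X\<close> can be recovered.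
\<close>
definition gensG :: "nat set \<Rightarrow> (point \<Rightarrow> point) set" where
  "gensG X = {tcycle 1 (window_start 0) UNIV, tcycle 2 (window_start 0) (Suc ` X)} \<union> gensA"

definition grpA :: "(point \<Rightarrow> point) set" where
  "grpA = generate perms gensA"

definition grpG :: "nat set \<Rightarrow> (point \<Rightarrow> point) set" where
  "grpG X = generate perms (gensG X)"

lemma window_start_bounds: "v \<le> 2 \<Longrightarrow> stride n \<le> window_start v n \<and> window_start v n \<le> 3 * stride n"
proof -
  assume "v \<le> 2"
  then have "1 * stride n \<le> (int v + 1) * stride n" "(int v + 1) * stride n \<le> 3 * stride n"
    by (intro mult_right_mono; simp)+
  then show ?thesis by (simp add: window_start_def)
qed

lemma gens_tame: "gensG X \<subseteq> tame"
  using shift_tame tcycle_tame[OF window_start_bounds] by (auto simp: gensG_def gensA_def)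

lemma gens_perm: "gensG X \<subseteq> carrier perms" "gensA \<subseteq> carrier perms"
  using gens_tame[of X] gens_tame[of "{}"] by (auto simp: tame_def gensG_def)

lemma subgroup_grpG: "subgroup (grpG X) perms"
  unfolding grpG_def by (rule group.generate_is_subgroup[OF group_perm gens_perm(1)])

lemma subgroup_grpA: "subgroup grpA perms"
  unfolding grpA_def by (rule group.generate_is_subgroup[OF group_perm gens_perm(2)])

lemma grpG_tame: "grpG X \<subseteq> tame"
  unfolding grpG_def by (rule group.generate_subgroup_incl[OF group_perm gens_tame subgroup_tame])

lemma grpA_le_grpG: "grpA \<subseteq> grpG X"
  unfolding grpA_def grpG_def by (rule group.mono_generate[OF group_perm]) (auto simp: gensG_def)

lemma grpA_tame: "grpA \<subseteq> tame"
  using grpA_le_grpG grpG_tame by blast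

lemma shift_grpA: "shift z \<in> grpA"
proof (rule shift_mem[OF subgroup_grpA])
  show "shift 1 \<in> grpA" unfolding grpA_def by (rule generate.incl) (simp add: gensA_def)
qed

lemma tcycle_grpA: "v \<le> 2 \<Longrightarrow> tcycle v (window_start v) UNIV \<in> grpA"
proof -
  assume "v \<le> 2"
  then have "v \<in> {0, 1, 2}" by auto
  then show ?thesis unfolding grpA_def by (intro generate.incl) (auto simp: gensA_def)
qed

lemma tcycle_singleton_grpA: "v \<le> 2 \<Longrightarrow> tcycle v (window_start v) {n} \<in> grpA"
  by (rule tcycle_singleton_mem[OF subgroup_grpA shift_grpA tcycle_grpA window_start_bounds])

text \<open>
  In a single block a shift takes the window of kind \<open>v\<close> to window 0, so there the new generators of
  \<open>G X\<close> are already in \<open>A\<close>. No shift does this in all blocks at once.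
\<close>
lemma tcycle_window_0_singleton_grpA:
  assumes "v \<le> 2" shows "tcycle v (window_start 0) {n} \<in> grpA"
proof -
  let ?z = "- (int v * stride n)"
  have "shift ?z \<circ> tcycle v (window_start v) {n} \<circ> shift (- ?z) = tcycle v (window_start 0) {n}"
  proof (rule shift_tcycle_conj)
    fix m assume m: "m \<in> {n}" "m > 0"
    then have "window_start v m + ?z = window_start 0 m + 0 * rows m"
      by (simp add: window_start_def algebra_simps)
    then show "0 \<le> window_start v m \<and> window_start v m + 2 < rows m \<and> 0 \<le> window_start 0 m
        \<and> window_start 0 m + 2 < rows m \<and> (\<exists>j. window_start v m + ?z = window_start 0 m + j * rows m)"
      using window_start_bounds[of v m] window_start_bounds[of 0 m] stride_pos[OF m(2)] assms by auto
  qed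
  moreover have "shift ?z \<circ> tcycle v (window_start v) {n} \<circ> shift (- ?z) \<in> grpA"
    by (intro subgroup_perm_comp[OF subgroup_grpA] shift_grpA tcycle_singleton_grpA assms)
  ultimately show ?thesis by (simp only:)
qed

lemma tcycle_window_0_finite_grpA:
  "v \<le> 2 \<Longrightarrow> finite I \<Longrightarrow> tcycle v (window_start 0) I \<in> grpA"
  by (rule tcycle_finite_mem[OF subgroup_grpA]) (auto intro: tcycle_window_0_singleton_grpA)

lemma generate_perm_induct [consumes 1, case_names id gen inv comp]:
  assumes "g \<in> generate perms S" "P id"
    and "\<And>s. s \<in> S \<Longrightarrow> P s" "\<And>s. s \<in> S \<Longrightarrow> P (inv\<^bsub>perms\<^esub> s)"
    and "\<And>f g. P f \<Longrightarrow> P g \<Longrightarrow> P (f \<circ> g)"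
  shows "P g"
  using assms(1) by (induction rule: generate.induct) (use assms(2-) in \<open>simp_all only: perm_simps\<close>)

lemma gensG_cases:
  assumes "s \<in> gensG X" "s \<notin> gensA"
  obtains v J where "v \<le> 2" "s = tcycle v (window_start 0) J"
proof -
  have "s = tcycle 1 (window_start 0) UNIV \<or> s = tcycle 2 (window_start 0) (Suc ` X)" using assms
    unfolding gensG_def by blast
  then show ?thesis using that[of 1 UNIV] that[of 2 "Suc ` X"] by linarith
qed

text \<open>
  The blocks in which a shift by \<open>5 * e\<close> may take a cycle across the end of the block.
\<close>
definition small_blocks :: "int \<Rightarrow> nat set" where
  "small_blocks e = {n. 0 < n \<and> 2 * stride n \<le> 5 * e + 5}"

lemma finite_small_blocks: "finite (small_blocks e)"
proof (rule finite_subset)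
  show "small_blocks e \<subseteq> {..nat (5 * e + 5)}"
  proof
    fix n assume "n \<in> small_blocks e"
    then have e: "2 * stride n \<le> 5 * e + 5" by (simp add: small_blocks_def)
    have "n < 8 ^ n" using order.strict_trans2[OF less_exp power_mono[of "2 :: nat" 8 n]] by simp
    then have "int n < stride n" by (metis of_nat_less_iff of_nat_numeral of_nat_power)
    then have "int n \<le> 5 * e + 5" using e by linarith
    then show "n \<in> {..nat (5 * e + 5)}" by (simp add: le_nat_iff)
  qed
qed simp

lemma tcycle_cofinite_mem_normal':
  assumes "subgroup H perms" "grpA \<subseteq> H" "v \<le> 2" "w \<le> 2" "tcycle v (window_start w) J
      \<in> H" "\<And>n. tcycle v (window_start w) {n} \<in> grpA"
    and N: "N \<lhd> perms\<lparr>carrier := H\<rparr>" and e: "shift e \<in> N" "e > 0"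
  shows "tcycle v (window_start w) (J - small_blocks e) \<in> N"
proof (rule tcycle_cofinite_mem_normal[OF assms(1) _ assms(5) _ window_start_bounds[OF assms(4)] N e
    finite_small_blocks])
  show "shift 1 \<in> H" using shift_grpA assms(2) by blast
  show "tcycle v (window_start w) {n} \<in> H" for n using assms(2,6) by blast
  show "5 * e + 5 < 2 * stride n" if "0 < n" "n \<notin> small_blocks e" for n using that
    by (auto simp: small_blocks_def)
qed

lemma inv_perm_tcycle: "inv\<^bsub>perms\<^esub> (tcycle v s J) = tcycle' v s J"
  by (rule inv_perm[OF tcycle_inv])

lemma inv_perm_shift: "inv\<^bsub>perms\<^esub> (shift z) = shift (- z)"
  by (rule inv_perm[OF shift_inv])

text \<open>
  A new generator splits into its part in the finitely many blocks of \<open>small_blocks e\<close>, which is in \<open>A\<close>,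
  and the remaining part, which is in \<open>N\<close>.
\<close>
lemma grpG_eq_normal_grpA:
  assumes N: "N \<in> finite_index_normals (perms\<lparr>carrier := grpG X\<rparr>)" and g: "g \<in> grpG X"
  shows "\<exists>a\<in>grpA. \<exists>n\<in>N. g = n \<circ> a"
proof -
  note H = subgroup_grpG[of X]
  have Nn: "N \<lhd> perms\<lparr>carrier := grpG X\<rparr>" using N by (simp add: finite_index_normals_def)
  have idN: "id \<in> N" using subgroup.one_closed[OF normal_imp_subgroup[OF Nn]] by simp
  have sh: "shift 1 \<in> grpG X" using shift_grpA grpA_le_grpG by blast
  obtain e where e: "e > 0" "shift e \<in> N" using shift_power_mem_finite_index[OF H sh N] by blast
  let ?I = "small_blocks e"
  have new: "\<exists>a\<in>grpA. \<exists>n\<in>N. h = n \<circ> a"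
    if "v \<le> 2" "tcycle v (window_start 0) J \<in> grpG X" "h = tcycle v (window_start 0) J
        \<or> h = inv\<^bsub>perms\<^esub> (tcycle v (window_start 0) J)" for v J h
  proof -
    have n: "tcycle v (window_start 0) (J - ?I) \<in> N"
      by (rule tcycle_cofinite_mem_normal'[OF H grpA_le_grpG that(1) _ that(2)
          tcycle_window_0_singleton_grpA[OF that(1)] Nn e(2,1)]) simp
    have n': "tcycle' v (window_start 0) (J - ?I) \<in> N"
      by (rule normal_restrict_perm_inv[OF H Nn n tcycle_inv])
    have a: "tcycle v (window_start 0) (J \<inter> ?I) \<in> grpA"
      by (rule tcycle_window_0_finite_grpA[OF that(1)]) (simp add: finite_small_blocks)
    have a': "tcycle' v (window_start 0) (J \<inter> ?I) \<in> grpA" by (rule tcycle'_mem[OF subgroup_grpA a])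
    have 1: "tcycle v (window_start 0) J = tcycle v (window_start 0) (J - ?I)
        \<circ> tcycle v (window_start 0) (J \<inter> ?I)"
      by (subst tcycle_Un[symmetric]) (auto intro: arg_cong)
    have 2: "tcycle' v (window_start 0) J = tcycle' v (window_start 0) (J - ?I)
        \<circ> tcycle' v (window_start 0) (J \<inter> ?I)"
      unfolding tcycle'_def lift_comp by (rule lift_eqI) auto
    from that(3) show ?thesis
      unfolding inv_perm_tcycle using 1 2 n n' a a' by (elim disjE) blast+
  qed
  have "g \<in> generate perms (gensG X)" using g by (simp add: grpG_def)
  then have "g \<in> grpG X \<and> (\<exists>a\<in>grpA. \<exists>n\<in>N. g = n \<circ> a)"
  proof (induction rule: generate_perm_induct)
    case id
    have "id = id \<circ> (id :: point \<Rightarrow> point)" by simp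
    then show ?case using idN subgroup_perm_id[OF subgroup_grpA] subgroup_perm_id[OF H] by blast
  next
    case (gen s)
    then have s: "s \<in> grpG X" unfolding grpG_def by (rule generate.incl)
    show ?case
    proof (cases "s \<in> gensA")
      case True
      then have "s \<in> grpA" unfolding grpA_def by (rule generate.incl)
      moreover have "s = id \<circ> s" by simp
      ultimately show ?thesis using idN s by blast
    next
      case False
      with gen obtain v J where "v \<le> 2" "s = tcycle v (window_start 0) J" by (rule gensG_cases)
      then show ?thesis using new[of v J s] s by blast
    qed
  next
    case (inv s)
    then have s: "inv\<^bsub>perms\<^esub> s \<in> grpG X" "s \<in> grpG X" unfolding grpG_def
      by (auto intro: generate.inv generate.incl)
    show ?case
    proof (cases "s \<in> gensA")
      case True
      then have "inv\<^bsub>perms\<^esub> s \<in> grpA" unfolding grpA_def by (rule generate.inv)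
      moreover have "inv\<^bsub>perms\<^esub> s = id \<circ> inv\<^bsub>perms\<^esub> s" by simp
      ultimately show ?thesis using idN s by blast
    next
      case False
      with inv obtain v J where "v \<le> 2" "s = tcycle v (window_start 0) J" by (rule gensG_cases)
      then show ?thesis using new[of v J "inv\<^bsub>perms\<^esub> s"] s by blast
    qed
  next
    case (comp f g)
    then obtain a n b m where f: "a \<in> grpA" "n \<in> N" "f = n \<circ> a" and g: "b \<in> grpA" "m \<in> N" "g = m \<circ> b"
      by blast
    let ?a' = "inv\<^bsub>perms\<^esub> a"
    have aa: "a \<circ> ?a' = id" "?a' \<circ> a = id"
      using inv_perm_comp[OF subgroup_perm_bij[OF subgroup_grpA f(1)]] .
    have "a \<circ> m \<circ> ?a' \<in> N"
      by (rule normal_restrict_perm_conj[OF H Nn g(2) _ aa]) (use f(1) grpA_le_grpG in blast)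
    then have "n \<circ> (a \<circ> m \<circ> ?a') \<in> N" by (rule normal_restrict_perm_comp[OF H Nn f(2)])
    moreover have "a \<circ> b \<in> grpA" using f g subgroup_perm_comp[OF subgroup_grpA] by blast
    moreover have "f \<circ> g = (n \<circ> (a \<circ> m \<circ> ?a')) \<circ> (a \<circ> b)"
      using aa(2) unfolding f g by (auto simp: fun_eq_iff)
    ultimately show ?case using comp subgroup_perm_comp[OF H] by blast
  qed
  then show ?thesis by blast
qed

text \<open>
  Each cycle splits into its part in the blocks of \<open>I\<close> and a part in \<open>N\<close> that fixes these blocks and the
  line. The two kinds of parts commute and are permuted by conjugation with the shift, so every
  element of \<open>A\<close> can be sorted accordingly.
\<close>
lemma grpA_decomposition:
  assumes N: "N \<lhd> perms\<lparr>carrier := grpA\<rparr>" and I: "0 \<notin> I"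
    and t: "\<And>v. v \<le> 2 \<Longrightarrow> tcycle v (window_start v) (- I) \<in> N" and g: "g \<in> grpA"
  shows "\<exists>r\<in>supported_on I. \<exists>m\<in>N \<inter> supported_on (- insert 0 I). \<exists>z. g = r \<circ> m \<circ> shift z"
proof -
  let ?K = "- insert 0 I"
  note H = subgroup_grpA
  have IK: "I \<inter> ?K = {}" by auto
  have idI: "id \<in> supported_on J" for J by (auto simp: supported_on_def)
  have idN: "id \<in> N" using subgroup.one_closed[OF normal_imp_subgroup[OF N]] by simp
  have tr: "\<exists>r\<in>supported_on I. \<exists>m\<in>N \<inter> supported_on ?K. \<exists>z. h = r \<circ> m \<circ> shift z"
    if "v \<le> 2" "h = tcycle v (window_start v) UNIV \<or> h = inv\<^bsub>perms\<^esub> (tcycle v (window_start v) UNIV)"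
        for v h
  proof -
    note n = t[OF that(1)]
    have n': "tcycle' v (window_start v) (- I) \<in> N" by (rule normal_restrict_perm_inv[OF H N n tcycle_inv])
    have r: "tcycle v (window_start v) I \<in> supported_on I" using I by (intro tcycle_supported_on) auto
    have m: "tcycle v (window_start v) (- I) \<in> supported_on ?K" by (intro tcycle_supported_on) auto
    have r': "tcycle' v (window_start v) I \<in> supported_on I" by (rule supported_on_inv[OF r tcycle_inv])
    have m': "tcycle' v (window_start v) (- I) \<in> supported_on ?K"
      by (rule supported_on_inv[OF m tcycle_inv])
    have 1: "tcycle v (window_start v) UNIV = tcycle v (window_start v) I \<circ> tcycle v (window_start v) (- I)
        \<circ> shift 0"
      by (subst tcycle_Un[symmetric]) (auto simp: shift_0)
    have 2: "tcycle' v (window_start v) UNIV = tcycle' v (window_start v) I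
        \<circ> tcycle' v (window_start v) (- I) \<circ> shift 0"
      unfolding tcycle'_def lift_comp shift_0 comp_id by (rule lift_eqI) auto
    from that(2) show ?thesis unfolding inv_perm_tcycle
      using 1 2 n n' r r' m m' by (elim disjE) blast+
  qed
  have sh: "\<exists>r\<in>supported_on I. \<exists>m\<in>N \<inter> supported_on ?K. \<exists>z. shift w = r \<circ> m \<circ> shift z" for w
  proof -
    have "shift w = id \<circ> id \<circ> shift w" by simp
    then show ?thesis using idI idN by blast
  qed
  have gens: "s = shift 1 \<or> (\<exists>v\<le>2. s = tcycle v (window_start v) UNIV)" if "s \<in> gensA" for s
  proof -
    have "s = shift 1 \<or> s \<in> (\<lambda>v. tcycle v (window_start v) UNIV) ` {0, 1, 2}" using that
      by (simp only: gensA_def insert_iff)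
    then show ?thesis
    proof
      assume "s \<in> (\<lambda>v. tcycle v (window_start v) UNIV) ` {0, 1, 2}"
      then obtain v where v: "s = tcycle v (window_start v) UNIV" "v \<in> {0, 1, 2}" by (rule imageE)
      from v(2) have "v \<le> 2" by auto
      with v(1) show ?thesis by (intro disjI2 exI conjI)
    qed (rule disjI1)
  qed
  have "g \<in> generate perms gensA" using g by (simp add: grpA_def)
  then show ?thesis
  proof (induction rule: generate_perm_induct)
    case id
    show ?case using sh[of 0] by (simp only: shift_0)
  next
    case (gen s)
    then show ?case using gens tr sh by blast
  next
    case (inv s)
    then show ?case using gens tr sh[of "-1"] inv_perm_shift[of 1] by metis
  next
    case (comp f g)
    then obtain r m z r' m' z' where f: "r \<in> supported_on I" "m \<in> N" "m \<in> supported_on ?K" "f = r \<circ> m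
        \<circ> shift z"
      and g: "r' \<in> supported_on I" "m' \<in> N" "m' \<in> supported_on ?K" "g = r' \<circ> m' \<circ> shift z'" by blast
    let ?r = "shift z \<circ> r' \<circ> shift (- z)" and ?m = "shift z \<circ> m' \<circ> shift (- z)"
    have "?m \<in> N" by (rule normal_restrict_perm_conj[OF H N g(2) shift_grpA shift_inv])
    then have "m \<circ> ?m \<in> N" by (rule normal_restrict_perm_comp[OF H N f(2)])
    moreover have "r \<circ> ?r \<in> supported_on I" "m \<circ> ?m \<in> supported_on ?K"
      using f g supported_on_shift_conj supported_on_comp by blast+
    moreover have "f \<circ> g = (r \<circ> ?r) \<circ> (m \<circ> ?m) \<circ> shift (z + z')"
    proof
      fix p
      have c: "shift (- z) (shift z q) = q" for q using shift_inv(2)[of z] by (simp add: pointfree_idE)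
      have d: "?r (m q) = m (?r q)" for q
        using supported_on_commute[OF supported_on_shift_conj[OF g(1)] f(3) IK, of z] by (metis comp_apply)
      show "(f \<circ> g) p = ((r \<circ> ?r) \<circ> (m \<circ> ?m) \<circ> shift (z + z')) p"
        unfolding f(4) g(4) using d by (simp add: shift_add c)
    qed
    ultimately show ?case by blast
  qed
qed

text \<open>
  Take an element of \<open>A\<close> decomposed as \<open>r \<circ> m \<circ> shift z\<close>. Only the last factor moves the line, so the
  congruence kernel restricts \<open>z\<close> to multiples of its modulus. The modulus is chosen divisible by the
  exponent of a shift in \<open>M\<close>, which gives \<open>shift z \<in> M\<close>, and by \<open>rows n\<close> for all \<open>n \<in> I\<close>, which makes
  \<open>shift z\<close> trivial in these blocks. As the element and \<open>m\<close> are trivial there too, so is \<open>r\<close>.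
\<close>
lemma grpA_congruence:
  assumes M: "M \<in> finite_index_normals (perms\<lparr>carrier := grpA\<rparr>)"
  shows "\<exists>I e. finite I \<and> e > 0 \<and> grpA \<inter> congruence_kernel (grpG X) I e \<subseteq> M"
proof -
  note H = subgroup_grpA
  have Mn: "M \<lhd> perms\<lparr>carrier := grpA\<rparr>" using M by (simp add: finite_index_normals_def)
  obtain e where e: "e > 0" "shift e \<in> M" using shift_power_mem_finite_index[OF H shift_grpA M] by blast
  let ?I = "small_blocks e"
  \<comment> \<open>The second factor makes shifts by multiples of \<open>E\<close> trivial in the blocks of \<open>?I\<close>.\<close>
  define E where "E = e * (\<Prod>n\<in>?I. rows n)"
  have I0: "0 \<notin> ?I" by (simp add: small_blocks_def)
  have t: "tcycle v (window_start v) (- ?I) \<in> M" if "v \<le> 2" for v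
    using tcycle_cofinite_mem_normal'[OF H order_refl that that tcycle_grpA[OF that]
        tcycle_singleton_grpA[OF that] Mn e(2,1)]
    by (simp add: Compl_eq_Diff_UNIV)
  have mult: "shift (e * j) \<in> M" for j
  proof -
    have nat: "shift (e * int k) \<in> M" for k
    proof (induction k)
      case 0
      have "id \<in> M" using subgroup.one_closed[OF normal_imp_subgroup[OF Mn]] by simp
      then show ?case by (simp only: of_nat_0 mult_zero_right shift_0)
    next
      case (Suc k)
      have q: "shift (e * int (Suc k)) = shift e \<circ> shift (e * int k)"
        by (simp add: shift_add[symmetric] algebra_simps)
      show ?case unfolding q by (rule normal_restrict_perm_comp[OF H Mn e(2) Suc])
    qed
    show ?thesis
    proof (cases "j \<ge> 0")
      case True
      then show ?thesis using nat[of "nat j"] by simp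
    next
      case False
      have "shift (- (e * int (nat (- j)))) \<in> M" by (rule normal_restrict_perm_inv[OF H Mn nat shift_inv])
      then show ?thesis using False by simp
    qed
  qed
  have "grpA \<inter> congruence_kernel (grpG X) ?I E \<subseteq> M"
  proof
    fix g assume "g \<in> grpA \<inter> congruence_kernel (grpG X) ?I E"
    then have g: "g \<in> grpA" "\<And>n p. n \<in> ?I \<Longrightarrow> p \<in> block n \<Longrightarrow> g p = p" "E dvd translation g"
      by (auto simp: congruence_kernel_def)
    obtain r m z where r: "r \<in> supported_on ?I" and m: "m \<in> M" "m \<in> supported_on (- insert 0 ?I)"
        and gz: "g = r \<circ> m \<circ> shift z"
      using grpA_decomposition[OF Mn I0 t g(1)] by blast
    have "g (0, 0, 0, 0) = (0, z, 0, 0)"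
      using r m(2) I0 by (simp add: gz shift_apply supported_on_def)
    then have z: "E dvd z" using g(3) by (simp add: translation_def)
    have shift_fixes: "shift z p = p" if p: "fst p \<in> ?I" for p
    proof -
      obtain n i y where pe: "p = (n, i, y)" by (cases p)
      have n: "n \<in> ?I" "n \<noteq> 0" using p pe by (auto simp: small_blocks_def)
      have "rows n dvd (\<Prod>n\<in>?I. rows n)" using n(1) finite_small_blocks by (intro dvd_prodI)
      then have "rows n dvd z" using z unfolding E_def by (meson dvd_mult dvd_trans)
      then obtain c where "z = rows n * c" by (elim dvdE)
      then show ?thesis using n(2) by (auto simp: pe shift_apply mem_block)
    qed
    have "r p = p" for p
    proof (cases "fst p \<in> ?I")
      case False
      then show ?thesis using r by (simp add: supported_on_def)
    next
      case True
      then have "m p = p" using m(2) by (simp add: supported_on_def)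
      then have "g p = r p" using shift_fixes[OF True] by (simp add: gz)
      moreover have "g p = p"
      proof (cases "p \<in> block (fst p)")
        case True
        then show ?thesis using g(2) \<open>fst p \<in> ?I\<close> by blast
      next
        case False
        then show ?thesis using tame_outside[of g p] g(1) grpA_tame True I0 by (metis gr0I subsetD)
      qed
      ultimately show ?thesis by simp
    qed
    then have "r = id" by (intro ext) (simp only: id_apply)
    then have "g = m \<circ> shift z" unfolding gz by (simp only: id_comp)
    moreover obtain c where "z = e * c" using z unfolding E_def by (metis dvdE dvd_mult_left)
    ultimately show "g \<in> M" using normal_restrict_perm_comp[OF H Mn m(1) mult[of c]] by simp
  qed
  moreover have "E > 0" using e(1) unfolding E_def by (intro mult_pos_pos prod_pos) auto
  ultimately show ?thesis using finite_small_blocks by blast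
qed

lemma grothendieck_pair_grpA_grpG:
  "grothendieck_pair (perms\<lparr>carrier := grpA\<rparr>) (perms\<lparr>carrier := grpG X\<rparr>) (\<lambda>a. a)"
  unfolding grothendieck_pair_def
proof (intro conjI ballI)
  show "(\<lambda>a. a) \<in> mon (perms\<lparr>carrier := grpA\<rparr>) (perms\<lparr>carrier := grpG X\<rparr>)"
    using grpA_le_grpG by (auto simp: mon_def hom_def)
next
  fix N g assume "N \<in> finite_index_normals (perms\<lparr>carrier := grpG X\<rparr>)" "g
      \<in> carrier (perms\<lparr>carrier := grpG X\<rparr>)"
  then obtain a n where "a \<in> grpA" "n \<in> N" "g = n \<circ> a" using grpG_eq_normal_grpA[of N X g] by auto
  then show "\<exists>a\<in>carrier (perms\<lparr>carrier := grpA\<rparr>). g \<in> N #>\<^bsub>perms\<lparr>carrier := grpG X\<rparr>\<^esub> a"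
    by (auto simp: r_coset_def)
next
  fix M assume "M \<in> finite_index_normals (perms\<lparr>carrier := grpA\<rparr>)"
  then obtain I e where "finite I" "e > 0" "grpA \<inter> congruence_kernel (grpG X) I e \<subseteq> M"
    using grpA_congruence[of M X] by blast
  then show "\<exists>N\<in>finite_index_normals (perms\<lparr>carrier := grpG X\<rparr>). {a \<in> carrier (perms\<lparr>carrier := grpA\<rparr>). a
      \<in> N} \<subseteq> M"
    using congruence_kernel_finite_index[OF subgroup_grpG grpG_tame, of I e X]
    by (intro bexI[of _ "congruence_kernel (grpG X) I e"]) auto
qed

section \<open>Amenability\<close>

text \<open>
  The last clause lets the construction be repeated with further subgroups.
\<close>
lemma finite_subgroup_join:
  assumes F: "subgroup F perms" "finite F" and F': "subgroup F' perms" "finite F'"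
    and c: "\<And>f f'. f \<in> F \<Longrightarrow> f' \<in> F' \<Longrightarrow> f \<circ> f' = f' \<circ> f"
  shows "\<exists>Q. subgroup Q perms \<and> finite Q \<and> F \<subseteq> Q \<and> F' \<subseteq> Q \<and>
    (\<forall>h. (\<forall>f\<in>F \<union> F'. f \<circ> h = h \<circ> f) \<longrightarrow> (\<forall>q\<in>Q. q \<circ> h = h \<circ> q))"
proof -
  define Q where "Q = (\<lambda>(f, f'). f \<circ> f') ` (F \<times> F')"
  have mem: "f \<circ> f' \<in> Q" if "f \<in> F" "f' \<in> F'" for f f' using that by (auto simp: Q_def)
  have cases: "\<exists>f\<in>F. \<exists>f'\<in>F'. q = f \<circ> f'" if "q \<in> Q" for q using that by (auto simp: Q_def)
  have "subgroup Q perms"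
  proof (rule group.subgroupI[OF group_perm])
    show "Q \<subseteq> carrier perms"
      using subgroup_perm_bij[OF F(1)] subgroup_perm_bij[OF F'(1)] by (auto simp: Q_def intro!: bij_comp)
    show "Q \<noteq> {}" using mem subgroup_perm_id[OF F(1)] subgroup_perm_id[OF F'(1)] by blast
    fix q assume "q \<in> Q"
    then obtain f f' where q: "f \<in> F" "f' \<in> F'" "q = f \<circ> f'" using cases by blast
    have i: "inv\<^bsub>perms\<^esub> f \<in> F" "inv\<^bsub>perms\<^esub> f' \<in> F'"
      using q subgroup.m_inv_closed[OF F(1)] subgroup.m_inv_closed[OF F'(1)] by auto
    have "inv\<^bsub>perms\<^esub> q = inv\<^bsub>perms\<^esub> f' \<circ> inv\<^bsub>perms\<^esub> f"
      using group.inv_mult_group[OF group_perm, of f f'] subgroup_perm_bij[OF F(1) q(1)]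
          subgroup_perm_bij[OF F'(1) q(2)] q(3) by simp
    also have "\<dots> = inv\<^bsub>perms\<^esub> f \<circ> inv\<^bsub>perms\<^esub> f'" using c[OF i] by simp
    finally show "inv\<^bsub>perms\<^esub> q \<in> Q" using mem[OF i] by (simp only:)
    fix r assume "r \<in> Q"
    then obtain g g' where r: "g \<in> F" "g' \<in> F'" "r = g \<circ> g'" using cases by blast
    have "q \<circ> r = f \<circ> (f' \<circ> g) \<circ> g'" unfolding q(3) r(3) by (simp only: o_assoc)
    also have "\<dots> = (f \<circ> g) \<circ> (f' \<circ> g')" unfolding c[OF r(1) q(2), symmetric] by (simp only: o_assoc)
    finally have "q \<circ> r = (f \<circ> g) \<circ> (f' \<circ> g')" .
    moreover have "(f \<circ> g) \<circ> (f' \<circ> g') \<in> Q"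
      by (intro mem subgroup_perm_comp[OF F(1)] subgroup_perm_comp[OF F'(1)] q r)
    ultimately show "q \<otimes>\<^bsub>perms\<^esub> r \<in> Q" by (simp only: perm_simps)
  qed
  moreover have "finite Q" using F(2) F'(2) by (simp add: Q_def)
  moreover have "F \<subseteq> Q" "F' \<subseteq> Q"
    using mem[OF _ subgroup_perm_id[OF F'(1)]] mem[OF subgroup_perm_id[OF F(1)]]
      by (simp_all only: comp_id id_comp subsetI)
  moreover have "q \<circ> h = h \<circ> q" if h: "\<forall>f\<in>F \<union> F'. f \<circ> h = h \<circ> f" and qQ: "q \<in> Q" for h q
  proof -
    obtain f f' where q: "f \<in> F" "f' \<in> F'" "q = f \<circ> f'" using cases[OF qQ] by blast
    have e: "f \<circ> h = h \<circ> f" "f' \<circ> h = h \<circ> f'" using h q by auto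
    have "q \<circ> h = f \<circ> (f' \<circ> h)" by (simp only: q(3) o_assoc)
    also have "\<dots> = (f \<circ> h) \<circ> f'" by (simp only: e(2) o_assoc)
    also have "\<dots> = h \<circ> q" by (simp only: e(1) q(3) o_assoc)
    finally show ?thesis .
  qed
  ultimately show ?thesis by blast
qed

lemma lift_commute:
  assumes "\<And>n i. n > 0 \<Longrightarrow> \<rho> n i = i \<or> \<rho>' n i = i \<and> \<rho>' n (\<rho> n i) = \<rho> n i"
    and "\<And>n i. n > 0 \<Longrightarrow> \<rho>' n i = i \<or> \<rho> n i = i \<and> \<rho> n (\<rho>' n i) = \<rho>' n i"
  shows "lift v \<rho> \<circ> lift v' \<rho>' = lift v' \<rho>' \<circ> lift v \<rho>"
proof
  fix p :: point
  obtain n i y where p: "p = (n, i, y)" by (cases p)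
  show "(lift v \<rho> \<circ> lift v' \<rho>') p = (lift v' \<rho>' \<circ> lift v \<rho>) p"
  proof (cases "n = 0")
    case True
    then show ?thesis by (simp add: p lift_apply)
  next
    case False
    then show ?thesis
      using assms(1)[of n i] assms(2)[of n i] by (auto simp: p lift_apply twist_sheet twist_0)
  qed
qed

text \<open>
  A permutation \<open>r\<close> of row offsets, acting in the same way relative to the start of window \<open>v\<close> in all
  blocks from \<open>n0\<close> on. For fixed \<open>n0\<close> and \<open>v\<close> this is a homomorphism in \<open>r\<close>, so a finite group of
  offset permutations has a finite image although it acts in infinitely many blocks.
\<close>
definition window :: "nat \<Rightarrow> int \<Rightarrow> nat \<Rightarrow> (int \<Rightarrow> int) \<Rightarrow> point \<Rightarrow> point" where
  "window n0 d v r = lift v (\<lambda>n. if n0 \<le> n then (\<lambda>i. window_start v n + r (i - window_start v n)) else id)"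

lemma window_comp: "window n0 d v r \<circ> window n0 d v r' = window n0 d v (r \<circ> r')"
  unfolding window_def lift_comp by (intro lift_eqI) simp

lemma window_id: "window n0 d v id = id"
proof -
  have "window n0 d v id = lift v (\<lambda>n. id)" unfolding window_def by (intro lift_eqI) simp
  then show ?thesis by (simp only: lift_id)
qed

lemma window_inv:
  assumes "r permutes D"
  shows "window n0 d v r \<circ> window n0 d v (inv_into UNIV r) = id" "window n0 d v (inv_into UNIV r)
      \<circ> window n0 d v r = id"
  unfolding window_comp by (simp_all only: permutes_inv_o[OF assms] window_id)

lemma subgroup_window: "subgroup (window n0 d v ` {r. r permutes D}) perms"
proof (rule group.subgroupI[OF group_perm])
  show "window n0 d v ` {r. r permutes D} \<subseteq> carrier perms"
    using o_bij[OF window_inv(2,1)] by auto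
  show "window n0 d v ` {r. r permutes D} \<noteq> {}" using permutes_id by blast
  fix f assume "f \<in> window n0 d v ` {r. r permutes D}"
  then obtain r where r: "f = window n0 d v r" "r permutes D" by auto
  then have "inv\<^bsub>perms\<^esub> f = window n0 d v (inv_into UNIV r)" using inv_perm[OF window_inv[OF r(2)]] by simp
  then show "inv\<^bsub>perms\<^esub> f \<in> window n0 d v ` {r. r permutes D}" using permutes_inv[OF r(2)] by auto
  fix g assume "g \<in> window n0 d v ` {r. r permutes D}"
  then obtain r' where r': "g = window n0 d v r'" "r' permutes D" by auto
  show "f \<otimes>\<^bsub>perms\<^esub> g \<in> window n0 d v ` {r. r permutes D}"
    unfolding perm_simps r r' window_comp using permutes_compose[OF r'(2) r(2)] by blast
qed

lemma window_commute:
  assumes r: "r permutes {- d..d + 2}" "r' permutes {- d..d + 2}" and v: "v \<noteq> v'"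
    and n0: "\<And>n. n \<ge> n0 \<Longrightarrow> 2 * d + 2 < stride n"
  shows "window n0 d v r \<circ> window n0 d v' r' = window n0 d v' r' \<circ> window n0 d v r"
proof -
  have *: "window_start v n + r (i - window_start v n) = i \<or>
      window_start w n + s (i - window_start w n) = i \<and> window_start w n + s (window_start v n + r (i -
          window_start v n) - window_start w n) = window_start v n + r (i - window_start v n)"
    if rs: "r permutes {- d..d + 2}" "s permutes {- d..d + 2}" and "v \<noteq> w" "n \<ge> n0" for r s v w n i
  proof (cases "i - window_start v n \<in> {- d..d + 2}")
    case False
    then show ?thesis using permutes_not_in[OF rs(1), of "i - window_start v n"] by auto
  next
    case True
    then have j: "r (i - window_start v n) \<in> {- d..d + 2}"
      using permutes_in_image[OF rs(1), of "i - window_start v n"] by auto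
    have "stride n \<le> \<bar>int v - int w\<bar> * stride n" using that(3) by simp
    then have "stride n \<le> \<bar>window_start v n - window_start w n\<bar>"
      by (simp add: window_start_def abs_mult left_diff_distrib[symmetric])
    then have "i - window_start w n \<notin> {- d..d + 2}" "window_start v n + r (i - window_start v n) -
        window_start w n \<notin> {- d..d + 2}"
      using True j n0[OF that(4)] by auto
    then show ?thesis using permutes_not_in[OF rs(2)] by auto
  qed
  show ?thesis
    unfolding window_def
    by (rule lift_commute) (use *[OF r v] *[OF r(2,1) v[symmetric]] in auto)
qed

definition window_gens :: "nat \<Rightarrow> (point \<Rightarrow> point) set" where
  "window_gens d = (\<lambda>(v, z). shift z \<circ> tcycle v (window_start v) UNIV
      \<circ> shift (- z)) ` ({0, 1, 2} \<times> {- int d..int d})"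

lemma window_gensE:
  assumes "s \<in> window_gens d"
  obtains v z where "v \<in> {0, 1, 2}" "- int d \<le> z" "z \<le> int d" "s = shift z \<circ> tcycle v (window_start v) UNIV
      \<circ> shift (- z)"
proof -
  obtain q where q: "s = (\<lambda>(v, z). shift z \<circ> tcycle v (window_start v) UNIV \<circ> shift (- z)) q" "q
      \<in> {0, 1, 2} \<times> {- int d..int d}"
    using assms unfolding window_gens_def by (rule imageE)
  then show ?thesis by (intro that[of "fst q" "snd q"]) (simp_all only: mem_Times_iff case_prod_beta
      atLeastAtMost_iff)
qed

text \<open>
  From block \<open>n0\<close> on, the cycles shifted by at most \<open>d\<close> stay within disjoint ranges of rows around the
  three windows, where they act through the finite groups of \<open>window\<close>. What they do in the earlier
  blocks is a permutation of a finite set of points. These four finite groups commute.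
\<close>
lemma window_gens_finite_subgroup: "\<exists>Q. subgroup Q perms \<and> finite Q \<and> window_gens d \<subseteq> Q"
proof -
  \<comment> \<open>From here on neighbouring windows are further apart than the shifted cycles extend.\<close>
  define n0 where "n0 = 2 * d + 5"
  have n0: "2 * int d + 5 < stride n" if "n0 \<le> n" for n
  proof -
    have "n < 8 ^ n" using order.strict_trans2[OF less_exp power_mono[of "2 :: nat" 8 n]] by simp
    then have "int n < stride n" by (metis of_nat_less_iff of_nat_numeral of_nat_power)
    then show ?thesis using that unfolding n0_def by linarith
  qed
  define B where "B = (\<Union>n\<in>{0<..<n0}. block n)"
  have finB: "finite B" using finite_block by (auto simp: B_def)
  define D where "D = {- int d..int d + 2}"
  define F where "F v = window n0 (int d) v ` {r. r permutes D}" for v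
  define F3 where "F3 = {f :: point \<Rightarrow> point. f permutes B}"
  have sF: "subgroup (F v) perms" for v unfolding F_def by (rule subgroup_window)
  have fF: "finite (F v)" for v by (simp add: F_def D_def finite_permutations)
  have fF3: "finite F3" using finite_permutations[OF finB] by (simp add: F3_def)
  have sF3: "subgroup F3 perms"
  proof (rule group.subgroupI[OF group_perm])
    fix f assume "f \<in> F3"
    then have f: "f permutes B" by (simp add: F3_def)
    have "inv\<^bsub>perms\<^esub> f = inv_into UNIV f" by (rule inv_perm) (simp_all only: permutes_inv_o[OF f])
    then show "inv\<^bsub>perms\<^esub> f \<in> F3" using permutes_inv[OF f] by (simp add: F3_def)
    fix g assume "g \<in> F3"
    then show "f \<otimes>\<^bsub>perms\<^esub> g \<in> F3" using permutes_compose[of g B f] f by (simp add: F3_def)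
  next
    show "F3 \<noteq> {}" using permutes_id[of B] unfolding F3_def by blast
  qed (auto simp: F3_def permutes_bij)
  have cF: "f \<circ> g = g \<circ> f" if f: "f \<in> F v" and g: "g \<in> F w" and vw: "v \<noteq> w" for f g v w
  proof -
    obtain r r' where "r permutes D" "f = window n0 (int d) v r" "r' permutes D" "g
        = window n0 (int d) w r'"
      using f g by (auto simp: F_def)
    moreover have "2 * int d + 2 < stride n" if "n0 \<le> n" for n using n0[OF that] by linarith
    ultimately show ?thesis using window_commute[of r "int d" r' v w n0] vw unfolding D_def by blast
  qed
  have cF3: "f \<circ> g = g \<circ> f" if f3: "f \<in> F3" and gF: "g \<in> F v" for f g v
  proof
    fix p
    have f: "f permutes B" using f3 by (simp add: F3_def)
    obtain r where g: "g = window n0 (int d) v r" using gF by (auto simp: F_def)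
    have gfst: "fst (g q) = fst q" for q by (cases q) (simp add: g window_def lift_apply)
    have glow: "g q = q" if "fst q < n0" for q
      using that by (cases q) (simp add: g window_def lift_apply twist_0)
    have Bfst: "fst q < n0" if "q \<in> B" for q using that by (auto simp: B_def block_def)
    show "(f \<circ> g) p = (g \<circ> f) p"
    proof (cases "p \<in> B")
      case True
      then have "f p \<in> B" using permutes_in_image[OF f] by blast
      then show ?thesis using True glow Bfst by simp
    next
      case False
      then have "g p \<notin> B" using glow[of p] gfst[of p] Bfst[of "g p"] by auto
      then show ?thesis using False permutes_not_in[OF f] by simp
    qed
  qed
  obtain Q1 where Q1: "subgroup Q1 perms" "finite Q1" "F 0 \<subseteq> Q1" "F 1 \<subseteq> Q1"
    and c1: "\<And>h q. \<forall>f\<in>F 0 \<union> F 1. f \<circ> h = h \<circ> f \<Longrightarrow> q \<in> Q1 \<Longrightarrow> q \<circ> h = h \<circ> q"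
    using finite_subgroup_join[OF sF fF sF fF, of 0 1] cF[of _ 0 _ 1] by (metis zero_neq_one)
  have "q \<circ> f = f \<circ> q" if "q \<in> Q1" "f \<in> F 2" for q f
    by (rule c1[OF _ that(1)]) (use cF[of _ 0 f 2] cF[of _ 1 f 2] that(2) in auto)
  then obtain Q2 where Q2: "subgroup Q2 perms" "finite Q2" "Q1 \<subseteq> Q2" "F 2 \<subseteq> Q2"
    and c2: "\<And>h q. \<forall>f\<in>Q1 \<union> F 2. f \<circ> h = h \<circ> f \<Longrightarrow> q \<in> Q2 \<Longrightarrow> q \<circ> h = h \<circ> q"
    using finite_subgroup_join[OF Q1(1,2) sF fF, of 2] by metis
  have "q \<circ> f = f \<circ> q" if "q \<in> Q2" "f \<in> F3" for q f
  proof (rule c2[OF _ that(1)], intro ballI)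
    fix h assume "h \<in> Q1 \<union> F 2"
    then show "h \<circ> f = f \<circ> h"
      using c1[of f h] cF3[OF that(2)] by (metis Un_iff)
  qed
  then obtain Q where Q: "subgroup Q perms" "finite Q" "Q2 \<subseteq> Q" "F3 \<subseteq> Q"
    using finite_subgroup_join[OF Q2(1,2) sF3 fF3] by metis
  have FQ: "F v \<subseteq> Q" if "v \<in> {0, 1, 2}" for v using that Q1 Q2 Q by blast
  have "window_gens d \<subseteq> Q"
  proof
    fix f assume "f \<in> window_gens d"
    then obtain v z where v: "v \<in> {0, 1, 2}" and z: "- int d \<le> z" "z \<le> int d"
      and f: "f = shift z \<circ> tcycle v (window_start v) UNIV \<circ> shift (- z)" by (rule window_gensE)
    have v2: "v \<le> 2" using v by auto
    let ?lo = "shift z \<circ> tcycle v (window_start v) {..<n0} \<circ> shift (- z)"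
    have "?lo \<in> tame"
      by (intro subgroup_perm_comp[OF subgroup_tame] shift_tame tcycle_tame window_start_bounds v2)
    have sup: "?lo \<in> supported_on ({..<n0} - {0})"
      by (intro supported_on_shift_conj tcycle_supported_on) auto
    have "?lo p = p" if "p \<notin> B" for p
    proof (cases "fst p \<in> {..<n0} - {0}")
      case True
      then have "p \<notin> block (fst p)" using that by (auto simp: B_def)
      then show ?thesis using tame_outside[OF \<open>?lo \<in> tame\<close>] True by simp
    next
      case False
      then show ?thesis using sup by (simp add: supported_on_def)
    qed
    moreover have "bij ?lo" using \<open>?lo \<in> tame\<close> by (simp add: tame_def)
    ultimately have "?lo permutes B" unfolding permutes_def bij_iff by blast
    then have lo: "?lo \<in> Q" using Q(4) by (auto simp: F3_def)
    have hi: "shift z \<circ> tcycle v (window_start v) {n0..} \<circ> shift (- z)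
        = tcycle v (\<lambda>n. window_start v n + z) {n0..}"
    proof (rule shift_tcycle_conj)
      fix n assume n: "n \<in> {n0..}" "n > 0"
      then show "0 \<le> window_start v n \<and> window_start v n + 2 < rows n \<and> 0 \<le> window_start v n + z
          \<and> window_start v n + z + 2 < rows n \<and> (\<exists>j. window_start v n + z = window_start v n + z + j * rows
          n)"
        using window_start_bounds[OF v2, of n] n0[of n] z by (auto intro!: exI[of _ 0])
    qed
    also have "\<dots> = window n0 (int d) v (cyc z)"
      unfolding tcycle_def window_def by (rule lift_eqI) (auto simp: cyc_def)
    also have "\<dots> \<in> F v"
    proof -
      have "cyc z permutes D"
        unfolding permutes_def
      proof (intro conjI allI impI)
        show "cyc z x = x" if "x \<notin> D" for x using that z by (auto simp: D_def cyc_def)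
        show "\<exists>!x. cyc z x = y" for y by (metis cyc_inv)
      qed
      then show ?thesis by (simp add: F_def)
    qed
    finally have "shift z \<circ> tcycle v (window_start v) {n0..} \<circ> shift (- z) \<in> Q" using FQ[OF v] by blast
    then have "?lo \<circ> (shift z \<circ> tcycle v (window_start v) {n0..} \<circ> shift (- z)) \<in> Q"
      by (rule subgroup_perm_comp[OF Q(1) lo])
    also have "?lo \<circ> (shift z \<circ> tcycle v (window_start v) {n0..} \<circ> shift (- z)) = shift z
        \<circ> tcycle v (window_start v) {..<n0} \<circ> (shift (- z) \<circ> shift z) \<circ> tcycle v (window_start v) {n0..} \<circ>
        shift (- z)"
      by (simp only: o_assoc)
    also have "\<dots> = shift z \<circ> (tcycle v (window_start v) {..<n0} \<circ> tcycle v (window_start v) {n0..})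
        \<circ> shift (- z)"
      by (simp only: shift_inv comp_id o_assoc)
    also have "tcycle v (window_start v) {..<n0} \<circ> tcycle v (window_start v) {n0..}
        = tcycle v (window_start v) UNIV"
    proof -
      have "{..<n0} \<union> {n0..} = UNIV" "{..<n0} \<inter> {n0..} = {}" by auto
      then show ?thesis using tcycle_Un[of "{..<n0}" "{n0..}" v "window_start v"] by simp
    qed
    finally show "f \<in> Q" unfolding f .
  qed
  then show ?thesis using Q by blast
qed

definition window_grp :: "nat \<Rightarrow> (point \<Rightarrow> point) set" where
  "window_grp d = generate perms (window_gens d)"

lemma window_gens_grpA: "window_gens d \<subseteq> grpA"
proof
  fix f assume "f \<in> window_gens d"
  then obtain v z where v: "v \<in> {0, 1, 2}"
      and f: "f = shift z \<circ> tcycle v (window_start v) UNIV \<circ> shift (- z)" by (rule window_gensE)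
  have "v \<le> 2" using v by auto
  then show "f \<in> grpA" unfolding f by (intro subgroup_perm_comp[OF subgroup_grpA] shift_grpA tcycle_grpA)
qed

lemma window_gens_carrier: "window_gens d \<subseteq> carrier perms"
  using window_gens_grpA subgroup.subset[OF subgroup_grpA] by blast

lemma window_grp_subgroup: "subgroup (window_grp d) perms"
  unfolding window_grp_def by (rule group.generate_is_subgroup[OF group_perm window_gens_carrier])

lemma window_grp_grpA: "window_grp d \<subseteq> grpA"
  unfolding window_grp_def by (rule group.generate_subgroup_incl[OF group_perm window_gens_grpA
      subgroup_grpA])

lemma finite_window_grp: "finite (window_grp d)"
  using window_gens_finite_subgroup group.generate_subgroup_incl[OF group_perm] finite_subset
  unfolding window_grp_def by metis

lemma window_grp_mono: "d \<le> d' \<Longrightarrow> window_grp d \<subseteq> window_grp d'"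
  unfolding window_grp_def by (rule group.mono_generate[OF group_perm]) (auto simp: window_gens_def)

lemma window_grp_shift_conj: "p \<in> window_grp d \<Longrightarrow> \<exists>d'. shift z \<circ> p \<circ> shift (- z) \<in> window_grp d'"
proof -
  let ?W = "window_grp (d + nat \<bar>z\<bar>)"
  note W = window_grp_subgroup[of "d + nat \<bar>z\<bar>"]
  have gen: "shift z \<circ> s \<circ> shift (- z) \<in> ?W" if s: "s \<in> window_gens d" for s
  proof -
    obtain v w where vw: "v \<in> {0, 1, 2}" "- int d \<le> w" "w \<le> int d" "s = shift w
        \<circ> tcycle v (window_start v) UNIV \<circ> shift (- w)"
      using s by (rule window_gensE)
    have "shift z \<circ> s \<circ> shift (- z) = (shift z \<circ> shift w) \<circ> tcycle v (window_start v) UNIV \<circ> (shift (- w)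
        \<circ> shift (- z))"
      unfolding vw(4) by (simp only: o_assoc)
    also have "\<dots> = shift (z + w) \<circ> tcycle v (window_start v) UNIV \<circ> shift (- (z + w))"
      by (simp only: shift_add[symmetric]) (simp add: algebra_simps)
    also have "\<dots> \<in> window_gens (d + nat \<bar>z\<bar>)"
      using vw(1-3) unfolding window_gens_def by (intro image_eqI[of _ _ "(v, z + w)"]) auto
    finally show ?thesis unfolding window_grp_def by (rule generate.incl)
  qed
  assume "p \<in> window_grp d"
  then have "p \<in> generate perms (window_gens d)" by (simp add: window_grp_def)
  then have "shift z \<circ> p \<circ> shift (- z) \<in> ?W"
  proof (induction rule: generate_perm_induct)
    case id
    show ?case unfolding comp_id shift_inv by (rule subgroup_perm_id[OF W])
  next
    case (gen s)
    then show ?case by (rule \<open>\<And>s. s \<in> window_gens d \<Longrightarrow> shift z \<circ> s \<circ> shift (- z) \<in> ?W\<close>)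
  next
    case (inv s)
    have b: "bij s" using subsetD[OF window_gens_carrier inv] by simp
    note c = inv_perm_comp[OF b]
    show ?case
    proof (rule subgroup_perm_inv[OF W gen[OF inv]])
      have "(shift z \<circ> s \<circ> shift (- z)) \<circ> (shift z \<circ> inv\<^bsub>perms\<^esub> s \<circ> shift (- z)) = shift z \<circ> s
          \<circ> (shift (- z) \<circ> shift z) \<circ> inv\<^bsub>perms\<^esub> s \<circ> shift (- z)"
        by (simp only: o_assoc)
      also have "\<dots> = shift z \<circ> (s \<circ> inv\<^bsub>perms\<^esub> s) \<circ> shift (- z)" by (simp only: shift_inv comp_id o_assoc)
      also have "\<dots> = id" by (simp only: c comp_id shift_inv)
      finally show "(shift z \<circ> s \<circ> shift (- z)) \<circ> (shift z \<circ> inv\<^bsub>perms\<^esub> s \<circ> shift (- z)) = id" .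
      have "(shift z \<circ> inv\<^bsub>perms\<^esub> s \<circ> shift (- z)) \<circ> (shift z \<circ> s \<circ> shift (- z)) = shift z \<circ> inv\<^bsub>perms\<^esub> s
          \<circ> (shift (- z) \<circ> shift z) \<circ> s \<circ> shift (- z)"
        by (simp only: o_assoc)
      also have "\<dots> = shift z \<circ> (inv\<^bsub>perms\<^esub> s \<circ> s) \<circ> shift (- z)" by (simp only: shift_inv comp_id o_assoc)
      also have "\<dots> = id" by (simp only: c comp_id shift_inv)
      finally show "(shift z \<circ> inv\<^bsub>perms\<^esub> s \<circ> shift (- z)) \<circ> (shift z \<circ> s \<circ> shift (- z)) = id" .
    qed
  next
    case (comp f g)
    have "shift z \<circ> (f \<circ> g) \<circ> shift (- z) = (shift z \<circ> f \<circ> (shift (- z) \<circ> shift z)) \<circ> g \<circ> shift (- z)"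
      by (simp only: shift_inv comp_id o_assoc)
    also have "\<dots> = (shift z \<circ> f \<circ> shift (- z)) \<circ> (shift z \<circ> g \<circ> shift (- z))" by (simp only: o_assoc)
    also have "\<dots> \<in> ?W" by (rule subgroup_perm_comp[OF W comp])
    finally show ?case .
  qed
  then show ?thesis by blast
qed

lemma window_grp_directed:
  assumes "finite E" "E \<subseteq> (\<Union>d. window_grp d)"
  shows "\<exists>d. E \<subseteq> window_grp d"
  using assms
proof (induction E)
  case (insert x E)
  then obtain d d' where "E \<subseteq> window_grp d" "x \<in> window_grp d'" by auto
  then show ?case using window_grp_mono[of d "max d d'"] window_grp_mono[of d' "max d d'"]
    by (intro exI[of _ "max d d'"]) auto
qed simp

lemma grpA_window_shift:
  assumes "g \<in> grpA" shows "\<exists>p\<in>(\<Union>d. window_grp d). \<exists>z. g = p \<circ> shift z"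
proof -
  have mem: "id \<in> window_grp 0" by (rule subgroup_perm_id[OF window_grp_subgroup])
  have sh: "\<exists>p\<in>(\<Union>d. window_grp d). \<exists>z. shift w = p \<circ> shift z" for w
  proof -
    have "shift w = id \<circ> shift w" by simp
    then show ?thesis using mem by blast
  qed
  have gens: "s \<in> window_gens 0 \<or> s = shift 1" if "s \<in> gensA" for s
  proof (rule disjCI)
    assume "s \<noteq> shift 1"
    then have "s \<in> (\<lambda>v. tcycle v (window_start v) UNIV) ` {0, 1, 2}" using that
      by (simp only: gensA_def insert_iff simp_thms)
    then obtain v where v: "s = tcycle v (window_start v) UNIV" "v \<in> {0, 1, 2}" by (rule imageE)
    have "s = shift 0 \<circ> tcycle v (window_start v) UNIV \<circ> shift (- 0)" by (simp add: v shift_0)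
    also have "\<dots> \<in> window_gens 0" unfolding window_gens_def using v(2)
      by (intro image_eqI[of _ _ "(v, 0)"]) auto
    finally show "s \<in> window_gens 0" .
  qed
  have win: "\<exists>p\<in>(\<Union>d. window_grp d). \<exists>z. h = p \<circ> shift z" if "h \<in> window_grp 0" for h
  proof -
    have "h = h \<circ> shift 0" by (simp only: shift_0 comp_id)
    then show ?thesis using that by blast
  qed
  have "g \<in> generate perms gensA" using assms by (simp add: grpA_def)
  then show ?thesis
  proof (induction rule: generate_perm_induct)
    case id
    then show ?case using sh[of 0] by (simp only: shift_0)
  next
    case (gen s)
    from gens[OF this] show ?case
    proof
      assume "s = shift 1"
      then show ?thesis using sh[of 1] by (simp only:)
    next
      assume "s \<in> window_gens 0"
      then show ?thesis using win unfolding window_grp_def by (blast intro: generate.incl)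
    qed
  next
    case (inv s)
    from gens[OF this] show ?case
    proof
      assume "s = shift 1"
      then show ?thesis using sh[of "- 1"] by (simp only: inv_perm_shift)
    next
      assume "s \<in> window_gens 0"
      then show ?thesis using win unfolding window_grp_def by (blast intro: generate.inv)
    qed
  next
    case (comp f g)
    then obtain d p z d' q w where f: "p \<in> window_grp d" "f = p \<circ> shift z"
        and g: "q \<in> window_grp d'" "g = q \<circ> shift w" by blast
    let ?q = "shift z \<circ> q \<circ> shift (- z)"
    obtain d'' where "?q \<in> window_grp d''" using window_grp_shift_conj[OF g(1)] by blast
    then have q: "?q \<in> window_grp (max d d'')" using window_grp_mono[of d'' "max d d''"] by auto
    have "p \<in> window_grp (max d d'')" using f(1) window_grp_mono[of d "max d d''"] by auto
    then have "p \<circ> ?q \<in> window_grp (max d d'')" by (rule subgroup_perm_comp[OF window_grp_subgroup _ q])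
    moreover have "f \<circ> g = (p \<circ> ?q) \<circ> shift (z + w)"
    proof -
      have "(p \<circ> ?q) \<circ> shift (z + w) = p \<circ> shift z \<circ> q \<circ> (shift (- z) \<circ> shift z) \<circ> shift w"
        by (simp only: shift_add o_assoc)
      then show ?thesis unfolding f g by (simp only: shift_inv comp_id o_assoc)
    qed
    ultimately show ?case by blast
  qed
qed

lemma amenable_grpA: "amenable (perms\<lparr>carrier := grpA\<rparr>)"
proof (rule amenable_locally_finite_by_int[where \<tau> = shift and P = "\<Union>d. window_grp d"])
  let ?G = "perms\<lparr>carrier := grpA\<rparr>"
  show "group ?G" by (rule group_restrict_perm[OF subgroup_grpA])
  show "shift i \<in> carrier ?G" for i using shift_grpA by simp
  show "shift (i + j) = shift i \<otimes>\<^bsub>?G\<^esub> shift j" for i j using shift_add[of i j] by simp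
  show "(\<Union>d. window_grp d) \<subseteq> carrier ?G" using window_grp_grpA by auto
  show "shift (- i) \<otimes>\<^bsub>?G\<^esub> p \<otimes>\<^bsub>?G\<^esub> shift i \<in> (\<Union>d. window_grp d)" if "p \<in> (\<Union>d. window_grp d)" for p i
    using that window_grp_shift_conj[of p _ "- i"] by auto
  show "\<exists>p\<in>\<Union>d. window_grp d. \<exists>i. g = p \<otimes>\<^bsub>?G\<^esub> shift i" if "g \<in> carrier ?G" for g
    using grpA_window_shift[of g] that by simp
  fix E assume "finite E" "E \<subseteq> (\<Union>d. window_grp d)"
  then obtain d where "E \<subseteq> window_grp d" using window_grp_directed by blast
  moreover have "subgroup (window_grp d) ?G"
    by (rule group.subgroup_incl[OF group_perm window_grp_subgroup subgroup_grpA window_grp_grpA])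
  ultimately show "\<exists>F. subgroup F ?G \<and> finite F \<and> E \<subseteq> F" using finite_window_grp by blast
qed

section \<open>Free subgroups by ping-pong\<close>

definition int_letter :: "bool \<Rightarrow> bool \<Rightarrow> int \<times> int \<Rightarrow> int \<times> int" where
  "int_letter c b = (\<lambda>(x, y). if c then (x + (if b then 3 else - 3) * y, y) else (x, y + (if b then 3 else -
      3) * x))"

definition int_word :: "(bool \<times> bool) list \<Rightarrow> int \<times> int \<Rightarrow> int \<times> int" where
  "int_word w v = foldr (\<lambda>(c, b). int_letter c b) w v"

lemma int_word_simps [simp]: "int_word [] v = v" "int_word (l # w) v
    = int_letter (fst l) (snd l) (int_word w v)"
  by (simp_all add: int_word_def case_prod_beta)

text \<open>
  The ping-pong regions: \<open>c\<close> tells which coordinate dominates and \<open>b\<close> is the sign of the product.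
\<close>
definition cone :: "bool \<Rightarrow> bool \<Rightarrow> (int \<times> int) set" where
  "cone c b = {(x, y). (if c then \<bar>y\<bar> < \<bar>x\<bar> else \<bar>x\<bar> < \<bar>y\<bar>) \<and> (if b then 0 < x * y else x * y < 0)}"

lemma cone_disjoint: "v \<in> cone c b \<Longrightarrow> v \<in> cone c' b' \<Longrightarrow> c = c' \<and> b = b'"
  by (cases c; cases c'; cases b; cases b') (auto simp: cone_def)

lemma sign_split:
  fixes x y :: int
  shows "0 < x * y \<longleftrightarrow> 0 < x \<and> 0 < y \<or> x < 0 \<and> y < 0" "x * y < 0 \<longleftrightarrow> 0 < x \<and> y < 0 \<or> x < 0 \<and> 0 < y"
  by (auto simp: zero_less_mult_iff mult_less_0_iff)

text \<open>
  With the entry 3 even the diagonal vector \<open>(1, 1)\<close> is sent into the right region by each letter, so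
  that it can serve as base point for all words. With the entry 2 it would be sent by an inverse
  letter to a vector with coordinates of equal size.
\<close>
lemma int_letter_cone:
  assumes "v = (1, 1) \<or> (\<exists>c' b'. v \<in> cone c' b' \<and> \<not> (c' = c \<and> b' \<noteq> b))"
  shows "int_letter c b v \<in> cone c b"
proof -
  obtain x y where v: "v = (x, y)" by (cases v)
  show ?thesis
    using assms unfolding v int_letter_def cone_def
    by (cases c; cases b) (auto simp: sign_split split: if_splits)
qed

lemma int_word_cone:
  assumes "l # w \<in> reduced_words UNIV"
  shows "int_word (l # w) (1, 1) \<in> cone (fst l) (snd l)"
  using assms
proof (induction w arbitrary: l)
  case Nil
  then show ?case by (auto intro!: int_letter_cone)
next
  case (Cons m w)
  then have "int_word (m # w) (1, 1) \<in> cone (fst m) (snd m)" by (simp add: reduced_words_Cons)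
  moreover have "\<not> (fst m = fst l \<and> snd m \<noteq> snd l)"
    using Cons.prems by (auto simp: reduced_words_Cons letter_inv_def prod_eq_iff)
  ultimately show ?case by (subst int_word_simps) (blast intro: int_letter_cone)
qed

lemma inj_int_letter: "int_letter c b v = int_letter c b v' \<Longrightarrow> v = v'"
  by (auto simp: int_letter_def split: prod.splits if_splits)

text \<open>
  The region that contains the image of \<open>(1, 1)\<close> determines the first letter, which can then be
  cancelled.
\<close>
lemma int_word_inj:
  assumes "w \<in> reduced_words UNIV" "w' \<in> reduced_words UNIV" "int_word w (1, 1) = int_word w' (1, 1)"
  shows "w = w'"
  using assms
proof (induction w arbitrary: w')
  case Nil
  show ?case
  proof (cases w')
    case (Cons l v)
    then show ?thesis using int_word_cone[of l v] Nil by (auto simp: cone_def split: if_splits)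
  qed simp
next
  case (Cons l w)
  show ?case
  proof (cases w')
    case Nil
    then show ?thesis using int_word_cone[of l w] Cons.prems by (auto simp: cone_def split: if_splits)
  next
    case w': (Cons m v)
    have "int_word (l # w) (1, 1) \<in> cone (fst l) (snd l)" "int_word (l # w) (1, 1) \<in> cone (fst m) (snd m)"
      using int_word_cone[of l w] int_word_cone[of m v] Cons.prems w' by (simp_all del: int_word_simps)
    then have "l = m" using cone_disjoint by (auto simp: prod_eq_iff simp del: int_word_simps)
    moreover have "w = v"
    proof (rule Cons.IH)
      show "w \<in> reduced_words UNIV" "v \<in> reduced_words UNIV" using Cons.prems w'
        by (simp_all add: reduced_words_Cons)
      have "int_letter (fst l) (snd l) (int_word w (1, 1)) = int_letter (fst l) (snd l) (int_word v (1, 1))"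
        using Cons.prems(3) w' \<open>l = m\<close> by simp
      then show "int_word w (1, 1) = int_word v (1, 1)" by (rule inj_int_letter)
    qed
    ultimately show ?thesis using w' by simp
  qed
qed

text \<open>
  The twisted and the untwisted cycle move the rows of window 0 in the same way, so this quotient
  preserves every row and acts on it by a power of the twist, in the blocks where both are nontrivial.
\<close>
definition free_gen :: "nat set \<Rightarrow> bool \<Rightarrow> point \<Rightarrow> point" where
  "free_gen X c = (if c then tcycle 1 (window_start 0) UNIV else tcycle 2 (window_start 0) (Suc ` X))
      \<circ> tcycle' 0 (window_start 0) UNIV"

lemma tcycle_gensG: "tcycle 1 (window_start 0) UNIV \<in> grpG X" "tcycle 2 (window_start 0) (Suc ` X)
    \<in> grpG X" "tcycle 0 (window_start 0) UNIV \<in> grpG X"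
proof -
  show "tcycle 1 (window_start 0) UNIV \<in> grpG X" "tcycle 2 (window_start 0) (Suc ` X) \<in> grpG X"
    unfolding grpG_def by (auto intro!: generate.incl simp: gensG_def)
  show "tcycle 0 (window_start 0) UNIV \<in> grpG X" using subsetD[OF grpA_le_grpG tcycle_grpA[of 0]] by simp
qed

lemma free_gen_grpG: "free_gen X c \<in> grpG X"
  unfolding free_gen_def using tcycle_gensG[of X] tcycle'_mem[OF subgroup_grpG tcycle_gensG(3)]
  by (auto intro!: subgroup_perm_comp[OF subgroup_grpG])

definition reduce_mod :: "nat \<Rightarrow> int \<times> int \<Rightarrow> int \<times> int" where
  "reduce_mod n v = (fst v mod int n, snd v mod int n)"

lemma reduce_mod_sheet: "n > 0 \<Longrightarrow> reduce_mod n v \<in> sheet n"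
  by (simp add: reduce_mod_def sheet_def)

lemma twist_trivial: "twist 0 n z y = y"
  by (cases y) (simp add: twist_def)

lemma add_mult_mod:
  fixes a b k n :: int
  shows "(a + k * (b mod n)) mod n = (a + k * b) mod n" "(a - k * (b mod n)) mod n = (a - k * b) mod n"
  by (metis mod_add_right_eq mod_mult_right_eq) (metis mod_diff_right_eq mod_mult_right_eq)

text \<open>
  The cycle takes the middle row of the window to itself after a displacement by \<open>-1\<close> without twist and
  one by \<open>1\<close> with twist.
\<close>
lemma free_gen_row:
  assumes n: "n \<in> Suc ` X" and y: "y \<in> sheet n"
  shows "free_gen X c (n, stride n + 1, y) = (n, stride n + 1, twist (if c then 1 else 2) n 1 y)"
  using assms by (auto simp: free_gen_def tcycle_def tcycle'_def lift_apply cyc_def cyc'_def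
      window_start_def twist_trivial twist_sheet)

lemma free_gen_letter:
  assumes n: "n \<in> Suc ` X"
  shows "letter_value perms (free_gen X c, b) (n, stride n + 1, reduce_mod n v)
      = (n, stride n + 1, reduce_mod n (int_letter c b v))"
proof -
  have n0: "n > 0" using n by auto
  have tw: "twist (if c then 1 else 2) n (if b then 1 else -1) (reduce_mod n v)
      = reduce_mod n (int_letter c b v)" for b v
    by (cases v) (auto simp: twist_def reduce_mod_def int_letter_def mod_simps add_mult_mod)
  have fwd: "free_gen X c (n, stride n + 1, reduce_mod n v) = (n, stride n + 1, reduce_mod n (int_letter c
      True v))" for v
    using free_gen_row[OF n reduce_mod_sheet[OF n0]] tw[of True] by simp
  show ?thesis
  proof (cases b)
    case True
    then show ?thesis using fwd by (simp add: letter_value_def)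
  next
    case False
    have "int_letter c True (int_letter c False v) = v" by (auto simp: int_letter_def split: prod.splits)
    then have "free_gen X c (n, stride n + 1, reduce_mod n (int_letter c False v))
        = (n, stride n + 1, reduce_mod n v)"
      using fwd[of "int_letter c False v"] by simp
    moreover have "(inv\<^bsub>perms\<^esub> (free_gen X c)) (free_gen X c p) = p" for p
      using inv_perm_comp(2)[OF subgroup_perm_bij[OF subgroup_grpG free_gen_grpG]]
        by (simp add: pointfree_idE)
    ultimately have "(inv\<^bsub>perms\<^esub> (free_gen X c)) (n, stride n + 1, reduce_mod n v)
        = (n, stride n + 1, reduce_mod n (int_letter c False v))"
      by metis
    moreover have "letter_value perms (free_gen X c, b) = inv\<^bsub>perms\<^esub> (free_gen X c)" using False
      by (simp add: letter_value_def)
    ultimately show ?thesis using False by (simp only:)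
  qed
qed

lemma free_gen_word:
  assumes n: "n \<in> Suc ` X"
  shows "word_value perms (map (\<lambda>l. (free_gen X (fst l), snd l)) w) (n, stride n + 1, reduce_mod n v)
      = (n, stride n + 1, reduce_mod n (int_word w v))"
  by (induction w) (simp_all add: free_gen_letter[OF n])

lemma reduce_mod_eventually_inj:
  assumes "v \<noteq> v'" and "int n > \<bar>fst v - fst v'\<bar> + \<bar>snd v - snd v'\<bar>"
  shows "reduce_mod n v \<noteq> reduce_mod n v'"
proof
  assume "reduce_mod n v = reduce_mod n v'"
  then have "int n dvd fst v - fst v'" "int n dvd snd v - snd v'"
    by (simp_all add: reduce_mod_def mod_eq_dvd_iff)
  moreover have "a = 0" if "int n dvd a" "\<bar>a\<bar> < int n" for a
  proof (rule ccontr)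
    assume "a \<noteq> 0"
    then have "\<bar>int n\<bar> \<le> \<bar>a\<bar>" using dvd_imp_le_int that(1) by blast
    then show False using that(2) by simp
  qed
  moreover have "\<bar>fst v - fst v'\<bar> < int n" "\<bar>snd v - snd v'\<bar> < int n" using assms(2) by linarith+
  ultimately have "fst v - fst v' = 0" "snd v - snd v' = 0" by blast+
  then show False using assms(1) by (simp add: prod_eq_iff)
qed

lemma free_gen_words_inj:
  assumes X: "infinite X" and w: "w \<in> reduced_words UNIV" "w' \<in> reduced_words UNIV"
    and e: "word_value perms (map (\<lambda>l. (free_gen X (fst l), snd l)) w)
        = word_value perms (map (\<lambda>l. (free_gen X (fst l), snd l)) w')"
  shows "w = w'"
proof (rule ccontr)
  assume "w \<noteq> w'"
  then have ne: "int_word w (1, 1) \<noteq> int_word w' (1, 1)" using int_word_inj[OF w] by blast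
  let ?v = "int_word w (1, 1)" and ?v' = "int_word w' (1, 1)"
  obtain m where m: "m \<in> X" "m > nat (\<bar>fst ?v - fst ?v'\<bar> + \<bar>snd ?v - snd ?v'\<bar>)"
    using X infinite_nat_iff_unbounded by blast
  let ?n = "Suc m"
  have n: "?n \<in> Suc ` X" using m by simp
  have "reduce_mod ?n ?v = reduce_mod ?n ?v'"
    using free_gen_word[OF n, of w "(1, 1)"] free_gen_word[OF n, of w' "(1, 1)"] e by simp
  moreover have "int ?n > \<bar>fst ?v - fst ?v'\<bar> + \<bar>snd ?v - snd ?v'\<bar>" using m(2) by linarith
  ultimately show False using reduce_mod_eventually_inj[OF ne] by blast
qed

lemma free_gen_inj:
  assumes "infinite X" shows "free_gen X c = free_gen X c' \<longleftrightarrow> c = c'"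
proof
  assume e: "free_gen X c = free_gen X c'"
  have "[(c, True)] \<in> reduced_words UNIV" "[(c', True)] \<in> reduced_words UNIV"
    by (simp_all add: reduced_words_Cons)
  then have "[(c, True)] = [(c', True)]" by (rule free_gen_words_inj[OF assms]) (simp add: e)
  then show "c = c'" by simp
qed simp

lemma inj_on_word_value_free_gen:
  assumes "infinite X"
  shows "inj_on (word_value (perms\<lparr>carrier := grpG X\<rparr>)) (reduced_words (range (free_gen X)))"
proof (rule inj_onI)
  let ?G = "perms\<lparr>carrier := grpG X\<rparr>"
  have inj: "inj (free_gen X)" using free_gen_inj[OF assms] by (auto simp: inj_def)
  have pull: "\<exists>v\<in>reduced_words UNIV. w = map (\<lambda>l. (free_gen X (fst l), snd l)) v
      \<and> word_value ?G w = word_value perms w"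
    if "w \<in> reduced_words (range (free_gen X))" for w
    using that
  proof (induction w)
    case Nil
    show ?case by (intro bexI[of _ "[]"]) (simp_all add: reduced_words_Nil)
  next
    case (Cons l w)
    then obtain v where v: "v \<in> reduced_words UNIV" "w = map (\<lambda>l. (free_gen X (fst l), snd l)) v"
        "word_value ?G w = word_value perms w"
      by (auto simp: reduced_words_Cons)
    obtain c where c: "fst l = free_gen X c" using Cons.prems by (auto simp: reduced_words_Cons)
    have "v = [] \<or> hd v \<noteq> letter_inv (c, snd l)"
    proof (rule ccontr)
      assume "\<not> (v = [] \<or> hd v \<noteq> letter_inv (c, snd l))"
      then have "hd w = letter_inv l \<and> w \<noteq> []" using v(2) c by (cases v) (auto simp: letter_inv_def)
      then show False using Cons.prems by (auto simp: reduced_words_Cons)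
    qed
    then have "(c, snd l) # v \<in> reduced_words UNIV" using v(1) by (simp add: reduced_words_Cons)
    moreover have "l # w = map (\<lambda>l. (free_gen X (fst l), snd l)) ((c, snd l) # v)" using v c
      by (simp add: prod_eq_iff)
    moreover have "letter_value ?G l = letter_value perms l"
      using inv_restrict_perm[OF subgroup_grpG free_gen_grpG] by (simp add: letter_value_def c)
    then have "word_value ?G (l # w) = word_value perms (l # w)" using v(3) by simp
    ultimately show ?case by (intro bexI[of _ "(c, snd l) # v"] conjI)
  qed
  fix w w' assume w: "w \<in> reduced_words (range (free_gen X))" "w' \<in> reduced_words (range (free_gen X))"
    and e: "word_value ?G w = word_value ?G w'"
  obtain v v' where v: "v \<in> reduced_words UNIV" "w = map (\<lambda>l. (free_gen X (fst l), snd l)) v"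
      "word_value ?G w = word_value perms w"
    and v': "v' \<in> reduced_words UNIV" "w' = map (\<lambda>l. (free_gen X (fst l), snd l)) v'" "word_value ?G w'
        = word_value perms w'"
    using pull[OF w(1)] pull[OF w(2)] by blast
  then have "v = v'" using e by (intro free_gen_words_inj[OF assms]) simp_all
  then show "w = w'" using v v' by simp
qed

section \<open>Isomorphism classes and the main result\<close>

lemma countable_generate_perm:
  assumes "countable S" shows "countable (generate perms S)"
proof -
  let ?T = "S \<union> (\<lambda>s. inv\<^bsub>perms\<^esub> s) ` S"
  let ?p = "\<lambda>l. foldr (\<circ>) l id"
  have app: "?p (l @ l') = ?p l \<circ> ?p l'" for l l' :: "('a \<Rightarrow> 'a) list"
    by (induction l) (simp_all add: o_assoc)
  have "generate perms S \<subseteq> ?p ` lists ?T"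
  proof
    fix g assume "g \<in> generate perms S"
    then show "g \<in> ?p ` lists ?T"
    proof (induction rule: generate_perm_induct)
      case id
      show ?case by (rule image_eqI[of _ _ "[]"]) simp_all
    next
      case (gen s)
      then show ?case by (intro image_eqI[of _ _ "[s]"]) simp_all
    next
      case (inv s)
      then show ?case by (intro image_eqI[of _ _ "[inv\<^bsub>perms\<^esub> s]"]) simp_all
    next
      case (comp f g)
      then obtain l l' where l: "l \<in> lists ?T" "l' \<in> lists ?T" "f = ?p l" "g = ?p l'" by blast
      have "f \<circ> g = ?p (l @ l')" unfolding app l(3,4) by (rule refl)
      moreover have "l @ l' \<in> lists ?T" using l(1,2) by simp
      ultimately show ?case by (rule image_eqI)
    qed
  qed
  moreover have "countable (lists ?T)" using assms by (intro countable_lists) simp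
  ultimately show ?thesis by (rule countable_subset[OF _ countable_image])
qed

lemma finite_gensG: "finite (gensG X)"
  by (simp add: gensG_def gensA_def)

lemma countable_grpG: "countable (grpG X)"
  unfolding grpG_def by (rule countable_generate_perm[OF countable_finite[OF finite_gensG]])

lemma countable_grpA: "countable grpA"
  using countable_subset[OF grpA_le_grpG countable_grpG] .

abbreviation GA :: "(point \<Rightarrow> point) monoid" where "GA \<equiv> perms\<lparr>carrier := grpA\<rparr>"

abbreviation GG :: "nat set \<Rightarrow> (point \<Rightarrow> point) monoid" where "GG X \<equiv> perms\<lparr>carrier := grpG X\<rparr>"

lemma group_GA: "group GA" by (rule group_restrict_perm[OF subgroup_grpA])

lemma group_GG: "group (GG X)" by (rule group_restrict_perm[OF subgroup_grpG])

text \<open>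
  An element of \<open>A\<close> that overlaps with the last generator of \<open>G X\<close> in block \<open>n\<close> and nowhere else.
\<close>
definition probe :: "nat \<Rightarrow> point \<Rightarrow> point" where
  "probe n = tcycle 2 (\<lambda>m. window_start 0 m + 2) {n}"

lemma probe_grpA: "probe n \<in> grpA"
proof -
  have "shift 2 \<circ> tcycle 2 (window_start 0) {n} \<circ> shift (- 2) = probe n"
    unfolding probe_def
  proof (rule shift_tcycle_conj)
    fix m assume m: "m \<in> {n}" "m > 0"
    show "0 \<le> window_start 0 m \<and> window_start 0 m + 2 < rows m \<and> 0 \<le> window_start 0 m + 2
        \<and> window_start 0 m + 2 + 2 < rows m \<and> (\<exists>j. window_start 0 m + 2 = window_start 0 m + 2 + j * rows
        m)"
      using stride_pos[OF m(2)] by (auto simp: window_start_def intro!: exI[of _ 0])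
  qed
  moreover have "shift 2 \<circ> tcycle 2 (window_start 0) {n} \<circ> shift (- 2) \<in> grpA"
    by (intro subgroup_perm_comp[OF subgroup_grpA] shift_grpA tcycle_window_0_singleton_grpA) simp
  ultimately show ?thesis by (simp only:)
qed

lemma probe_commute_iff:
  assumes "n > 0"
  shows "tcycle 2 (window_start 0) J \<circ> probe n = probe n \<circ> tcycle 2 (window_start 0) J \<longleftrightarrow> n \<notin> J"
proof
  assume n: "n \<notin> J"
  show "tcycle 2 (window_start 0) J \<circ> probe n = probe n \<circ> tcycle 2 (window_start 0) J"
    unfolding probe_def tcycle_def lift_comp by (rule lift_eqI) (use n in auto)
next
  assume e: "tcycle 2 (window_start 0) J \<circ> probe n = probe n \<circ> tcycle 2 (window_start 0) J"
  show "n \<notin> J"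
  proof
    assume J: "n \<in> J"
    \<comment> \<open>A point of the row shared by the two cycles, which they move differently in the two orders.\<close>
    let ?p = "(n, window_start 0 n + 2, (0, 0))"
    have "fst (snd ((tcycle 2 (window_start 0) J \<circ> probe n) ?p)) = fst (snd ((probe n
        \<circ> tcycle 2 (window_start 0) J) ?p))"
      by (simp only: e)
    moreover have "(0, 0) \<in> sheet n" using assms by (simp add: sheet_def)
    ultimately show False using J by (simp add: probe_def tcycle_def lift_apply twist_sheet cyc_def)
  qed
qed

lemma hom_GG_inv:
  assumes "group K" "f \<in> hom (GG X) K" "g \<in> grpG X"
  shows "f (inv\<^bsub>perms\<^esub> g) = inv\<^bsub>K\<^esub> (f g)"
proof -
  interpret group_hom "GG X" K f
    using assms(1,2) group_GG by (simp add: group_hom_def group_hom_axioms_def)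
  show ?thesis using hom_inv[of g] assms(3) inv_restrict_perm[OF subgroup_grpG assms(3)] by simp
qed

lemma hom_eq_on_grpA:
  assumes "group K" and f: "f \<in> hom (GG X) K" and f': "f' \<in> hom (GG X') K"
    and e: "\<And>s. s \<in> gensA \<Longrightarrow> f s = f' s" and g: "g \<in> grpA"
  shows "f g = f' g"
proof -
  have A: "grpA \<subseteq> grpG X" "grpA \<subseteq> grpG X'" by (rule grpA_le_grpG)+
  have hf: "f (g \<circ> h) = f g \<otimes>\<^bsub>K\<^esub> f h" "f' (g \<circ> h) = f' g \<otimes>\<^bsub>K\<^esub> f' h" if "g \<in> grpA" "h \<in> grpA" for g h
    using hom_mult[OF f, of g h] hom_mult[OF f', of g h] subsetD[OF A(1)] subsetD[OF A(2)] that by simp_all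
  have hinv: "f (inv\<^bsub>perms\<^esub> g) = inv\<^bsub>K\<^esub> (f g)" "f' (inv\<^bsub>perms\<^esub> g) = inv\<^bsub>K\<^esub> (f' g)" if "g \<in> grpA" for g
    using hom_GG_inv[OF assms(1) f subsetD[OF A(1) that]] hom_GG_inv[OF assms(1) f' subsetD[OF A(2) that]] .
  have "g \<in> generate perms gensA" using g by (simp add: grpA_def)
  then have "g \<in> grpA \<and> f g = f' g"
  proof (induction rule: generate_perm_induct)
    case id
    have "f id = \<one>\<^bsub>K\<^esub>" "f' id = \<one>\<^bsub>K\<^esub>"
      using hom_one[OF f group_GG assms(1)] hom_one[OF f' group_GG assms(1)] by simp_all
    then show ?case using subgroup_perm_id[OF subgroup_grpA] by (simp only: simp_thms)
  next
    case (gen s)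
    then show ?case using e unfolding grpA_def by (auto intro: generate.incl)
  next
    case (inv s)
    then have "s \<in> grpA" "inv\<^bsub>perms\<^esub> s \<in> grpA" unfolding grpA_def
      by (auto intro: generate.incl generate.inv)
    then show ?case using hinv e[OF inv] by simp
  next
    case (comp f g)
    then show ?case using hf subgroup_perm_comp[OF subgroup_grpA] by metis
  qed
  then show ?thesis by simp
qed

text \<open>
  Choose an isomorphism from each group \<open>G X\<close> in the class to \<open>G Y\<close> and record the images of the
  generators of \<open>A\<close> and of the last generator of \<open>G X\<close>. These five elements of a countable group
  determine the images of all \<open>probe n\<close>, hence which of them commute with the last generator, hence \<open>X\<close>.
\<close>
lemma countable_iso_class: "countable {X. GG X \<cong> GG Y}"
proof -
  let ?C = "{X. GG X \<cong> GG Y}"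
  define \<phi> where "\<phi> X = (SOME f. f \<in> iso (GG X) (GG Y))" for X
  have \<phi>: "\<phi> X \<in> iso (GG X) (GG Y)" if "X \<in> ?C" for X
    using that by (simp add: \<phi>_def is_iso_def some_in_eq)
  have hom: "\<phi> X \<in> hom (GG X) (GG Y)" and inj: "inj_on (\<phi> X) (grpG X)" if "X \<in> ?C" for X
    using \<phi>[OF that] by (auto simp: iso_def bij_betw_def)
  have c_grpG: "tcycle 2 (window_start 0) (Suc ` X) \<in> grpG X" for X unfolding grpG_def
    by (rule generate.incl) (simp add: gensG_def)
  have gG: "gensA \<subseteq> grpG X" for X using grpA_le_grpG[of X] unfolding grpA_def by (auto intro: generate.incl)
  \<comment> \<open>Four generators of \<open>A\<close>, followed by the generator that depends on \<open>X\<close>.\<close>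
  define code where "code X = map (\<phi> X) [shift 1, tcycle 0 (window_start 0) UNIV, tcycle 1 (window_start 1)
      UNIV, tcycle 2 (window_start 2) UNIV, tcycle 2 (window_start 0) (Suc ` X)]" for X
  have "code X \<in> lists (grpG Y)" if "X \<in> ?C" for X
    using hom[OF that] gG[of X] c_grpG[of X] by (auto simp: code_def hom_def gensA_def)
  then have "code ` ?C \<subseteq> lists (grpG Y)" by (rule image_subsetI)
  then have "countable (code ` ?C)" by (rule countable_subset[OF _ countable_lists[OF countable_grpG]])
  moreover have "inj_on code ?C"
  proof (rule inj_onI)
    fix X X' assume X: "X \<in> ?C" and X': "X' \<in> ?C" and e: "code X = code X'"
    have "\<phi> X s = \<phi> X' s" if "s \<in> gensA" for s
      using e that by (auto simp: code_def gensA_def)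
    then have p: "\<phi> X (probe n) = \<phi> X' (probe n)" for n
      using hom_eq_on_grpA[OF group_GG hom[OF X] hom[OF X'] _ probe_grpA] by blast
    have c: "\<phi> X (tcycle 2 (window_start 0) (Suc ` X)) = \<phi> X' (tcycle 2 (window_start 0) (Suc ` X'))"
      using e by (simp add: code_def)
    have detect: "\<phi> Z (tcycle 2 (window_start 0) (Suc ` Z)) \<circ> \<phi> Z (probe (Suc n)) = \<phi> Z (probe (Suc n))
        \<circ> \<phi> Z (tcycle 2 (window_start 0) (Suc ` Z)) \<longleftrightarrow> n \<notin> Z"
      if Z: "Z \<in> ?C" for Z n
    proof -
      have pr: "probe (Suc n) \<in> grpG Z" using probe_grpA grpA_le_grpG by blast
      have h: "\<phi> Z (f \<circ> g) = \<phi> Z f \<circ> \<phi> Z g" if "f \<in> grpG Z" "g \<in> grpG Z" for f g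
        using hom[OF Z] that by (auto simp: hom_def)
      have "n \<notin> Z \<longleftrightarrow> tcycle 2 (window_start 0) (Suc ` Z) \<circ> probe (Suc n) = probe (Suc n)
          \<circ> tcycle 2 (window_start 0) (Suc ` Z)"
        using probe_commute_iff[of "Suc n" "Suc ` Z"] by (simp add: inj_image_mem_iff)
      also have "\<dots> \<longleftrightarrow> \<phi> Z (tcycle 2 (window_start 0) (Suc ` Z) \<circ> probe (Suc n)) = \<phi> Z (probe (Suc n)
          \<circ> tcycle 2 (window_start 0) (Suc ` Z))"
        by (rule inj_on_eq_iff[OF inj[OF Z], symmetric]) (intro subgroup_perm_comp[OF subgroup_grpG] pr
            c_grpG)+
      finally show ?thesis unfolding h[OF pr c_grpG] h[OF c_grpG pr] by blast
    qed
    have "n \<in> X \<longleftrightarrow> n \<in> X'" for n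
      using detect[OF X, of n] detect[OF X', of n] unfolding c p by blast
    then show "X = X'" by blast
  qed
  ultimately show ?thesis by (rule countable_image_inj_on)
qed

lemma uncountable_infinite_sets: "uncountable {X :: nat set. infinite X}"
proof
  assume "countable {X :: nat set. infinite X}"
  then have "countable ({X :: nat set. infinite X} \<union> {X. finite X})" using countable_Collect_finite
    by (intro countable_Un)
  moreover have "{X :: nat set. infinite X} \<union> {X. finite X} = UNIV" by auto
  ultimately have "countable (UNIV :: nat set set)" by simp
  then have "\<exists>f :: nat \<Rightarrow> nat set. range f = UNIV" using uncountable_def[of "UNIV :: nat set set"] by simp
  then have "\<exists>f :: nat \<Rightarrow> nat set. f ` UNIV = Pow UNIV" by simp
  then show False by (rule notE[OF Cantors_theorem])
qed

lemma uncountable_representatives: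
  assumes unc: "uncountable S" and cls: "\<And>x. x \<in> S \<Longrightarrow> countable {y \<in> S. R y x}"
    and refl: "\<And>x. x \<in> S \<Longrightarrow> R x x" and symm: "\<And>x y. x \<in> S \<Longrightarrow> y \<in> S \<Longrightarrow> R x y \<Longrightarrow> R y x"
    and trans: "\<And>x y z. x \<in> S \<Longrightarrow> y \<in> S \<Longrightarrow> z \<in> S \<Longrightarrow> R x y \<Longrightarrow> R y z \<Longrightarrow> R x z"
  shows "\<exists>J \<subseteq> S. uncountable J \<and> (\<forall>x\<in>J. \<forall>y\<in>J. x \<noteq> y \<longrightarrow> \<not> R x y)"
proof -
  define rep where "rep x = (SOME y. y \<in> S \<and> R y x)" for x
  have rep: "rep x \<in> S" "R (rep x) x" if "x \<in> S" for x
    using someI[of "\<lambda>y. y \<in> S \<and> R y x" x] refl[OF that] that unfolding rep_def by auto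
  let ?J = "rep ` S"
  have "x = y" if xy: "x \<in> ?J" "y \<in> ?J" "R x y" for x y
  proof -
    obtain a b where ab: "a \<in> S" "x = rep a" "b \<in> S" "y = rep b" using xy by auto
    have "R a b" using ab xy(3) rep[OF ab(1)] rep[OF ab(3)] symm trans by meson
    then have "(\<lambda>z. z \<in> S \<and> R z a) = (\<lambda>z. z \<in> S \<and> R z b)" using ab(1,3) symm trans by (intro ext) blast
    then show ?thesis unfolding ab(2,4) rep_def by simp
  qed
  moreover have "uncountable ?J"
  proof
    assume "countable ?J"
    then have "countable (\<Union>x\<in>?J. {y \<in> S. R y x})" using cls rep(1) by (intro countable_UN) auto
    moreover have "S \<subseteq> (\<Union>x\<in>?J. {y \<in> S. R y x})" using rep symm by auto
    ultimately show False using unc countable_subset by blast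
  qed
  ultimately show ?thesis using rep(1) by (intro exI[of _ ?J]) auto
qed

lemma generated_GA: "generated_by_at_most 6 GA"
  unfolding generated_by_at_most_def
proof (intro exI conjI)
  have "gensA = set [shift 1, tcycle 0 (window_start 0) UNIV, tcycle 1 (window_start 1) UNIV, tcycle 2
      (window_start 2) UNIV]" by (simp add: gensA_def)
  then show "card gensA \<le> 6" using card_length[of "[shift 1, tcycle 0 (window_start 0) UNIV, tcycle 1
      (window_start 1) UNIV, tcycle 2 (window_start 2) UNIV]"] by simp
  show "gensA \<subseteq> carrier GA" unfolding grpA_def by (auto intro: generate.incl)
  then show "generate GA gensA = carrier GA"
    using group.generate_consistent[OF group_perm _ subgroup_grpA, of gensA] by (simp add: grpA_def)
qed (simp add: gensA_def)

lemma generated_GG: "generated_by_at_most 18 (GG X)"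
  unfolding generated_by_at_most_def
proof (intro exI conjI)
  let ?l = "[tcycle 1 (window_start 0) UNIV, tcycle 2 (window_start 0) (Suc ` X), shift 1, tcycle 0
      (window_start 0) UNIV, tcycle 1 (window_start 1) UNIV, tcycle 2 (window_start 2) UNIV]"
  have "gensG X = set ?l" by (simp add: gensG_def gensA_def insert_commute)
  then show "card (gensG X) \<le> 18" using card_length[of ?l] by simp
  show "gensG X \<subseteq> carrier (GG X)" unfolding grpG_def by (auto intro: generate.incl)
  then show "generate (GG X) (gensG X) = carrier (GG X)"
    using group.generate_consistent[OF group_perm _ subgroup_grpG, of "gensG X" X] by (simp add: grpG_def)
qed (rule finite_gensG)

definition A_nat :: "nat monoid" where
  "A_nat = transport (to_nat_on grpA) GA"

definition G_nat :: "nat set \<Rightarrow> nat monoid" where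
  "G_nat X = transport (to_nat_on (grpG X)) (GG X)"

lemma A_nat: "group A_nat" "to_nat_on grpA \<in> iso GA A_nat"
  using transport_iso[OF group_GA, of "to_nat_on grpA"] inj_on_to_nat_on[OF countable_grpA]
    by (simp_all add: A_nat_def)

lemma G_nat: "group (G_nat X)" "to_nat_on (grpG X) \<in> iso (GG X) (G_nat X)"
  using transport_iso[OF group_GG, of "to_nat_on (grpG X)" X] inj_on_to_nat_on[OF countable_grpG]
    by (simp_all add: G_nat_def)

lemma iso_imp_mon: "f \<in> iso G H \<Longrightarrow> f \<in> mon G H"
  by (auto simp: iso_iff_mon_epi)

lemma A_nat_properties:
  "residually_finite A_nat" "generated_by_at_most 6 A_nat" "amenable A_nat"
  using residually_finite_pullback[OF A_nat(1) group_GA iso_imp_mon[OF group.iso_set_sym[OF group_GA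
      A_nat(2)]]
      residually_finite_tame[OF subgroup_grpA grpA_tame]]
    generated_by_at_most_iso[OF group_GA A_nat generated_GA]
    amenable_iso[OF group_GA A_nat amenable_grpA] by blast+

lemma G_nat_properties:
  "residually_finite (G_nat X)" "generated_by_at_most 18 (G_nat X)"
  using residually_finite_pullback[OF G_nat(1) group_GG iso_imp_mon[OF group.iso_set_sym[OF group_GG
      G_nat(2)]]
      residually_finite_tame[OF subgroup_grpG grpG_tame]]
    generated_by_at_most_iso[OF group_GG G_nat generated_GG] by blast+

lemma G_nat_free:
  assumes "infinite X"
  shows "contains_nonabelian_free_subgroup (G_nat X)" "\<not> amenable (G_nat X)"
proof -
  let ?e = "to_nat_on (grpG X)" and ?F = "range (free_gen X)"
  have F: "?F \<subseteq> grpG X" using free_gen_grpG by auto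
  have bij: "bij_betw ?e (grpG X) (carrier (G_nat X))" using G_nat(2)[of X] by (simp add: iso_def)
  have sub: "?e ` ?F \<subseteq> carrier (G_nat X)" using bij F by (auto simp: bij_betw_def)
  have inj: "inj_on (word_value (G_nat X)) (reduced_words (?e ` ?F))"
    by (rule inj_on_word_value_iso[OF group_GG G_nat _ inj_on_word_value_free_gen[OF assms]]) (use F in
        simp)
  have mem: "?e (free_gen X c) \<in> ?e ` ?F" for c by simp
  have "free_gen X True \<noteq> free_gen X False" using free_gen_inj[OF assms] by simp
  then have ne: "?e (free_gen X True) \<noteq> ?e (free_gen X False)"
    using bij free_gen_grpG[of X] by (auto simp: bij_betw_def inj_on_def)
  show "contains_nonabelian_free_subgroup (G_nat X)"
    by (rule group.contains_nonabelian_free_subgroupI[OF G_nat(1) sub mem mem ne inj])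
  show "\<not> amenable (G_nat X)"
    by (rule group.not_amenable_if_free_pair[OF G_nat(1) sub mem mem ne inj])
qed

definition embedding :: "nat set \<Rightarrow> nat \<Rightarrow> nat" where
  "embedding X = to_nat_on (grpG X) \<circ> (\<lambda>a. a) \<circ> inv_into (carrier GA) (to_nat_on grpA)"

lemma embedding_pair: "grothendieck_pair A_nat (G_nat X) (embedding X)"
  unfolding embedding_def
  by (rule grothendieck_pair_iso[OF group_GA group_GG A_nat(1) G_nat(1) grothendieck_pair_grpA_grpG
        group.iso_set_sym[OF group_GA A_nat(2)] G_nat(2)])

lemma embedding_mon: "embedding X \<in> mon A_nat (G_nat X)"
  using embedding_pair[of X] by (simp add: grothendieck_pair_def)

lemma embedding_profinite_iso: "profinite_iso A_nat (G_nat X) (profinite_map A_nat (G_nat X) (embedding X))"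
  by (rule grothendieck_pair_imp_profinite_iso[OF A_nat(1) G_nat(1) embedding_pair])

lemma iso_G_nat_iff: "G_nat X \<cong> G_nat Y \<longleftrightarrow> GG X \<cong> GG Y"
proof -
  have a: "GG Z \<cong> G_nat Z" for Z using G_nat(2)[of Z] unfolding is_iso_def by blast
  have b: "G_nat Z \<cong> GG Z" for Z using group.iso_sym[OF group_GG a] .
  show ?thesis
  proof
    assume h: "G_nat X \<cong> G_nat Y"
    show "GG X \<cong> GG Y" by (rule iso_trans[OF iso_trans[OF a h] b])
  next
    assume h: "GG X \<cong> GG Y"
    show "G_nat X \<cong> G_nat Y" by (rule iso_trans[OF iso_trans[OF b h] a])
  qed
qed

lemma countable_iso_class_G_nat: "countable {X. G_nat X \<cong> G_nat Y}"
  using countable_iso_class by (simp add: iso_G_nat_iff)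

lemma generated_by_at_most_imp_finitely_generated: "generated_by_at_most k G \<Longrightarrow> finitely_generated G"
  unfolding generated_by_at_most_def finitely_generated_def by blast

theorem theorem1p1:
  shows "(\<exists>(J :: nat set set) (G :: nat set \<Rightarrow> nat monoid) (A :: nat monoid)
            (\<iota> :: nat set \<Rightarrow> nat \<Rightarrow> nat).
           uncountable J \<and>
           (\<forall>j\<in>J. group (G j) \<and> residually_finite (G j) \<and> generated_by_at_most 18 (G j)) \<and>
           (\<forall>i\<in>J. \<forall>j\<in>J. i \<noteq> j \<longrightarrow> \<not> G i \<cong> G j) \<and>
           group A \<and> residually_finite A \<and> generated_by_at_most 6 A \<and>
           (\<forall>j\<in>J. \<iota> j \<in> mon A (G j)) \<and>
           (\<forall>j\<in>J. profinite_iso A (G j) (profinite_map A (G j) (\<iota> j))) \<and>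
           amenable A \<and>
           (\<forall>j\<in>J. contains_nonabelian_free_subgroup (G j)))
       \<and> (\<exists>(H :: nat monoid) (K :: nat monoid).
           group H \<and> finitely_generated H \<and> residually_finite H \<and>
           group K \<and> finitely_generated K \<and> residually_finite K \<and>
           (\<exists>F. profinite_iso H K F) \<and>
           amenable H \<and> \<not> amenable K)"
proof (rule conjI)
  have "\<exists>J \<subseteq> {X :: nat set. infinite X}. uncountable J \<and> (\<forall>X\<in>J. \<forall>Y\<in>J. X \<noteq> Y \<longrightarrow> \<not> G_nat X \<cong> G_nat Y)"
  proof (rule uncountable_representatives[OF uncountable_infinite_sets])
    show "countable {Y \<in> {X. infinite X}. G_nat Y \<cong> G_nat X}" for X
      by (rule countable_subset[OF _ countable_iso_class_G_nat[of X]]) auto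
    show "G_nat X \<cong> G_nat X" for X by (rule iso_refl)
    show "G_nat Y \<cong> G_nat X" if "G_nat X \<cong> G_nat Y" for X Y using group.iso_sym[OF G_nat(1) that] .
    show "G_nat X \<cong> G_nat Z" if "G_nat X \<cong> G_nat Y" "G_nat Y \<cong> G_nat Z" for X Y Z using iso_trans[OF that] .
  qed
  then obtain J where J: "J \<subseteq> {X :: nat set. infinite X}" "uncountable J" "\<forall>X\<in>J. \<forall>Y\<in>J. X \<noteq> Y
      \<longrightarrow> \<not> G_nat X \<cong> G_nat Y"
    by blast
  have "\<forall>j\<in>J. contains_nonabelian_free_subgroup (G_nat j)" using J(1) G_nat_free(1) by auto
  with J(2,3) show "\<exists>(J :: nat set set) (G :: nat set \<Rightarrow> nat monoid) (A :: nat monoid)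
            (\<iota> :: nat set \<Rightarrow> nat \<Rightarrow> nat).
           uncountable J \<and>
           (\<forall>j\<in>J. group (G j) \<and> residually_finite (G j) \<and> generated_by_at_most 18 (G j)) \<and>
           (\<forall>i\<in>J. \<forall>j\<in>J. i \<noteq> j \<longrightarrow> \<not> G i \<cong> G j) \<and>
           group A \<and> residually_finite A \<and> generated_by_at_most 6 A \<and>
           (\<forall>j\<in>J. \<iota> j \<in> mon A (G j)) \<and>
           (\<forall>j\<in>J. profinite_iso A (G j) (profinite_map A (G j) (\<iota> j))) \<and>
           amenable A \<and>
           (\<forall>j\<in>J. contains_nonabelian_free_subgroup (G j))"
    using G_nat(1) G_nat_properties A_nat(1) A_nat_properties embedding_mon embedding_profinite_iso
    by (intro exI[of _ J] exI[of _ G_nat] exI[of _ A_nat] exI[of _ embedding]) simp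
next
  have "group A_nat" "group (G_nat UNIV)" "finitely_generated A_nat" "finitely_generated (G_nat UNIV)"
    using A_nat(1) G_nat(1) generated_by_at_most_imp_finitely_generated A_nat_properties(2)
        G_nat_properties(2) by blast+
  moreover have "\<exists>F. profinite_iso A_nat (G_nat UNIV) F" by (rule exI, rule embedding_profinite_iso)
  ultimately show "\<exists>(H :: nat monoid) (K :: nat monoid).
           group H \<and> finitely_generated H \<and> residually_finite H \<and>
           group K \<and> finitely_generated K \<and> residually_finite K \<and>
           (\<exists>F. profinite_iso H K F) \<and>
           amenable H \<and> \<not> amenable K"
    using A_nat_properties G_nat_properties[of UNIV] G_nat_free(2)[OF infinite_UNIV_nat]
    by (intro exI[of _ A_nat] exI[of _ "G_nat UNIV"]) (simp only: simp_thms)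
qed

end
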